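(* Let $T$ be the planted binary tree, let $s$ be a good size function for $T$, and let $t\in[0,1]$. Let $\mathbb{P}_N^{(s)}$ be the law of the $N$-parameter frozen percolation process on $T$ with size function $s$, let $\mathbb{P}_\infty$ be the law of Aldous' ($\infty$-parameter) frozen percolation process on $T$, and let $\mathcal{C}_t$ denote the open cluster of the root vertex at time $t$. Then $$\mathbb{P}_{N}^{(s)}\left(\mathcal{C}_{t}=C\right)\rightarrow\mathbb{P}_{\infty}\left(\mathcal{C}_{t}=C\right)\quad\text{as }N\rightarrow\infty$$ for all finite clusters $C$. Moreover $$\lim_{k\rightarrow\infty}\limsup_{N\rightarrow\infty}\mathbb{P}_{N}^{(s)}\left(k\leq s\left(\mathcal{C}_{t}\right)<N\right)=0,$$ and hence the probability that the open cluster of the root vertex is frozen also converges: $$\mathbb{P}_{N}^{(s)}\left(N\leq s\left(\mathcal{C}_{t}\right)\right)\rightarrow\mathbb{P}_{\infty}\left(\left|\mathcal{C}_{t}\right|=\infty\right)\quad\text{as }N\rightarrow\infty.$$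
   Context: The planted binary tree $T=(V,E)$ is the infinite tree in which one vertex $v_0$, the root vertex, has degree one and all other vertices have degree three. A cluster is a connected subgraph of $T$ (a single vertex, with no edges, is allowed); its volume $|C|$ is its number of edges. Let $\mathscr{C}$ be the set of finite clusters of $T$. A function $h$ from the vertex set of $T$ into itself is a homomorphism if it maps any edge $(a,b)$, with $a$ closer to the root than $b$, to an edge $(h(a),h(b))$ with $h(a)$ closer to the root than $h(b)$. A good size function is a function $s:\mathscr{C}\to\mathbb{N}$ (with $0\in\mathbb{N}$) such that: 1. (Compatibility with homomorphisms) for all $C\in\mathscr{C}$ and all injective homomorphisms $h$, $s(h(C))=s(C)$; 2. (Finiteness) for all $N\in\mathbb{N}$ and every vertex $v$, the set $\{C\in\mathscr{C} : v\in C,\ s(C)\le N\}$ is finite; 3. (Monotonicity) if $C,C'\in\mathscr{C}$ and $C\subseteq C'$, then $s(C)\le s(C')$; 4. (Boundedness above by the volume) $s(C)\le|C|$ for all $C\in\mathscr{C}$. Let $(\tau_e)_{e\in E}$ be independent random variables, uniform on $[0,1]$. $N$-parameter frozen percolation process with size function $s$ ($N$ a positive integer): at time $0$ all edges are closed. At time $t$, an edge $e=(u,v)$ becomes open if $\tau_e=t$ and the open clusters of $u$ and $v$ at that time (just before $e$ opens) both have size $s(\cdot)$ strictly smaller than $N$; otherwise $e$ stays closed (forever). Open edges stay open. This process exists (it is a finite-range interacting particle system); its law is $\mathbb{P}_N^{(s)}$. The open cluster $\mathcal{C}_t$ of the root vertex at time $t$ is the connected component of $v_0$ in the graph formed by the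 open edges at time $t$; it is called frozen when $s(\mathcal{C}_t)\ge N$. $\infty$-parameter (Aldous') frozen percolation process: at time $0$ all edges are closed, and each edge $e=(u,v)$ becomes open at time $\tau_e$ if the open clusters of $u$ and $v$ at that time are both finite, and otherwise stays closed. Aldous (2000) constructed this process on $T$; $\mathbb{P}_\infty$ is its law. Its one-time marginals for the root cluster (known from Aldous) are as follows: with $$\beta_\infty(t)=\mathbb{P}_\infty(\text{the root edge is closed at time }t)=\begin{cases}1-t & \text{if } t\in[0,1/2],\\ \frac1{4t} & \text{if } t\in[1/2,1],\end{cases}$$ one has $\mathbb{P}_\infty(\mathcal{C}_t=C)=\beta_\infty(t)\,(t\beta_\infty(t))^{|C|}$ for every finite cluster $C$ containing the root vertex $v_0$, and $\mathbb{P}_\infty(|\mathcal{C}_t|=\infty)=1-\sum_{C}\mathbb{P}_\infty(\mathcal{C}_t=C)$, the sum being over all finite clusters $C$ containing $v_0$. *)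

theory Defs
  imports "HOL-Probability.Probability"
begin

text \<open>
  The planted binary tree. \<open>Root\<close> has the single child \<open>Node []\<close>, and \<open>Node w\<close> has the two children
  \<open>Node (False # w)\<close> and \<open>Node (True # w)\<close>. Every edge is stored once, as the pair
  (endpoint closer to the root, endpoint further from the root); connectivity ignores this orientation.
\<close>

datatype vertex = Root | Node "bool list"

type_synonym edge = "vertex \<times> vertex"

fun parent :: "vertex \<Rightarrow> vertex" where
  "parent Root = Root"
| "parent (Node []) = Root"
| "parent (Node (b # w)) = Node w"

definition tree_edges :: "edge set" where
  "tree_edges = {(parent v, v) | v. v \<noteq> Root}"

definition linked :: "edge set \<Rightarrow> (vertex \<times> vertex) set" where
  "linked F = (F \<union> F\<inverse>)\<^sup>*"

type_synonym subgraph = "vertex set \<times> edge set"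

definition cluster :: "subgraph \<Rightarrow> bool" where
  "cluster C \<longleftrightarrow>
     fst C \<noteq> {} \<and> snd C \<subseteq> tree_edges \<and> snd C \<subseteq> fst C \<times> fst C \<and>
     (\<forall>u\<in>fst C. \<forall>v\<in>fst C. (u, v) \<in> linked (snd C))"

definition finite_clusters :: "subgraph set" where
  "finite_clusters = {C. cluster C \<and> finite (fst C)}"

definition volume :: "subgraph \<Rightarrow> nat" where
  "volume C = card (snd C)"

definition homomorphism :: "(vertex \<Rightarrow> vertex) \<Rightarrow> bool" where
  "homomorphism h \<longleftrightarrow> (\<forall>(a, b)\<in>tree_edges. (h a, h b) \<in> tree_edges)"

definition image_subgraph :: "(vertex \<Rightarrow> vertex) \<Rightarrow> subgraph \<Rightarrow> subgraph" where
  "image_subgraph h C = (h ` fst C, map_prod h h ` snd C)"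

text \<open>
  A size function is only meaningful on finite clusters; its values elsewhere are irrelevant, and
  every use below is guarded by membership in \<open>finite_clusters\<close>.
\<close>

definition good_size_function :: "(subgraph \<Rightarrow> nat) \<Rightarrow> bool" where
  "good_size_function s \<longleftrightarrow>
     (\<forall>C\<in>finite_clusters. \<forall>h. homomorphism h \<and> inj h \<longrightarrow> s (image_subgraph h C) = s C) \<and>
     (\<forall>N v. finite {C \<in> finite_clusters. v \<in> fst C \<and> s C \<le> N}) \<and>
     (\<forall>C\<in>finite_clusters. \<forall>C'\<in>finite_clusters.
        fst C \<subseteq> fst C' \<and> snd C \<subseteq> snd C' \<longrightarrow> s C \<le> s C') \<and>
     (\<forall>C\<in>finite_clusters. s C \<le> volume C)"

definition open_cluster :: "edge set \<Rightarrow> vertex \<Rightarrow> subgraph" where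
  "open_cluster F v =
     (let W = {w. (v, w) \<in> linked F} in (W, F \<inter> (W \<times> W)))"

definition iid_uniform :: "'a measure \<Rightarrow> (edge \<Rightarrow> 'a \<Rightarrow> real) \<Rightarrow> bool" where
  "iid_uniform M \<tau> \<longleftrightarrow>
     prob_space.indep_vars M (\<lambda>_. borel) \<tau> tree_edges \<and>
     (\<forall>e\<in>tree_edges. distr M borel (\<tau> e) = uniform_measure lborel {0..1})"

definition open_before :: "(real \<Rightarrow> edge set) \<Rightarrow> real \<Rightarrow> edge set" where
  "open_before A t = (\<Union>r\<in>{0..<t}. A r)"

text \<open>
  A realisation \<open>A\<close> of the dynamics driven by the clocks \<open>\<tau>\<close>, where \<open>A t \<omega>\<close> is the set of edges that
  are open at time \<open>t\<close>. The predicate \<open>G\<close> says which clusters may still grow: an edge opens at its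
  clock time if and only if the clusters of both endpoints just before that time satisfy \<open>G\<close>. The
  rule is only imposed almost surely, since it may be contradictory or ill-posed on a null event, for
  instance when some clock rings at time 0 or there is an infinite chain of dependencies.
\<close>

definition frozen_percolation ::
  "(subgraph \<Rightarrow> bool) \<Rightarrow> 'a measure \<Rightarrow> (edge \<Rightarrow> 'a \<Rightarrow> real) \<Rightarrow> (real \<Rightarrow> 'a \<Rightarrow> edge set) \<Rightarrow> bool" where
  "frozen_percolation G M \<tau> A \<longleftrightarrow>
     prob_space M \<and> iid_uniform M \<tau> \<and>
     (\<forall>t\<in>{0..1}. \<forall>\<omega>\<in>space M. A t \<omega> \<subseteq> tree_edges) \<and>
     (\<forall>t\<in>{0..1}. \<forall>e\<in>tree_edges. {\<omega> \<in> space M. e \<in> A t \<omega>} \<in> sets M) \<and>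
     (AE \<omega> in M.
        A 0 \<omega> = {} \<and>
        (\<forall>t\<in>{0..1}. A t \<omega> =
           {(u, v) \<in> tree_edges. \<tau> (u, v) \<omega> \<le> t \<and>
              G (open_cluster (open_before (\<lambda>r. A r \<omega>) (\<tau> (u, v) \<omega>)) u) \<and>
              G (open_cluster (open_before (\<lambda>r. A r \<omega>) (\<tau> (u, v) \<omega>)) v)}))"

definition N_frozen_percolation ::
  "(subgraph \<Rightarrow> nat) \<Rightarrow> nat \<Rightarrow> 'a measure \<Rightarrow> (edge \<Rightarrow> 'a \<Rightarrow> real) \<Rightarrow> (real \<Rightarrow> 'a \<Rightarrow> edge set) \<Rightarrow> bool" where
  "N_frozen_percolation s N M \<tau> A \<longleftrightarrow>
     frozen_percolation (\<lambda>C. C \<in> finite_clusters \<and> s C < N) M \<tau> A"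

definition infinite_frozen_percolation ::
  "'a measure \<Rightarrow> (edge \<Rightarrow> 'a \<Rightarrow> real) \<Rightarrow> (real \<Rightarrow> 'a \<Rightarrow> edge set) \<Rightarrow> bool" where
  "infinite_frozen_percolation M \<tau> A \<longleftrightarrow> frozen_percolation (\<lambda>C. C \<in> finite_clusters) M \<tau> A"

text \<open>
  The infinite-parameter rule involves infinitely many edges at once, and it is not clear that it
  determines the law of the process. Aldous' process is therefore singled out by its known one-time
  marginals. For \<open>C = ({Root}, {})\<close> the formula says that \<open>beta_infinity t\<close> is the probability that
  the root edge is closed at time \<open>t\<close>.
\<close>

definition beta_infinity :: "real \<Rightarrow> real" where
  "beta_infinity t = (if t \<le> 1/2 then 1 - t else 1 / (4 * t))"

definition Aldous_marginals :: "'a measure \<Rightarrow> (real \<Rightarrow> 'a \<Rightarrow> edge set) \<Rightarrow> bool" where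
  "Aldous_marginals M A \<longleftrightarrow>
     (\<forall>t\<in>{0..1}. \<forall>C\<in>finite_clusters. Root \<in> fst C \<longrightarrow>
        \<P>(\<omega> in M. open_cluster (A t \<omega>) Root = C)
          = beta_infinity t * (t * beta_infinity t) ^ volume C)"

end

theory Submission
  imports Defs
begin

text \<open>
  At time \<open>t\<close> the root cluster equals a given finite cluster \<open>C\<close> with \<open>s C < N\<close> iff the clocks of its
  \<open>n\<close> edges have rung and each of the \<open>n + 1\<close> outer boundary edges is closed in the process run on the
  subtree below it alone; these subtree processes are independent copies of the whole process. Hence
  \<open>P (C\<^sub>t = C) = \<beta> (t * \<beta>) ^ n\<close>, where \<open>\<beta> = \<beta> N t\<close> is the probability that the root edge is closed,
  and everything reduces to \<open>\<beta> N t \<longlonglongrightarrow> beta_infinity t\<close>. The upper bound holds since these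
  probabilities sum to at most 1, while \<open>b * (\<Sum>C. (t * b) ^ |C|) > 1\<close> for every \<open>b > beta_infinity t\<close>.
  For the lower bound, \<open>\<beta> \<ge> 1 - t\<close>, and the rate at which the root edge opens is at most \<open>4 \<beta>\<^sup>2\<close>
  while \<open>t * \<beta> \<le> 1/4\<close>, so that \<open>t * \<beta>\<close> never falls below \<open>1/4\<close> after time \<open>1/2\<close>. Finally,
  a difference quotient of \<open>\<beta>\<close> bounds \<open>P (s C\<^sub>t < N)\<close> from above; in the limit this excludes mass at
  clusters that are large but not frozen.
\<close>

text \<open>The product law rests on a coincidence of two growth conditions. In the whole process
  the upper endpoint of a boundary edge of an unfrozen cluster lies in a cluster of size below
  \<open>N\<close>; in the process of the subtree the same vertex is an isolated planted root.
  Neither prevents the edge from opening, so both processes agree below the edge until it opens. For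
  each \<open>N\<close>, finiteness of \<open>s\<close> gives a finite range of interaction, which
  makes the process a measurable function of the clocks.

  The obstacle is loss of mass: convergence of each cluster probability does not stop mass from
  escaping to ever larger unfrozen clusters. For \<open>t \<le> 1/2\<close> the limits already sum
  to 1. Beyond 1/2 they sum to \<open>1 / (2 * t)\<close>, and the matching upper bound is heuristic
  calculus made discrete: the unfrozen mass is at most \<open>\<beta> - t * \<beta>'\<close>, which
  equals \<open>1 / (2 * t)\<close> for \<open>\<beta> = 1 / (4 * t)\<close>.

  The constants 4 and 1/4 come from the Catalan generating function
  \<open>y = 1 + x * y ^ 2\<close>: it is singular at \<open>x = 1/4\<close> with value 2, of which
  the empty cluster takes 1 and all others together take 1.\<close>

definition edge_to :: "bool list \<Rightarrow> edge" where
  "edge_to w = (parent (Node w), Node w)"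

lemma parent_Node: "parent (Node w) = (if w = [] then Root else Node (tl w))"
  by (cases w) auto

lemma inj_edge_to: "inj edge_to"
  by (auto simp: inj_def edge_to_def)

lemma edge_to_eq_iff [simp]: "edge_to v = edge_to w \<longleftrightarrow> v = w"
  by (auto simp: edge_to_def)

lemma tree_edges_edge_to: "tree_edges = range edge_to"
proof -
  have "v \<noteq> Root \<longleftrightarrow> (\<exists>w. v = Node w)" for v by (cases v) auto
  then show ?thesis by (auto simp: tree_edges_def edge_to_def)
qed

lemma edge_to_mem [simp]: "edge_to w \<in> edge_to ` P \<longleftrightarrow> w \<in> P"
  by (auto simp: inj_image_mem_iff[OF inj_edge_to])

section \<open>Connectivity and open clusters of arbitrary edge sets\<close>

lemma linked_refl [simp]: "(u, u) \<in> linked F"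
  by (simp add: linked_def)

lemma linked_sym: "(u, v) \<in> linked F \<Longrightarrow> (v, u) \<in> linked F"
  unfolding linked_def by (rule symD[OF sym_rtrancl[OF sym_Un_converse]])

lemma linked_trans: "(u, v) \<in> linked F \<Longrightarrow> (v, w) \<in> linked F \<Longrightarrow> (u, w) \<in> linked F"
  unfolding linked_def by (rule rtrancl_trans)

lemma linked_mono: "F \<subseteq> F' \<Longrightarrow> linked F \<subseteq> linked F'"
  unfolding linked_def by (intro rtrancl_mono) auto

lemma linked_edge: "(u, v) \<in> F \<Longrightarrow> (u, v) \<in> linked F"
  unfolding linked_def by auto

lemma linked_closed:
  assumes "(u, v) \<in> linked F" "u \<in> V"
    and "\<And>a b. (a, b) \<in> F \<Longrightarrow> a \<in> V \<longleftrightarrow> b \<in> V"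
  shows "v \<in> V"
  using assms(1) unfolding linked_def
  by (induction rule: rtrancl_induct) (use assms in auto)

lemma mem_open_cluster: "v \<in> fst (open_cluster F u) \<longleftrightarrow> (u, v) \<in> linked F"
  by (simp add: open_cluster_def Let_def)

lemma snd_open_cluster:
  "snd (open_cluster F u) = {(a, b) \<in> F. (u, a) \<in> linked F \<and> (u, b) \<in> linked F}"
  by (auto simp: open_cluster_def Let_def)

text \<open>A path that starts in \<open>V\<close> meets only edges touching \<open>V\<close>, so
  \<open>F\<close> and \<open>F'\<close> need not be compared anywhere else. Locality of clusters is
  derived from this induction.\<close>

lemma linked_restrict:
  assumes "(u, v) \<in> linked F" "u \<in> V"
    and "\<And>a b. (a, b) \<in> F \<Longrightarrow> a \<in> V \<or> b \<in> V \<Longrightarrow> (a, b) \<in> F' \<and> a \<in> V \<and> b \<in> V"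
  shows "(u, v) \<in> linked F' \<and> v \<in> V"
  using assms(1) unfolding linked_def
proof (induction rule: rtrancl_induct)
  case base
  then show ?case using assms by auto
next
  case (step y z)
  then have "(y, z) \<in> F' \<union> F'\<inverse>" "z \<in> V" using assms(3) by auto
  then show ?case using step by (auto intro: rtrancl_into_rtrancl)
qed

lemma open_cluster_edge_in:
  "(a, b) \<in> F \<Longrightarrow> a \<in> fst (open_cluster F u) \<or> b \<in> fst (open_cluster F u) \<Longrightarrow>
    a \<in> fst (open_cluster F u) \<and> b \<in> fst (open_cluster F u)"
  using linked_trans[of u a F b] linked_trans[of u b F a] linked_edge[of a b F] linked_sym[of a b F]
  unfolding mem_open_cluster by blast

text \<open>Exploring the cluster of \<open>u\<close> in \<open>F\<close> reveals only the edges
  that touch it, so agreement on those edges fixes the cluster in \<open>F'\<close> as well.\<close>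

lemma open_cluster_cong:
  assumes "\<And>a b. a \<in> fst (open_cluster F u) \<or> b \<in> fst (open_cluster F u) \<Longrightarrow>
      (a, b) \<in> F \<longleftrightarrow> (a, b) \<in> F'"
  shows "open_cluster F' u = open_cluster F u"
proof -
  let ?V = "fst (open_cluster F u)"
  have u: "u \<in> ?V" by (simp add: mem_open_cluster)
  have 1: "(u, v) \<in> linked F' \<and> v \<in> ?V" if "(u, v) \<in> linked F" for v
    by (rule linked_restrict[OF that u]) (metis assms open_cluster_edge_in)
  have 2: "(u, v) \<in> linked F \<and> v \<in> ?V" if "(u, v) \<in> linked F'" for v
    by (rule linked_restrict[OF that u]) (metis assms open_cluster_edge_in)
  have 3: "(u, v) \<in> linked F' \<longleftrightarrow> (u, v) \<in> linked F" for v using 1 2 by blast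
  have "fst (open_cluster F' u) = ?V" by (auto simp: mem_open_cluster 3)
  moreover have "snd (open_cluster F' u) = snd (open_cluster F u)"
    unfolding snd_open_cluster 3 using assms by (auto simp: mem_open_cluster)
  ultimately show ?thesis by (rule prod_eqI)
qed

lemma cluster_open_cluster:
  assumes "F \<subseteq> tree_edges" shows "cluster (open_cluster F u)"
proof -
  have "(u, v) \<in> linked (snd (open_cluster F u))" if "(u, v) \<in> linked F" for v
  proof -
    have "(u, v) \<in> linked (snd (open_cluster F u)) \<and> v \<in> fst (open_cluster F u)"
    proof (rule linked_restrict[OF that])
      show "u \<in> fst (open_cluster F u)" by (simp add: mem_open_cluster)
      show "(a, b) \<in> snd (open_cluster F u) \<and> a \<in> fst (open_cluster F u) \<and> b \<in> fst (open_cluster F u)"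
        if "(a, b) \<in> F" "a \<in> fst (open_cluster F u) \<or> b \<in> fst (open_cluster F u)" for a b
        using that open_cluster_edge_in[OF that] by (auto simp: snd_open_cluster mem_open_cluster)
    qed
    then show ?thesis by simp
  qed
  then have "(v, w) \<in> linked (snd (open_cluster F u))"
    if "(u, v) \<in> linked F" "(u, w) \<in> linked F" for v w
    using that by (meson linked_sym linked_trans)
  then have "\<forall>v\<in>fst (open_cluster F u). \<forall>w\<in>fst (open_cluster F u). (v, w) \<in> linked (snd (open_cluster F u))"
    by (simp add: mem_open_cluster)
  moreover have "u \<in> fst (open_cluster F u)" by (simp add: mem_open_cluster)
  moreover have "snd (open_cluster F u) \<subseteq> F" "snd (open_cluster F u) \<subseteq> fst (open_cluster F u) \<times> fst (open_cluster F u)"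
    by (auto simp: mem_open_cluster snd_open_cluster)
  ultimately show ?thesis
    using assms unfolding cluster_def by blast
qed

text \<open>A path in the image is lifted edge by edge; injectivity makes consecutive lifted edges
  meet in one vertex.\<close>

lemma linked_image:
  assumes "inj h"
  shows "(h u, y) \<in> linked (map_prod h h ` F) \<longleftrightarrow> (\<exists>v. y = h v \<and> (u, v) \<in> linked F)"
proof
  assume "(h u, y) \<in> linked (map_prod h h ` F)"
  then show "\<exists>v. y = h v \<and> (u, v) \<in> linked F"
    unfolding linked_def
  proof (induction rule: rtrancl_induct)
    case (step y z)
    then obtain v where v: "y = h v" "(u, v) \<in> (F \<union> F\<inverse>)\<^sup>*" by blast
    obtain a b where ab: "(a, b) \<in> F" "(y, z) = (h a, h b) \<or> (y, z) = (h b, h a)" using step by auto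
    have inj: "h c = h d \<longleftrightarrow> c = d" for c d using assms by (rule inj_eq)
    from ab(2) show ?case
    proof
      assume "(y, z) = (h a, h b)"
      then have "a = v" "z = h b" using v(1) inj by auto
      moreover have "(u, b) \<in> (F \<union> F\<inverse>)\<^sup>*"
        using v(2) ab(1) \<open>a = v\<close> by (auto intro: rtrancl_into_rtrancl)
      ultimately show ?thesis by blast
    next
      assume "(y, z) = (h b, h a)"
      then have "b = v" "z = h a" using v(1) inj by auto
      moreover have "(u, a) \<in> (F \<union> F\<inverse>)\<^sup>*"
        using v(2) ab(1) \<open>b = v\<close> by (auto intro: rtrancl_into_rtrancl)
      ultimately show ?thesis by blast
    qed
  qed auto
next
  have "(h u, h v) \<in> linked (map_prod h h ` F)" if "(u, v) \<in> linked F" for v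
    using that unfolding linked_def
  proof (induction rule: rtrancl_induct)
    case (step y z)
    then have "(h y, h z) \<in> map_prod h h ` F \<union> (map_prod h h ` F)\<inverse>" by force
    with step(3) show ?case by (rule rtrancl_into_rtrancl)
  qed simp
  then show "\<exists>v. y = h v \<and> (u, v) \<in> linked F \<Longrightarrow> (h u, y) \<in> linked (map_prod h h ` F)" by auto
qed

lemma open_cluster_image:
  assumes "inj h"
  shows "open_cluster (map_prod h h ` F) (h u) = image_subgraph h (open_cluster F u)"
proof (rule prod_eqI)
  show "fst (open_cluster (map_prod h h ` F) (h u)) = fst (image_subgraph h (open_cluster F u))"
    by (auto simp: mem_open_cluster image_subgraph_def linked_image[OF assms])
  show "snd (open_cluster (map_prod h h ` F) (h u)) = snd (image_subgraph h (open_cluster F u))"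
    unfolding snd_open_cluster image_subgraph_def linked_image[OF assms]
    by (auto simp: inj_eq[OF assms] image_iff) (metis map_prod_simp)
qed

text \<open>The embedding of the planted tree onto the subtree whose root edge is \<open>edge_to w\<close>.\<close>

definition subtree_map :: "bool list \<Rightarrow> vertex \<Rightarrow> vertex" where
  "subtree_map w v = (case v of Root \<Rightarrow> parent (Node w) | Node u \<Rightarrow> Node (u @ w))"

lemma subtree_map_simps [simp]: "subtree_map w Root = parent (Node w)" "subtree_map w (Node u) = Node (u @ w)"
  by (simp_all add: subtree_map_def)

lemma subtree_map_parent: "subtree_map w (parent (Node u)) = parent (Node (u @ w))"
  by (cases u) auto

lemma subtree_map_edge_to: "map_prod (subtree_map w) (subtree_map w) (edge_to u) = edge_to (u @ w)"
  by (simp add: edge_to_def subtree_map_parent)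

lemma inj_subtree_map: "inj (subtree_map w)"
proof (rule injI)
  fix a b assume "subtree_map w a = subtree_map w b"
  moreover have "parent (Node w) \<noteq> Node (u @ w)" for u
    by (cases w) (auto dest: arg_cong[of _ _ length])
  ultimately show "a = b" by (cases a; cases b) (auto simp: eq_commute)
qed

lemma homomorphism_subtree_map: "homomorphism (subtree_map w)"
  unfolding homomorphism_def tree_edges_edge_to
proof (clarify)
  fix a b u assume "(a, b) = edge_to u"
  then have "(subtree_map w a, subtree_map w b) = edge_to (u @ w)" using subtree_map_edge_to[of w u] by (simp add: edge_to_def)
  then show "(subtree_map w a, subtree_map w b) \<in> range edge_to" by (rule range_eqI)
qed

text \<open>\<open>parent\<close> removes the head of a word, so words are read from the vertex
  towards the root and the subtree below \<open>Node w\<close> consists of the words with suffix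
  \<open>w\<close>.\<close>

definition descendants :: "bool list \<Rightarrow> vertex set" where
  "descendants w = {Node (p @ w) | p. True}"

lemma parent_in_descendants:
  assumes "q \<noteq> w" shows "parent (Node q) \<in> descendants w \<longleftrightarrow> Node q \<in> descendants w"
proof (cases q)
  case Nil
  then show ?thesis using assms by (auto simp: descendants_def)
next
  case (Cons b r)
  have "(\<exists>p. b # r = p @ w) \<longleftrightarrow> (\<exists>p. r = p @ w)"
    using assms Cons by (metis Cons_eq_append_conv append_Cons)
  then show ?thesis using Cons by (simp add: descendants_def)
qed

text \<open>\<open>edge_to w\<close> is the only edge with exactly one endpoint in
  \<open>descendants w\<close>. This is the form in which the absence of cycles enters.\<close>

lemma linked_descendants:
  assumes "(u, v) \<in> linked (edge_to ` P)" "w \<notin> P" "u \<in> descendants w" shows "v \<in> descendants w"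
  using assms(1,3)
proof (rule linked_closed)
  fix a b assume "(a, b) \<in> edge_to ` P"
  then obtain q where "q \<in> P" "a = parent (Node q)" "b = Node q" by (auto simp: edge_to_def)
  then show "a \<in> descendants w \<longleftrightarrow> b \<in> descendants w"
    using assms(2) parent_in_descendants[of q w] by metis
qed

text \<open>
  Edges are identified with the words naming their lower endpoints. A finite cluster is then a
  suffix-closed set \<open>W\<close> of words: \<open>cluster_at_root W\<close> contains \<open>Root\<close>, and \<open>cluster_below_root W\<close> has top vertex \<open>Node []\<close>,
  so it does not use the edge of the word \<open>[]\<close>.
\<close>

definition cluster_at_root :: "bool list set \<Rightarrow> subgraph" where
  "cluster_at_root W = (insert Root (Node ` W), edge_to ` W)"

definition cluster_below_root :: "bool list set \<Rightarrow> subgraph" where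
  "cluster_below_root W = (Node ` W, edge_to ` (W - {[]}))"

definition suffix_closed :: "bool list set \<Rightarrow> bool" where
  "suffix_closed W \<longleftrightarrow> finite W \<and> (\<forall>w\<in>W. w \<noteq> [] \<longrightarrow> tl w \<in> W)"

lemma linked_cluster_at_root: "suffix_closed W \<Longrightarrow> w \<in> W \<Longrightarrow> (Root, Node w) \<in> linked (edge_to ` W)"
proof (induction w)
  case Nil
  then have "(Root, Node []) \<in> edge_to ` W" by (intro image_eqI[of _ _ "[]"]) (auto simp: edge_to_def)
  then show ?case by (rule linked_edge)
next
  case (Cons b w)
  then have "(Root, Node w) \<in> linked (edge_to ` W)" by (auto simp: suffix_closed_def)
  moreover have "(Node w, Node (b # w)) \<in> edge_to ` W"
    using Cons(3) by (intro image_eqI[of _ _ "b # w"]) (auto simp: edge_to_def)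
  ultimately show ?case by (rule linked_trans[OF _ linked_edge])
qed

lemma linked_cluster_below_root: "suffix_closed W \<Longrightarrow> w \<in> W \<Longrightarrow> (Node [], Node w) \<in> linked (edge_to ` (W - {[]}))"
proof (induction w)
  case (Cons b w)
  then have "(Node [], Node w) \<in> linked (edge_to ` (W - {[]}))" by (auto simp: suffix_closed_def)
  moreover have "(Node w, Node (b # w)) \<in> edge_to ` (W - {[]})"
    using Cons(3) by (intro image_eqI[of _ _ "b # w"]) (auto simp: edge_to_def)
  ultimately show ?case by (rule linked_trans[OF _ linked_edge])
qed simp

lemma edge_to_in_cluster_at_root:
  assumes "suffix_closed W" "w \<in> W" shows "parent (Node w) \<in> insert Root (Node ` W)"
  using assms by (auto simp: suffix_closed_def parent_Node)

lemma open_cluster_cluster_at_root: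
  assumes "suffix_closed W" shows "open_cluster (edge_to ` W) Root = cluster_at_root W"
proof -
  have 1: "v \<in> insert Root (Node ` W)" if "(Root, v) \<in> linked (edge_to ` W)" for v
    using that by (rule linked_closed) (use assms edge_to_in_cluster_at_root in \<open>auto simp: edge_to_def\<close>)
  have 2: "(Root, v) \<in> linked (edge_to ` W) \<longleftrightarrow> v \<in> insert Root (Node ` W)" for v
    using 1 linked_cluster_at_root[OF assms] by auto
  show ?thesis
  proof (rule prod_eqI)
    show "fst (open_cluster (edge_to ` W) Root) = fst (cluster_at_root W)"
      by (auto simp: mem_open_cluster cluster_at_root_def 2)
    show "snd (open_cluster (edge_to ` W) Root) = snd (cluster_at_root W)"
      using edge_to_in_cluster_at_root[OF assms] unfolding snd_open_cluster cluster_at_root_def 2 by (auto simp: edge_to_def)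
  qed
qed

lemma open_cluster_cluster_below_root:
  assumes "suffix_closed W" "[] \<in> W" shows "open_cluster (edge_to ` (W - {[]})) (Node []) = cluster_below_root W"
proof -
  have p: "w \<in> W - {[]} \<Longrightarrow> parent (Node w) \<in> Node ` W" for w
    using assms by (auto simp: suffix_closed_def parent_Node)
  have 1: "v \<in> Node ` W" if "(Node [], v) \<in> linked (edge_to ` (W - {[]}))" for v
    using that by (rule linked_closed) (use assms p in \<open>auto simp: edge_to_def\<close>)
  have 2: "(Node [], v) \<in> linked (edge_to ` (W - {[]})) \<longleftrightarrow> v \<in> Node ` W" for v
    using 1 linked_cluster_below_root[OF assms(1)] by auto
  show ?thesis
  proof (rule prod_eqI)
    show "fst (open_cluster (edge_to ` (W - {[]})) (Node [])) = fst (cluster_below_root W)"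
      by (auto simp: mem_open_cluster cluster_below_root_def 2)
    show "snd (open_cluster (edge_to ` (W - {[]})) (Node [])) = snd (cluster_below_root W)"
      using p unfolding snd_open_cluster cluster_below_root_def 2 by (auto simp: edge_to_def)
  qed
qed

lemma edge_to_range: "edge_to ` P \<subseteq> tree_edges"
  by (auto simp: tree_edges_edge_to)

lemma cluster_at_root_finite_cluster:
  assumes "suffix_closed W" shows "cluster_at_root W \<in> finite_clusters"
proof -
  have "cluster (cluster_at_root W)"
    using cluster_open_cluster[OF edge_to_range, of W Root] unfolding open_cluster_cluster_at_root[OF assms] .
  moreover have "finite (fst (cluster_at_root W))" using assms by (simp add: cluster_at_root_def suffix_closed_def)
  ultimately show ?thesis by (simp add: finite_clusters_def)
qed

lemma cluster_below_root_finite_cluster: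
  assumes "suffix_closed W" "[] \<in> W" shows "cluster_below_root W \<in> finite_clusters"
proof -
  have "cluster (cluster_below_root W)"
    using cluster_open_cluster[OF edge_to_range, of "W - {[]}" "Node []"]
    unfolding open_cluster_cluster_below_root[OF assms] .
  moreover have "finite (fst (cluster_below_root W))" using assms by (simp add: cluster_below_root_def suffix_closed_def)
  ultimately show ?thesis by (simp add: finite_clusters_def)
qed

lemma cluster_at_root_eq_iff [simp]: "cluster_at_root W = cluster_at_root W' \<longleftrightarrow> W = W'"
  using inj_image_eq_iff[OF inj_edge_to, of W W'] by (auto simp only: cluster_at_root_def prod.inject)

lemma cluster_below_root_eq_iff [simp]: "cluster_below_root W = cluster_below_root W' \<longleftrightarrow> W = W'"
proof -
  have "inj Node" by (rule injI) simp
  from inj_image_eq_iff[OF this, of W W'] show ?thesis by (auto simp only: cluster_below_root_def prod.inject)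
qed

lemma volume_cluster_at_root: "volume (cluster_at_root W) = card W"
  using card_image[OF inj_on_subset[OF inj_edge_to subset_UNIV], of W] by (simp add: volume_def cluster_at_root_def)

section \<open>Description of arbitrary finite clusters by words\<close>

lemma cluster_eq_open_cluster:
  assumes "cluster C" "u \<in> fst C" shows "open_cluster (snd C) u = C"
proof (rule prod_eqI)
  have sub: "snd C \<subseteq> fst C \<times> fst C" using assms(1) by (simp only: cluster_def)
  have "v \<in> fst C" if "(u, v) \<in> linked (snd C)" for v
    using that assms(2) by (rule linked_closed) (use sub in blast)
  moreover have "(u, v) \<in> linked (snd C)" if "v \<in> fst C" for v
    using that assms(1,2) unfolding cluster_def by blast
  ultimately have 2: "(u, v) \<in> linked (snd C) \<longleftrightarrow> v \<in> fst C" for v by blast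
  show "fst (open_cluster (snd C) u) = fst C" by (auto simp only: mem_open_cluster 2)
  show "snd (open_cluster (snd C) u) = snd C"
    using sub unfolding snd_open_cluster 2 by blast
qed

text \<open>A path from \<open>Root\<close> has to enter the subtree below \<open>Node w\<close>
  through \<open>edge_to w\<close>, so that edge is present and its upper endpoint is reached
  too.\<close>

lemma cluster_root_words:
  assumes "(Root, Node w) \<in> linked (edge_to ` P)"
  shows "w \<in> P \<and> (Root, parent (Node w)) \<in> linked (edge_to ` P)"
proof -
  have "w \<in> P"
  proof (rule ccontr)
    assume "w \<notin> P"
    moreover have "Node w \<in> descendants w" by (force simp: descendants_def)
    ultimately have "Root \<in> descendants w" using linked_descendants linked_sym assms by blast
    then show False by (auto simp: descendants_def)
  qed
  moreover have "(Node w, parent (Node w)) \<in> linked (edge_to ` P)"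
    using \<open>w \<in> P\<close> by (intro linked_sym[OF linked_edge]) (force simp: edge_to_def)
  ultimately show ?thesis using assms linked_trans by blast
qed

lemma cluster_eq_cluster_at_root:
  assumes "C \<in> finite_clusters" "Root \<in> fst C"
  obtains W where "suffix_closed W" "C = cluster_at_root W"
proof -
  have C: "cluster C" "finite (fst C)" using assms by (auto simp: finite_clusters_def)
  have "snd C \<subseteq> range edge_to" using C(1) by (simp add: cluster_def tree_edges_edge_to)
  then obtain P where P: "snd C = edge_to ` P" by (meson subset_imageE)
  define W where "W = {w. Node w \<in> fst C}"
  have mem: "v \<in> fst C \<longleftrightarrow> (Root, v) \<in> linked (edge_to ` P)" for v
    using cluster_eq_open_cluster[OF C(1) assms(2)] P mem_open_cluster by metis
  have W: "w \<in> P \<and> parent (Node w) \<in> fst C" if "w \<in> W" for w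
    using that cluster_root_words[of w P] by (auto simp: W_def mem)
  have "w \<in> W" if "w \<in> P" for w
  proof -
    have "edge_to w \<in> fst C \<times> fst C" using C(1) that P unfolding cluster_def by blast
    then show ?thesis by (simp add: edge_to_def W_def)
  qed
  then have "P = W" using W by blast
  have "finite W" using C(2) unfolding W_def by (rule finite_subset[OF _ finite_vimageI[of _ Node], rotated])
      (auto simp: inj_def)
  moreover have "tl w \<in> W" if "w \<in> W" "w \<noteq> []" for w
    using W[OF that(1)] that by (auto simp: W_def parent_Node)
  moreover have "fst C = insert Root (Node ` W)"
  proof -
    have "v \<in> fst C \<longleftrightarrow> v \<in> insert Root (Node ` W)" for v
      by (cases v) (use assms in \<open>auto simp: W_def\<close>)
    then show ?thesis by blast
  qed
  ultimately show ?thesis using that[of W] P \<open>P = W\<close> by (auto simp: suffix_closed_def cluster_at_root_def prod_eq_iff)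
qed

text \<open>The vertex \<open>Node z\<close> with the shortest word is the top: the edge above it
  would lead to a shorter word or to \<open>Root\<close>. Invariance of \<open>s\<close> under
  \<open>subtree_map z\<close> then reduces questions about size to clusters through
  \<open>Root\<close> or \<open>Node []\<close>.\<close>

lemma cluster_top:
  assumes "C \<in> finite_clusters" "Root \<notin> fst C"
  obtains z C' where "C' \<in> finite_clusters" "Node [] \<in> fst C'" "C = image_subgraph (subtree_map z) C'"
    "fst C \<subseteq> descendants z"
proof -
  have C: "cluster C" "finite (fst C)" using assms by (auto simp: finite_clusters_def)
  have "\<exists>w. Node w \<in> fst C"
    using C(1) assms(2) unfolding cluster_def by (metis all_not_in_conv vertex.exhaust)
  then obtain z where z: "Node z \<in> fst C" "\<And>w. Node w \<in> fst C \<Longrightarrow> length z \<le> length w"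
    using ex_has_least_nat[of "\<lambda>w. Node w \<in> fst C" _ length] by blast
  have "snd C \<subseteq> range edge_to" using C(1) by (simp add: cluster_def tree_edges_edge_to)
  then obtain P where P: "snd C = edge_to ` P" by (meson subset_imageE)
  have zP: "z \<notin> P"
  proof
    assume "z \<in> P"
    then have "edge_to z \<in> snd C" by (simp add: P)
    then have "edge_to z \<in> fst C \<times> fst C" using C(1) unfolding cluster_def by blast
    then have "z \<noteq> []" "Node (tl z) \<in> fst C"
      using assms(2) by (auto simp: edge_to_def parent_Node split: if_splits)
    then show False using z(2)[of "tl z"] by (cases z) auto
  qed
  have sub: "v \<in> descendants z" if "v \<in> fst C" for v
  proof -
    have "(Node z, v) \<in> linked (edge_to ` P)" using C(1) z(1) that P unfolding cluster_def by metis
    then show ?thesis using zP linked_descendants[of "Node z" v P z] by (force simp: descendants_def)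
  qed
  define Q where "Q = {p. p @ z \<in> P}"
  have Q: "snd C = map_prod (subtree_map z) (subtree_map z) ` (edge_to ` Q)"
  proof -
    have "\<exists>p. w = p @ z" if "w \<in> P" for w
    proof -
      have "edge_to w \<in> fst C \<times> fst C" using that P C(1) unfolding cluster_def by blast
      then show ?thesis using sub by (auto simp: edge_to_def descendants_def)
    qed
    then have "P = (\<lambda>p. p @ z) ` Q" by (auto simp: Q_def)
    then show ?thesis using P by (simp add: image_image subtree_map_edge_to)
  qed
  define C' where "C' = open_cluster (edge_to ` Q) (Node [])"
  have eq: "C = image_subgraph (subtree_map z) C'"
    using cluster_eq_open_cluster[OF C(1) z(1)] open_cluster_image[OF inj_subtree_map, of z "edge_to ` Q" "Node []"]
    by (simp add: Q C'_def)
  have "finite (fst C')"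
    using C(2) unfolding eq by (auto simp: image_subgraph_def finite_image_iff inj_on_subset[OF inj_subtree_map])
  then have "C' \<in> finite_clusters"
    by (simp add: finite_clusters_def C'_def cluster_open_cluster edge_to_range)
  moreover have "Node [] \<in> fst C'" by (simp add: C'_def mem_open_cluster)
  ultimately show ?thesis using that[of C' z] eq sub by blast
qed

section \<open>Dynamics driven by deterministic clocks\<close>

definition outer_boundary :: "bool list set \<Rightarrow> bool list set" where
  "outer_boundary W = {w. w \<notin> W \<and> (w = [] \<or> tl w \<in> W)}"

lemma outer_boundary_eq: "outer_boundary W = insert [] ((\<lambda>(b, w). b # w) ` (UNIV \<times> W)) - W"
proof -
  have "w \<in> outer_boundary W \<longleftrightarrow> w \<in> insert [] ((\<lambda>(b, w). b # w) ` (UNIV \<times> W)) - W" for w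
    by (cases w) (auto simp: outer_boundary_def)
  then show ?thesis by blast
qed

lemma finite_outer_boundary: "suffix_closed W \<Longrightarrow> finite (outer_boundary W)"
  by (simp add: outer_boundary_eq suffix_closed_def)

text \<open>\<open>[]\<close> together with the two children of each word of \<open>W\<close> makes
  \<open>2 * card W + 1\<close> words, and \<open>W\<close> is contained in this set.\<close>

lemma card_outer_boundary:
  assumes "suffix_closed W" shows "card (outer_boundary W) = card W + 1"
proof -
  let ?X = "(\<lambda>(b :: bool, w). b # w) ` (UNIV \<times> W)"
  have fin: "finite W" using assms by (simp add: suffix_closed_def)
  have "card ?X = 2 * card W"
    by (subst card_image) (auto simp: inj_on_def card_cartesian_product)
  then have "card (insert [] ?X) = 2 * card W + 1"
    using fin by (subst card_insert_disjoint) auto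
  moreover have "W \<subseteq> insert [] ?X"
  proof
    fix w assume "w \<in> W"
    then show "w \<in> insert [] ?X" using assms by (cases w) (auto simp: suffix_closed_def image_iff)
  qed
  ultimately show ?thesis using fin by (simp add: outer_boundary_eq card_Diff_subset)
qed

lemma suffix_in_suffix_closed: "suffix_closed W \<Longrightarrow> p @ w \<in> W \<Longrightarrow> w \<in> W"
proof (induction p)
  case (Cons b p)
  then have "p @ w \<in> W" unfolding suffix_closed_def by force
  then show ?case using Cons by simp
qed simp

lemma finite_words_le: "finite {p :: bool list. length p \<le> n}"
  using finite_lists_length_le[of "UNIV :: bool set" n] by simp

definition shift :: "bool list \<Rightarrow> (bool list \<Rightarrow> 'a) \<Rightarrow> bool list \<Rightarrow> 'a" where
  "shift w x = (\<lambda>p. x (p @ w))"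

locale freezing =
  fixes s :: "subgraph \<Rightarrow> nat" and N :: nat
  assumes gs: "good_size_function s" and N_pos: "0 < N"
begin

definition growable :: "bool list set \<Rightarrow> vertex \<Rightarrow> bool" where
  "growable P u \<longleftrightarrow> open_cluster (edge_to ` P) u \<in> finite_clusters \<and> s (open_cluster (edge_to ` P) u) < N"

text \<open>\<open>Q\<close> is a candidate for the set of all edges that ever open. Only its edges
  with earlier clocks are visible to \<open>e\<close>, so the fixed points of \<open>step x\<close>
  are the solutions of the opening rule.\<close>

definition step :: "(bool list \<Rightarrow> real) \<Rightarrow> bool list set \<Rightarrow> bool list set" where
  "step x Q = {e. growable {f \<in> Q. x f < x e} (parent (Node e)) \<and> growable {f \<in> Q. x f < x e} (Node e)}"

lemma size_image: "C \<in> finite_clusters \<Longrightarrow> s (image_subgraph (subtree_map w) C) = s C"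
  using gs inj_subtree_map homomorphism_subtree_map by (simp add: good_size_function_def)

lemma size_mono:
  "C \<in> finite_clusters \<Longrightarrow> C' \<in> finite_clusters \<Longrightarrow> fst C \<subseteq> fst C' \<Longrightarrow> snd C \<subseteq> snd C' \<Longrightarrow> s C \<le> s C'"
  using gs by (simp add: good_size_function_def)

lemma size_finite: "finite {C \<in> finite_clusters. v \<in> fst C \<and> s C \<le> k}"
  using gs by (simp add: good_size_function_def)

lemma size_volume: "C \<in> finite_clusters \<Longrightarrow> s C \<le> volume C"
  using gs by (simp add: good_size_function_def)

section \<open>Growable clusters: inheritance, self-similarity and bounded depth\<close>

lemma growable_subset:
  assumes "C \<in> finite_clusters" "s C < N"
    and "fst (open_cluster (edge_to ` P) u) \<subseteq> fst C" "snd (open_cluster (edge_to ` P) u) \<subseteq> snd C"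
  shows "growable P u"
proof -
  have "open_cluster (edge_to ` P) u \<in> finite_clusters"
    using assms by (auto simp: finite_clusters_def cluster_open_cluster edge_to_range intro: finite_subset)
  then show ?thesis using size_mono[OF _ assms(1) assms(3,4)] assms(2) by (auto simp: growable_def)
qed

lemma growable_mono:
  assumes "P \<subseteq> P'" "growable P' u" shows "growable P u"
proof (rule growable_subset)
  have "(u, v) \<in> linked (edge_to ` P')" if "(u, v) \<in> linked (edge_to ` P)" for v
    using that linked_mono[OF image_mono[OF assms(1)], of edge_to] by blast
  then show "fst (open_cluster (edge_to ` P) u) \<subseteq> fst (open_cluster (edge_to ` P') u)"
    "snd (open_cluster (edge_to ` P) u) \<subseteq> snd (open_cluster (edge_to ` P') u)"
    using assms(1) by (auto simp: mem_open_cluster snd_open_cluster)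
qed (use assms in \<open>auto simp: growable_def\<close>)

text \<open>Compatibility of \<open>s\<close> with injective homomorphisms makes the opening rule
  the same in every subtree.\<close>

lemma growable_image: "growable ((\<lambda>p. p @ w) ` Q) (subtree_map w u) \<longleftrightarrow> growable Q u"
proof -
  let ?C = "open_cluster (edge_to ` Q) u"
  have "edge_to ` (\<lambda>p. p @ w) ` Q = map_prod (subtree_map w) (subtree_map w) ` (edge_to ` Q)"
    by (simp add: image_image subtree_map_edge_to)
  then have eq: "open_cluster (edge_to ` (\<lambda>p. p @ w) ` Q) (subtree_map w u) = image_subgraph (subtree_map w) ?C"
    by (simp add: open_cluster_image[OF inj_subtree_map])
  have "cluster (image_subgraph (subtree_map w) ?C)"
    unfolding eq[symmetric] by (rule cluster_open_cluster[OF edge_to_range])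
  moreover have "finite (fst (image_subgraph (subtree_map w) ?C)) \<longleftrightarrow> finite (fst ?C)"
    by (simp add: image_subgraph_def finite_image_iff inj_on_subset[OF inj_subtree_map])
  ultimately have "image_subgraph (subtree_map w) ?C \<in> finite_clusters \<longleftrightarrow> ?C \<in> finite_clusters"
    by (simp add: finite_clusters_def cluster_open_cluster[OF edge_to_range])
  then show ?thesis unfolding growable_def eq using size_image[of ?C w] by auto
qed

text \<open>Without the root edge the cluster of \<open>Root\<close> is a single vertex; its volume
  is 0, so its size is below every positive \<open>N\<close>. The upper endpoint therefore never
  blocks the root edge.\<close>

lemma growable_Root:
  assumes "[] \<notin> P" shows "growable P Root"
proof -
  have 1: "v \<in> {Root}" if "(Root, v) \<in> linked (edge_to ` P)" for v
    using that by (rule linked_closed) (use assms in \<open>auto simp: edge_to_def parent_Node split: if_splits\<close>)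
  have sc: "suffix_closed {}" by (simp add: suffix_closed_def)
  show ?thesis
  proof (rule growable_subset[OF cluster_at_root_finite_cluster[OF sc]])
    show "s (cluster_at_root {}) < N"
      using size_volume[OF cluster_at_root_finite_cluster[OF sc]] N_pos by (simp add: volume_cluster_at_root)
    show "fst (open_cluster (edge_to ` P) Root) \<subseteq> fst (cluster_at_root {})"
      using 1 by (auto simp: mem_open_cluster cluster_at_root_def)
    show "snd (open_cluster (edge_to ` P) Root) \<subseteq> snd (cluster_at_root {})"
      using 1 by (auto simp: snd_open_cluster cluster_at_root_def edge_to_def)
  qed
qed

text \<open>A cluster avoiding \<open>Root\<close> can be moved so that its top vertex is
  \<open>Node []\<close>. By finiteness of \<open>s\<close> only finitely many clusters through
  \<open>Root\<close> or \<open>Node []\<close> have size at most \<open>N\<close>; \<open>L\<close>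
  bounds their depth and \<open>z\<close> records the position of the top.\<close>

lemma ex_word_bound:
  "\<exists>L. \<forall>P u. growable P u \<longrightarrow> (\<exists>z. \<forall>v\<in>fst (open_cluster (edge_to ` P) u).
      v = Root \<and> z = [] \<or> (\<exists>p. length p \<le> L \<and> v = Node (p @ z)))"
proof -
  define D where "D = {C \<in> finite_clusters. Root \<in> fst C \<and> s C \<le> N} \<union>
      {C \<in> finite_clusters. Node [] \<in> fst C \<and> s C \<le> N}"
  define U where "U = (\<Union>C\<in>D. {w. Node w \<in> fst C})"
  have "finite D" unfolding D_def using size_finite by blast
  moreover have "finite {w. Node w \<in> fst C}" if "C \<in> D" for C
  proof -
    have "finite (fst C)" using that by (auto simp: D_def finite_clusters_def)
    then show ?thesis using finite_vimageI[of "fst C" Node] by (simp add: inj_def vimage_def)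
  qed
  ultimately have "finite U" by (simp add: U_def)
  then obtain L where L: "\<And>w. w \<in> U \<Longrightarrow> length w \<le> L"
    using finite_nat_set_iff_bounded_le[of "length ` U"] by auto
  show ?thesis
  proof (intro exI[of _ L] allI impI)
    fix P u assume g: "growable P u"
    let ?C = "open_cluster (edge_to ` P) u"
    have C: "?C \<in> finite_clusters" "s ?C < N" using g by (auto simp: growable_def)
    show "\<exists>z. \<forall>v\<in>fst ?C. v = Root \<and> z = [] \<or> (\<exists>p. length p \<le> L \<and> v = Node (p @ z))"
    proof (cases "Root \<in> fst ?C")
      case True
      then have D: "?C \<in> D" using C by (simp add: D_def)
      have "v = Root \<or> (\<exists>p. length p \<le> L \<and> v = Node (p @ []))" if "v \<in> fst ?C" for v
        using D that L by (cases v) (auto simp: U_def)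
      then show ?thesis by blast
    next
      case False
      obtain z C' where z: "C' \<in> finite_clusters" "Node [] \<in> fst C'" "?C = image_subgraph (subtree_map z) C'"
        "fst ?C \<subseteq> descendants z" by (rule cluster_top[OF C(1) False])
      have "s C' < N" using size_image[OF z(1), of z] z(3) C(2) by simp
      then have D: "C' \<in> D" using z by (simp add: D_def)
      have "\<exists>p. length p \<le> L \<and> v = Node (p @ z)" if v: "v \<in> fst ?C" for v
      proof -
        obtain v' where v': "v' \<in> fst C'" "v = subtree_map z v'"
          using v unfolding z(3) by (auto simp: image_subgraph_def)
        obtain p where p: "v = Node (p @ z)" using v z(4) by (auto simp: descendants_def)
        then have "v' = Node p" using v'(2) inj_subtree_map[of z] by (simp add: inj_eq flip: subtree_map_simps(2))
        then have "length p \<le> L" using D v'(1) L by (auto simp: U_def)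
        then show ?thesis using p by blast
      qed
      then show ?thesis by blast
    qed
  qed
qed

definition L :: nat where
  "L = (SOME L. \<forall>P u. growable P u \<longrightarrow> (\<exists>z. \<forall>v\<in>fst (open_cluster (edge_to ` P) u).
      v = Root \<and> z = [] \<or> (\<exists>p. length p \<le> L \<and> v = Node (p @ z))))"

lemma word_bound:
  assumes "growable P u"
  obtains z where "\<And>v. v \<in> fst (open_cluster (edge_to ` P) u) \<Longrightarrow>
      v = Root \<and> z = [] \<or> (\<exists>p. length p \<le> L \<and> v = Node (p @ z))"
  using someI_ex[OF ex_word_bound] assms unfolding L_def[symmetric] by blast

text \<open>The words of the edges whose state can influence the opening of the edge of \<open>e\<close>.\<close>

definition influence :: "bool list \<Rightarrow> bool list set" where
  "influence e = (\<lambda>(i, p). p @ drop i e) ` ({..L + 1} \<times> {p. length p \<le> L + 1})"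

text \<open>A bound on the size of \<open>influence e\<close> that is uniform in \<open>e\<close>,
  as needed for counting chains of dependencies.\<close>

definition K :: nat where
  "K = card ({..L + 1} \<times> {p :: bool list. length p \<le> L + 1})"

lemma finite_influence: "finite (influence e)"
  unfolding influence_def by (intro finite_imageI finite_cartesian_product finite_words_le) simp

lemma card_influence: "card (influence e) \<le> K"
  unfolding influence_def K_def
  by (intro card_image_le finite_cartesian_product finite_words_le) simp

lemma influence_shift:
  assumes "f \<in> influence e" shows "f @ w \<in> influence (e @ w)"
proof -
  obtain i p where ip: "f = p @ drop i e" "i \<le> L + 1" "length p \<le> L + 1"
    using assms by (auto simp: influence_def)
  \<comment> \<open>\<open>drop i e\<close> is empty once \<open>i\<close> exceeds
    \<open>length e\<close>, whereas dropping \<open>i\<close> letters from \<open>e @ w\<close>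
    would cut into \<open>w\<close>; truncating \<open>i\<close> avoids this.\<close>
  define j where "j = min i (length e)"
  have "drop j e = drop i e" by (simp add: j_def min_def)
  then have "f @ w = p @ drop j (e @ w)" using ip by (simp add: j_def)
  moreover have "j \<le> L + 1" using ip by (simp add: j_def)
  ultimately show ?thesis using ip unfolding influence_def by (force simp: image_iff)
qed

text \<open>A growable cluster reaches at most \<open>L\<close> levels below its top, and only edges
  touching it matter; \<open>influence f\<close> contains all of these for both endpoints of
  \<open>f\<close>.\<close>

lemma open_cluster_local:
  assumes u: "u = parent (Node f) \<or> u = Node f"
    and eq: "\<And>g. g \<in> influence f \<Longrightarrow> g \<in> P \<longleftrightarrow> g \<in> P'" and g: "growable P u"
  shows "open_cluster (edge_to ` P') u = open_cluster (edge_to ` P) u"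
proof (rule open_cluster_cong)
  let ?C = "open_cluster (edge_to ` P) u"
  obtain z where z: "\<And>v. v \<in> fst ?C \<Longrightarrow> v = Root \<and> z = [] \<or> (\<exists>p. length p \<le> L \<and> v = Node (p @ z))"
    using word_bound[OF g] by blast
  have "u \<in> fst ?C" by (simp add: mem_open_cluster)
  from z[OF this] obtain i where i: "i \<le> L + 1" "z = drop i f"
  proof
    assume "u = Root \<and> z = []"
    then show ?thesis using u that[of 0] by (auto simp: parent_Node split: if_splits)
  next
    assume "\<exists>p. length p \<le> L \<and> u = Node (p @ z)"
    then obtain p where p: "length p \<le> L" "u = Node (p @ z)" by blast
    show ?thesis
    proof (cases "u = Node f")
      case True
      then show ?thesis using p that[of "length p"] by auto
    next
      case False
      then have "f \<noteq> []" "tl f = p @ z" using u p by (auto simp: parent_Node split: if_splits)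
      \<comment> \<open>The upper endpoint of \<open>f\<close> sits one level higher, so the top of
        its cluster can be \<open>L + 1\<close> levels above \<open>f\<close>.\<close>
      then have "z = drop (length p + 1) f" by (cases f) auto
      then show ?thesis using p that by auto
    qed
  qed
  fix a b assume ab: "a \<in> fst ?C \<or> b \<in> fst ?C"
  show "(a, b) \<in> edge_to ` P \<longleftrightarrow> (a, b) \<in> edge_to ` P'"
  proof (cases "\<exists>g. (a, b) = edge_to g")
    case True
    then obtain g where g: "(a, b) = edge_to g" by blast
    \<comment> \<open>An edge touching the cluster may hang below its deepest vertex, which costs
      one more level.\<close>
    have "\<exists>q. length q \<le> L + 1 \<and> g = q @ z"
      using ab
    proof
      assume "b \<in> fst ?C"
      then show ?thesis using z[of b] g by (force simp: edge_to_def)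
    next
      assume "a \<in> fst ?C"
      from z[OF this] show ?thesis
      proof
        assume "a = Root \<and> z = []"
        then show ?thesis using g by (auto simp: edge_to_def parent_Node split: if_splits)
      next
        assume "\<exists>p. length p \<le> L \<and> a = Node (p @ z)"
        then obtain p where "length p \<le> L" "a = Node (p @ z)" by blast
        then have "g \<noteq> []" "g = (hd g # p) @ z" using g by (auto simp: edge_to_def parent_Node split: if_splits)
        then show ?thesis using \<open>length p \<le> L\<close> by (metis add_le_mono1 length_Cons Suc_eq_plus1)
      qed
    qed
    then obtain q where q: "length q \<le> L + 1" "g = q @ z" by blast
    then have "g \<in> influence f" unfolding influence_def i(2)
      using i(1) by (intro image_eqI[of _ _ "(i, q)"]) auto
    then show ?thesis using eq g by simp
  qed auto
qed

lemma growable_local: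
  assumes u: "u = parent (Node f) \<or> u = Node f"
    and eq: "\<And>g. g \<in> influence f \<Longrightarrow> g \<in> P \<longleftrightarrow> g \<in> P'"
  shows "growable P u \<longleftrightarrow> growable P' u"
proof
  assume "growable P u"
  then show "growable P' u" using open_cluster_local[OF u eq] by (simp add: growable_def)
next
  assume "growable P' u"
  then show "growable P u" using open_cluster_local[OF u, of P' P] eq by (simp add: growable_def)
qed

lemma step_cong:
  assumes "\<And>f. f \<in> influence e \<Longrightarrow> x f < x e \<Longrightarrow> f \<in> Q \<longleftrightarrow> f \<in> Q'"
  shows "e \<in> step x Q \<longleftrightarrow> e \<in> step x Q'"
  using growable_local[of "parent (Node e)" e "{f \<in> Q. x f < x e}" "{f \<in> Q'. x f < x e}"]
    growable_local[of "Node e" e "{f \<in> Q. x f < x e}" "{f \<in> Q'. x f < x e}"] assms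
  by (auto simp: step_def)

section \<open>Existence and uniqueness of the solution of the opening rule\<close>

definition wf_clocks :: "(bool list \<Rightarrow> real) \<Rightarrow> bool" where
  "wf_clocks x \<longleftrightarrow> wf {(f, e). f \<in> influence e \<and> x f < x e}"

text \<open>Descending chains of the subtree are descending chains of the whole tree, so every
  subtree process is well posed as soon as the whole one is.\<close>

lemma wf_clocks_shift: "wf_clocks x \<Longrightarrow> wf_clocks (shift w x)"
  unfolding wf_clocks_def
  by (rule wf_subset[OF wf_inv_image[where f = "\<lambda>p. p @ w"]])
     (auto simp: shift_def influence_shift)

text \<open>\<open>step x\<close> reverses inclusions, so its iterates need not be monotone and
  monotone fixed point theorems do not apply. The iterates from \<open>{}\<close> stabilise at each
  edge separately, and expressing this by \<open>eventually\<close> over the naturals keeps the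
  limit measurable.\<close>

definition opened :: "(bool list \<Rightarrow> real) \<Rightarrow> bool list set" where
  "opened x = {e. \<forall>\<^sub>F n in sequentially. e \<in> (step x ^^ n) {}}"

text \<open>Induction along the dependency relation: only finitely many earlier edges influence
  \<open>e\<close>, so from some iterate on all of them are settled, and the next iterate settles
  \<open>e\<close>.\<close>

lemma opened_eventually:
  assumes "wf_clocks x"
  shows "(\<forall>\<^sub>F n in sequentially. e \<in> (step x ^^ n) {} \<longleftrightarrow> e \<in> opened x) \<and> (e \<in> opened x \<longleftrightarrow> e \<in> step x (opened x))"
  using assms unfolding wf_clocks_def
proof (induction e rule: wf_induct_rule)
  case (less e)
  have "\<forall>\<^sub>F n in sequentially. \<forall>f\<in>{f \<in> influence e. x f < x e}. f \<in> (step x ^^ n) {} \<longleftrightarrow> f \<in> opened x"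
  proof (rule eventually_ball_finite)
    show "finite {f \<in> influence e. x f < x e}" using finite_influence by simp
  qed (use less in blast)
  then have "\<forall>\<^sub>F n in sequentially. e \<in> (step x ^^ Suc n) {} \<longleftrightarrow> e \<in> step x (opened x)"
  proof (rule eventually_mono)
    fix n assume "\<forall>f\<in>{f \<in> influence e. x f < x e}. f \<in> (step x ^^ n) {} \<longleftrightarrow> f \<in> opened x"
    then have "e \<in> step x ((step x ^^ n) {}) \<longleftrightarrow> e \<in> step x (opened x)" by (intro step_cong) blast
    then show "e \<in> (step x ^^ Suc n) {} \<longleftrightarrow> e \<in> step x (opened x)" by simp
  qed
  then have *: "\<forall>\<^sub>F n in sequentially. e \<in> (step x ^^ n) {} \<longleftrightarrow> e \<in> step x (opened x)"
    by (subst (asm) eventually_sequentially_Suc)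
  have "e \<in> opened x \<longleftrightarrow> e \<in> step x (opened x)"
  proof
    assume "e \<in> opened x"
    then have "\<forall>\<^sub>F n in sequentially. e \<in> (step x ^^ n) {}" by (simp add: opened_def)
    with * have "\<forall>\<^sub>F n::nat in sequentially. e \<in> step x (opened x)" by eventually_elim auto
    then show "e \<in> step x (opened x)" by simp
  next
    assume "e \<in> step x (opened x)"
    then show "e \<in> opened x" using * by (simp add: opened_def)
  qed
  then show ?case using * by simp
qed

lemma opened_fixpoint: "wf_clocks x \<Longrightarrow> step x (opened x) = opened x"
  using opened_eventually by blast

lemma fixpoint_unique:
  assumes "wf_clocks x" "step x Q = Q" shows "Q = opened x"
proof -
  have "e \<in> Q \<longleftrightarrow> e \<in> opened x" for e
    using assms(1) unfolding wf_clocks_def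
  proof (induction e rule: wf_induct_rule)
    case (less e)
    then have "e \<in> step x Q \<longleftrightarrow> e \<in> step x (opened x)" by (intro step_cong) auto
    then show ?case using assms(2) opened_fixpoint[OF assms(1)] by simp
  qed
  then show ?thesis by blast
qed

text \<open>Two shapes are treated together: the cluster of \<open>Root\<close>, for the law, and
  the cluster of \<open>Node []\<close> before the root edge rings, for the rate at which that edge
  opens. In the second shape \<open>[]\<close> belongs to \<open>W\<close> without being an edge of
  \<open>C\<close>; since \<open>t < x []\<close>, clocks up to time \<open>t\<close> do not see
  it.\<close>

definition framed :: "(bool list \<Rightarrow> real) \<Rightarrow> real \<Rightarrow> bool list set \<Rightarrow> subgraph \<Rightarrow> bool" where
  "framed x t W C \<longleftrightarrow> suffix_closed W \<and> s C < N \<and> (C = cluster_at_root W \<or> C = cluster_below_root W \<and> [] \<in> W \<and> t < x [])"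

lemma framed_finite_cluster: "framed x t W C \<Longrightarrow> C \<in> finite_clusters"
  using cluster_at_root_finite_cluster cluster_below_root_finite_cluster by (auto simp: framed_def)

lemma framed_snd:
  assumes "framed x t W C" "x g \<le> t"
  shows "edge_to g \<in> snd C \<longleftrightarrow> g \<in> W" "Node g \<in> fst C \<longleftrightarrow> g \<in> W"
  using assms by (auto simp: framed_def cluster_at_root_def cluster_below_root_def)

lemma framed_parent:
  assumes "framed x t W C" "x g \<le> t"
  shows "parent (Node g) \<in> fst C \<longleftrightarrow> g \<in> W \<or> g \<in> outer_boundary W"
proof (cases g)
  case Nil
  then show ?thesis using assms by (auto simp: framed_def cluster_at_root_def cluster_below_root_def outer_boundary_def)
next
  case (Cons b r)
  then show ?thesis using assms by (auto simp: framed_def cluster_at_root_def cluster_below_root_def outer_boundary_def suffix_closed_def)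
qed

lemma framed_outer_boundary: "framed x t W C \<Longrightarrow> w \<in> outer_boundary W \<Longrightarrow> parent (Node w) \<in> fst C"
  by (cases w) (auto simp: framed_def cluster_at_root_def cluster_below_root_def outer_boundary_def)

text \<open>Along the boundary of \<open>W\<close> the process decouples: if each boundary edge is closed in the whole
  process or in its own subtree process, then the two processes agree below that edge.\<close>

lemma glue:
  assumes fr: "framed x t W C" and wf_clocks: "wf_clocks x" and Q: "step x Q = Q"
    and closed: "\<And>w. w \<in> outer_boundary W \<Longrightarrow> x w \<le> t \<Longrightarrow> w \<notin> Q \<or> [] \<notin> opened (shift w x)"
  shows "x f \<le> t \<Longrightarrow> (f \<in> W \<longrightarrow> f \<in> Q) \<and> (\<forall>w\<in>outer_boundary W. \<forall>p. f = p @ w \<longrightarrow> (f \<in> Q \<longleftrightarrow> p \<in> opened (shift w x)))"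
  using wf_clocks unfolding wf_clocks_def
proof (induction f rule: wf_induct_rule)
  case (less f)
  have IH: "g \<in> W \<Longrightarrow> g \<in> Q" "\<And>w p. w \<in> outer_boundary W \<Longrightarrow> g = p @ w \<Longrightarrow> g \<in> Q \<longleftrightarrow> p \<in> opened (shift w x)"
    if "g \<in> influence f" "x g < x f" for g
    using less.IH[of g] that less.prems by auto
  define F where "F = {g \<in> Q. x g < x f}"
  \<comment> \<open>\<open>Fb\<close> is \<open>F\<close> without the boundary edges of
    \<open>W\<close>. No boundary edge within \<open>influence f\<close> lies in \<open>F\<close>,
    so \<open>growable\<close> cannot tell the two sets apart at the endpoints of
    \<open>f\<close>.\<close>
  define Fb where "Fb = F - outer_boundary W"
  have F: "g \<in> F \<longleftrightarrow> g \<in> Fb" if g: "g \<in> influence f" for g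
  proof -
    have False if "g \<in> F" "g \<in> outer_boundary W"
    proof -
      have g': "g \<in> Q" "x g < x f" using that by (auto simp: F_def)
      then have "[] \<in> opened (shift g x)" using IH(2)[OF g g'(2) that(2), of "[]"] by simp
      then show False using closed[OF that(2)] g' less.prems by simp
    qed
    then show ?thesis by (auto simp: Fb_def)
  qed
  have f_iff: "f \<in> Q \<longleftrightarrow> growable F (parent (Node f)) \<and> growable F (Node f)"
    using Q by (auto simp: step_def F_def set_eq_iff)
  \<comment> \<open>Deleting the boundary edges confines the cluster of \<open>v\<close> to
    \<open>C\<close>, whose size is below \<open>N\<close>.\<close>
  have inside: "growable F v" if v: "v \<in> fst C" "v = parent (Node f) \<or> v = Node f" for v
  proof -
    have 1: "y \<in> fst C" if "(v, y) \<in> linked (edge_to ` Fb)" for y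
      using that v(1)
    proof (rule linked_closed)
      fix a b assume "(a, b) \<in> edge_to ` Fb"
      then obtain g where g: "g \<in> Fb" "a = parent (Node g)" "b = Node g" by (auto simp: edge_to_def)
      then have "x g \<le> t" "g \<notin> outer_boundary W" using less.prems by (auto simp: Fb_def F_def)
      then show "a \<in> fst C \<longleftrightarrow> b \<in> fst C"
        using framed_snd[OF fr] framed_parent[OF fr] g by simp
    qed
    have "growable Fb v"
    proof (rule growable_subset[OF framed_finite_cluster[OF fr]])
      show "s C < N" using fr by (simp add: framed_def)
      show "fst (open_cluster (edge_to ` Fb) v) \<subseteq> fst C" using 1 by (auto simp: mem_open_cluster)
      show "snd (open_cluster (edge_to ` Fb) v) \<subseteq> snd C"
      proof
        fix e assume "e \<in> snd (open_cluster (edge_to ` Fb) v)"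
        then obtain g where g: "e = edge_to g" "g \<in> Fb" "(v, Node g) \<in> linked (edge_to ` Fb)"
          by (auto simp: snd_open_cluster edge_to_def)
        then have "x g \<le> t" "Node g \<in> fst C" using less.prems 1 by (auto simp: Fb_def F_def)
        then show "e \<in> snd C" using framed_snd[OF fr] g by simp
      qed
    qed
    then show ?thesis using growable_local[OF v(2) F] by simp
  qed
  have W: "f \<in> Q" if "f \<in> W"
  proof -
    have "parent (Node f) \<in> fst C" "Node f \<in> fst C"
      using framed_snd[OF fr less.prems] framed_parent[OF fr less.prems] that by auto
    then show ?thesis using inside f_iff by auto
  qed
  have B: "f \<in> Q \<longleftrightarrow> p \<in> opened (shift w x)" if w: "w \<in> outer_boundary W" and fp: "f = p @ w" for w p
  proof -
    define F' where "F' = {q \<in> opened (shift w x). shift w x q < shift w x p}"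
    have p_iff: "p \<in> opened (shift w x) \<longleftrightarrow> growable F' (parent (Node p)) \<and> growable F' (Node p)"
      using opened_fixpoint[OF wf_clocks_shift[OF wf_clocks], of w] by (auto simp: step_def F'_def set_eq_iff)
    define T where "T = {q @ w | q. True}"
    have tr: "growable F u \<longleftrightarrow> growable F' u'"
      if u: "u = parent (Node f) \<or> u = Node f" "u \<in> descendants w" "u = subtree_map w u'" for u u'
    proof -
      have wF: "w \<notin> Fb" using w by (simp add: Fb_def)
      \<comment> \<open>\<open>edge_to w\<close> is absent from \<open>Fb\<close>, so the cluster of
        \<open>u\<close> stays below \<open>Node w\<close> and can be compared with the subtree
        process.\<close>
      have "open_cluster (edge_to ` (Fb \<inter> T)) u = open_cluster (edge_to ` Fb) u"
      proof (rule open_cluster_cong)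
        fix a b assume "a \<in> fst (open_cluster (edge_to ` Fb) u) \<or> b \<in> fst (open_cluster (edge_to ` Fb) u)"
        then have ab: "a \<in> descendants w \<or> b \<in> descendants w"
          using linked_descendants[OF _ wF u(2)] by (auto simp: mem_open_cluster)
        show "(a, b) \<in> edge_to ` Fb \<longleftrightarrow> (a, b) \<in> edge_to ` (Fb \<inter> T)"
        proof
          assume "(a, b) \<in> edge_to ` Fb"
          then obtain g where g: "(a, b) = edge_to g" "g \<in> Fb" by blast
          then have "Node g \<in> descendants w" using ab parent_in_descendants[of g w] wF by (auto simp: edge_to_def)
          then have "g \<in> T" by (auto simp: descendants_def T_def)
          then show "(a, b) \<in> edge_to ` (Fb \<inter> T)" using g by simp
        qed auto
      qed
      then have "growable Fb u \<longleftrightarrow> growable (Fb \<inter> T) u" by (simp add: growable_def)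
      moreover have "growable F u \<longleftrightarrow> growable Fb u" by (rule growable_local[OF u(1) F])
      moreover have "growable (Fb \<inter> T) u \<longleftrightarrow> growable ((\<lambda>q. q @ w) ` F') u"
      proof (rule growable_local[OF u(1)])
        fix g assume g: "g \<in> influence f"
        have "g \<in> Fb \<inter> T \<longleftrightarrow> g \<in> F \<inter> T" using F[OF g] by simp
        also have "\<dots> \<longleftrightarrow> g \<in> (\<lambda>q. q @ w) ` F'"
          using IH(2)[OF g _ w] fp by (auto simp: F_def F'_def T_def shift_def)
        finally show "g \<in> Fb \<inter> T \<longleftrightarrow> g \<in> (\<lambda>q. q @ w) ` F'" .
      qed
      ultimately show ?thesis using growable_image[of w F' u'] u(3) by simp
    qed
    have lower: "growable F (Node f) \<longleftrightarrow> growable F' (Node p)"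
      by (rule tr) (auto simp: fp descendants_def)
    \<comment> \<open>For the boundary edge itself, the case \<open>p = []\<close>, the upper
      endpoint lies in the unfrozen cluster \<open>C\<close> in the whole process and is an isolated
      root in the subtree process. Both let the edge open, so the two rules coincide.\<close>
    have upper: "growable F (parent (Node f)) \<longleftrightarrow> growable F' (parent (Node p))"
    proof (cases "p = []")
      case True
      have "[] \<notin> F'" using True by (simp add: F'_def)
      then have "growable F' (parent (Node p))" using growable_Root True by simp
      moreover have "growable F (parent (Node f))" using inside framed_outer_boundary[OF fr w] fp True by simp
      ultimately show ?thesis by simp
    next
      case False
      then show ?thesis by (intro tr) (auto simp: fp descendants_def parent_Node)
    qed
    show ?thesis using f_iff p_iff lower upper by simp
  qed
  show ?case using W B by blast
qed

text \<open>\<open>glue\<close> accepts closedness of a boundary edge either in the whole process or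
  in its subtree process. The forward direction supplies the former, the backward direction the
  latter, and each reads off the other.\<close>

lemma cluster_char:
  assumes fr: "framed x t W C" and wf_clocks: "wf_clocks x" and Q: "step x Q = Q" and v: "v \<in> fst C"
  shows "open_cluster (edge_to ` {f \<in> Q. x f \<le> t}) v = C \<longleftrightarrow>
    (\<forall>f. edge_to f \<in> snd C \<longrightarrow> x f \<le> t) \<and> (\<forall>w\<in>outer_boundary W. x w \<le> t \<longrightarrow> [] \<notin> opened (shift w x))"
    (is "?oc = C \<longleftrightarrow> ?R")
proof
  assume oc: "?oc = C"
  have snd: "snd C \<subseteq> edge_to ` {f \<in> Q. x f \<le> t}" unfolding oc[symmetric] by (auto simp: snd_open_cluster)
  have closed: "w \<notin> Q" if "w \<in> outer_boundary W" "x w \<le> t" for w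
  proof
    assume "w \<in> Q"
    then have "edge_to w \<in> edge_to ` {f \<in> Q. x f \<le> t}" using that by simp
    then have "(parent (Node w), Node w) \<in> edge_to ` {f \<in> Q. x f \<le> t}" unfolding edge_to_def[of w] .
    moreover have "parent (Node w) \<in> fst ?oc" using framed_outer_boundary[OF fr that(1)] unfolding oc .
    ultimately have "Node w \<in> fst ?oc" by (intro conjunct2[OF open_cluster_edge_in]) auto
    then have "Node w \<in> fst C" unfolding oc .
    then show False using framed_snd[OF fr that(2)] that(1) by (simp add: outer_boundary_def)
  qed
  have "[] \<notin> opened (shift w x)" if "w \<in> outer_boundary W" "x w \<le> t" for w
    using glue[OF fr wf_clocks Q, of w] closed that by (metis append_Nil)
  then show ?R using snd by auto
next
  assume R: ?R
  have C: "cluster C" using framed_finite_cluster[OF fr] by (simp add: finite_clusters_def)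
  note glue = glue[OF fr wf_clocks Q]
  have W: "f \<in> Q" if "f \<in> W" "x f \<le> t" for f
    using glue[of f] R that by blast
  have B: "w \<notin> Q" if "w \<in> outer_boundary W" "x w \<le> t" for w
    using glue[of w] R that by (metis append_Nil)
  have "open_cluster (edge_to ` {f \<in> Q. x f \<le> t}) v = open_cluster (snd C) v"
  proof (rule open_cluster_cong)
    fix a b assume "a \<in> fst (open_cluster (snd C) v) \<or> b \<in> fst (open_cluster (snd C) v)"
    then have ab: "a \<in> fst C \<or> b \<in> fst C" by (simp add: cluster_eq_open_cluster[OF C v])
    show "(a, b) \<in> snd C \<longleftrightarrow> (a, b) \<in> edge_to ` {f \<in> Q. x f \<le> t}"
    proof
      assume s: "(a, b) \<in> snd C"
      then obtain g where g: "(a, b) = edge_to g" using C by (auto simp: cluster_def tree_edges_edge_to)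
      then have "x g \<le> t" using R s by simp
      then show "(a, b) \<in> edge_to ` {f \<in> Q. x f \<le> t}" using g s framed_snd[OF fr, of g] W by auto
    next
      assume "(a, b) \<in> edge_to ` {f \<in> Q. x f \<le> t}"
      then obtain g where g: "(a, b) = edge_to g" "g \<in> Q" "x g \<le> t" by auto
      then have "g \<in> W"
        using ab B[of g] framed_snd[OF fr g(3)] framed_parent[OF fr g(3)] by (auto simp: edge_to_def)
      then show "(a, b) \<in> snd C" using g framed_snd[OF fr g(3)] by simp
    qed
  qed
  then show "?oc = C" by (simp add: cluster_eq_open_cluster[OF C v])
qed

section \<open>Finiteness of the root cluster\<close>

lemma linked_drop:
  assumes "i \<le> j" "j \<le> length w" "\<And>k. i \<le> k \<Longrightarrow> k < j \<Longrightarrow> drop k w \<in> P"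
  shows "(Node (drop i w), Node (drop j w)) \<in> linked (edge_to ` P)"
  using assms
proof (induction rule: dec_induct)
  case (step k)
  then have k: "drop k w \<in> P" "drop k w \<noteq> []" by auto
  have "(Node (drop (Suc k) w), Node (drop k w)) \<in> edge_to ` P"
    using k by (intro image_eqI[of _ _ "drop k w"]) (auto simp: edge_to_def parent_Node drop_Suc drop_tl)
  then have "(Node (drop k w), Node (drop (Suc k) w)) \<in> linked (edge_to ` P)"
    by (rule linked_sym[OF linked_edge])
  moreover have "(Node (drop i w), Node (drop k w)) \<in> linked (edge_to ` P)" using step by auto
  ultimately show ?case using linked_trans by blast
qed simp

text \<open>The edge of a long open path that opens last would join two clusters one of which is
  already frozen.\<close>

lemma finite_root_cluster:
  assumes Q: "step x Q = Q" and inj: "inj x"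
  shows "open_cluster (edge_to ` {f \<in> Q. x f \<le> t}) Root \<in> finite_clusters"
proof -
  define P where "P = {f \<in> Q. x f \<le> t}"
  define U where "U = {w. Node w \<in> fst (open_cluster (edge_to ` P) Root)}"
  have U: "w \<in> P \<and> (w \<noteq> [] \<longrightarrow> tl w \<in> U)" if "w \<in> U" for w
    using cluster_root_words[of w P] that by (auto simp: U_def mem_open_cluster parent_Node)
  have dropU: "drop k w \<in> U" if "w \<in> U" for k w
  proof (induction k)
    case (Suc k)
    then show ?case using U[of "drop k w"] by (cases "drop k w = []") (auto simp: drop_Suc tl_drop)
  qed (use that in simp)
  \<comment> \<open>The latest of the \<open>n\<close> edges met when climbing from
    \<open>w\<close>, the one at \<open>drop i w\<close>, separates pieces with \<open>i\<close> and
    \<open>n - 1 - i\<close> edges. Each piece lies in a growable cluster and so has at most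
    \<open>L\<close> edges, whereas \<open>n - 1 = 2 * L + 1\<close>.\<close>
  define n where "n = 2 * L + 2"
  have "length w < n" if w: "w \<in> U" for w
  proof (rule ccontr)
    assume "\<not> length w < n"
    then have n: "n \<le> length w" by simp
    have inQ: "drop k w \<in> Q" for k using U[OF dropU[OF w]] by (auto simp: P_def)
    define X where "X = (\<lambda>k. x (drop k w)) ` {..<n}"
    have X: "finite X" "X \<noteq> {}" by (auto simp: X_def n_def lessThan_empty_iff)
    obtain m where m: "m \<in> X" "\<And>y. y \<in> X \<Longrightarrow> y \<le> m"
      using Max_in[OF X] Max_ge[OF X(1)] by blast
    then obtain i where i: "i < n" "x (drop i w) = m" by (auto simp: X_def)
    have less: "x (drop k w) < x (drop i w)" if "k < n" "k \<noteq> i" for k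
    proof -
      have "x (drop k w) \<le> m" using that m(2) by (auto simp: X_def)
      moreover have "length (drop k w) \<noteq> length (drop i w)" using that i(1) n by auto
      then have "drop k w \<noteq> drop i w" by metis
      then have "x (drop k w) \<noteq> x (drop i w)" using inj by (simp add: inj_eq)
      ultimately show ?thesis using i by simp
    qed
    define F where "F = {f \<in> Q. x f < x (drop i w)}"
    have "drop i w \<in> step x Q" using inQ Q by simp
    then have g: "growable F (parent (Node (drop i w)))" "growable F (Node (drop i w))"
      by (auto simp: step_def F_def)
    have par: "parent (Node (drop i w)) = Node (drop (Suc i) w)"
      using i n by (simp add: parent_Node drop_Suc tl_drop)
    have "(Node (drop 0 w), Node (drop i w)) \<in> linked (edge_to ` F)"
      by (rule linked_drop) (use i n inQ less in \<open>auto simp: F_def\<close>)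
    then have 1: "Node w \<in> fst (open_cluster (edge_to ` F) (Node (drop i w)))"
      by (simp add: mem_open_cluster linked_sym)
    have 2: "Node (drop n w) \<in> fst (open_cluster (edge_to ` F) (Node (drop (Suc i) w)))"
      unfolding mem_open_cluster
      by (rule linked_drop) (use i n inQ less in \<open>auto simp: F_def\<close>)
    have "length w \<le> length (drop i w) + L"
    proof -
      obtain z where z: "\<And>v. v \<in> fst (open_cluster (edge_to ` F) (Node (drop i w))) \<Longrightarrow>
          v = Root \<and> z = [] \<or> (\<exists>p. length p \<le> L \<and> v = Node (p @ z))"
        using word_bound[OF g(2)] by blast
      obtain p q where pq: "length p \<le> L" "w = p @ z" "drop i w = q @ z"
        using z[OF 1] z[of "Node (drop i w)"] by (auto simp: mem_open_cluster)
      show ?thesis unfolding pq(3) using pq(1) arg_cong[OF pq(2), of length] by simp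
    qed
    moreover have "length (drop (Suc i) w) \<le> length (drop n w) + L"
    proof -
      obtain z where z: "\<And>v. v \<in> fst (open_cluster (edge_to ` F) (Node (drop (Suc i) w))) \<Longrightarrow>
          v = Root \<and> z = [] \<or> (\<exists>p. length p \<le> L \<and> v = Node (p @ z))"
        using word_bound[OF g(1)] par by auto
      obtain p q where pq: "length p \<le> L" "drop (Suc i) w = p @ z" "drop n w = q @ z"
        using z[OF 2] z[of "Node (drop (Suc i) w)"] by (auto simp: mem_open_cluster)
      show ?thesis unfolding pq(2,3) using pq(1) by simp
    qed
    ultimately show False using i n by (simp add: n_def)
  qed
  then have "U \<subseteq> {w. length w \<le> n}" by fastforce
  then have "finite U" by (rule finite_subset) (rule finite_words_le)
  moreover have "v \<in> insert Root (Node ` U)" if "v \<in> fst (open_cluster (edge_to ` P) Root)" for v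
    using that by (cases v) (auto simp: U_def)
  ultimately have "finite (fst (open_cluster (edge_to ` P) Root))"
    using finite_subset[of "fst (open_cluster (edge_to ` P) Root)" "insert Root (Node ` U)"] by blast
  then show ?thesis
    unfolding finite_clusters_def P_def[symmetric] using cluster_open_cluster[OF edge_to_range] by blast
qed

end

section \<open>Independent uniform clocks\<close>

definition unif :: "real measure" where
  "unif = uniform_measure lborel {0..1}"

lemma sets_unif [simp, measurable_cong]: "sets unif = sets borel"
  by (simp add: unif_def)

lemma space_unif [simp]: "space unif = UNIV"
  by (simp add: unif_def)

lemma prob_space_unif: "prob_space unif"
  unfolding unif_def by (rule prob_space_uniform_measure) auto

interpretation unif: prob_space unif by (rule prob_space_unif)

lemma measure_unif: "A \<in> sets borel \<Longrightarrow> measure unif A = measure lborel ({0..1} \<inter> A)"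
  by (simp add: unif_def)

lemma measure_unif_interval:
  "0 \<le> a \<Longrightarrow> a \<le> b \<Longrightarrow> b \<le> 1 \<Longrightarrow> measure unif {a<..b} = b - a"
proof -
  assume *: "0 \<le> a" "a \<le> b" "b \<le> 1"
  then have "{0..1} \<inter> {a<..b} = {a<..b}" by auto
  then show ?thesis using * by (simp add: measure_unif)
qed

lemma measure_unif_atMost: "0 \<le> t \<Longrightarrow> t \<le> 1 \<Longrightarrow> measure unif {..t} = t"
proof -
  assume *: "0 \<le> t" "t \<le> 1"
  then have "{0..1} \<inter> {..t} = {0..t}" by auto
  then show ?thesis using * by (simp add: measure_unif)
qed

lemma measure_unif_le:
  assumes "a \<le> b" shows "measure unif {a..b} \<le> b - a"
proof -
  have "measure lborel ({0..1} \<inter> {a..b}) \<le> measure lborel {a..b}"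
    using assms by (intro measure_mono_fmeasurable) (auto simp: fmeasurable_def)
  then show ?thesis using assms by (simp add: measure_unif)
qed

section \<open>The product measure on clock configurations\<close>

definition clocks :: "(bool list \<Rightarrow> real) measure" where
  "clocks = PiM UNIV (\<lambda>_. unif)"

lemma sets_clocks: "sets clocks = sets (PiM UNIV (\<lambda>_. borel))"
  unfolding clocks_def by (rule sets_PiM_cong) auto

lemma space_clocks [simp]: "space clocks = UNIV"
  by (simp add: clocks_def space_PiM)

lemma prob_space_clocks: "prob_space clocks"
  unfolding clocks_def by (rule prob_space_PiM) (rule prob_space_unif)

interpretation clocks: prob_space clocks by (rule prob_space_clocks)

lemma measurable_clock [measurable]: "(\<lambda>x. x w) \<in> borel_measurable clocks"
proof -
  have "(\<lambda>x. x w) \<in> measurable (PiM UNIV (\<lambda>_. borel)) (borel :: real measure)"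
    by (rule measurable_component_singleton) simp
  then show ?thesis using measurable_cong_sets[OF sets_clocks refl] by blast
qed

lemma measurable_into_clocks:
  assumes "\<And>w. (\<lambda>\<omega>. f \<omega> w) \<in> borel_measurable M"
  shows "f \<in> measurable M clocks"
proof -
  have "(\<lambda>\<omega> w. f \<omega> w) \<in> measurable M (PiM UNIV (\<lambda>_. borel))"
    using assms by (intro measurable_PiM_single') auto
  then show ?thesis using measurable_cong_sets[OF refl sets_clocks] by auto
qed

lemma distr_clock: "distr clocks borel (\<lambda>x. x w) = unif"
proof -
  have "distr clocks borel (\<lambda>x. x w) = distr clocks unif (\<lambda>x. x w)"
    by (rule distr_cong) auto
  also have "\<dots> = unif"
    unfolding clocks_def by (rule distr_PiM_component) (auto simp: prob_space_unif)
  finally show ?thesis .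
qed

lemma indep_clocks: "clocks.indep_vars (\<lambda>_. borel) (\<lambda>w x. x w) UNIV"
proof (subst clocks.indep_vars_iff_distr_eq_PiM)
  have "distr clocks (PiM UNIV (\<lambda>_. borel)) (\<lambda>x. \<lambda>i\<in>UNIV. x i) = distr clocks clocks (\<lambda>x. x)"
    by (rule distr_cong) (auto simp: sets_clocks)
  then show "distr clocks (PiM UNIV (\<lambda>_. borel)) (\<lambda>x. \<lambda>i\<in>UNIV. x i)
      = PiM UNIV (\<lambda>i. distr clocks borel (\<lambda>x. x i))"
    by (simp add: distr_clock clocks_def[symmetric])
qed auto

text \<open>Each event may depend on infinitely many coordinates, as the events of a subtree process
  do; it is written as an event of the restriction to its block, and restrictions to disjoint blocks
  are independent.\<close>

lemma clocks_blocks: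
  fixes I :: "'i \<Rightarrow> bool list set"
  assumes J: "finite J" and disj: "disjoint_family_on I J"
    and meas: "\<And>j. j \<in> J \<Longrightarrow> Measurable.pred clocks (E j)"
    and dep: "\<And>j x y. j \<in> J \<Longrightarrow> (\<And>i. i \<in> I j \<Longrightarrow> x i = y i) \<Longrightarrow> E j x = E j y"
  shows "measure clocks {x. \<forall>j\<in>J. E j x} = (\<Prod>j\<in>J. measure clocks {x. E j x})"
proof (cases "J = {}")
  case True
  then show ?thesis using clocks.prob_space by simp
next
  case False
  \<comment> \<open>Padding with 0 turns a configuration on the block \<open>I j\<close> into a full
    one; by \<open>dep\<close> the event does not see the padding.\<close>
  define ext :: "'i \<Rightarrow> (bool list \<Rightarrow> real) \<Rightarrow> bool list \<Rightarrow> real"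
    where "ext j y = (\<lambda>i. if i \<in> I j then y i else 0)" for j y
  define A where "A j = {y \<in> space (PiM (I j) (\<lambda>_. borel :: real measure)). E j (ext j y)}" for j
  have ext: "ext j \<in> measurable (PiM (I j) (\<lambda>_. borel)) clocks" for j
  proof (rule measurable_into_clocks)
    show "(\<lambda>y. ext j y w) \<in> borel_measurable (PiM (I j) (\<lambda>_. borel))" for w
      by (cases "w \<in> I j") (auto simp: ext_def intro: measurable_component_singleton)
  qed
  have A: "A j \<in> sets (PiM (I j) (\<lambda>_. borel))" if "j \<in> J" for j
    using measurable_compose[OF ext meas[OF that]] by (simp add: A_def pred_def)
  have ind: "clocks.indep_vars (\<lambda>j. PiM (I j) (\<lambda>_. borel)) (\<lambda>j x. restrict (\<lambda>i. x i) (I j)) J"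
    using indep_clocks disj by (intro clocks.indep_vars_restrict) auto
  have eq: "(\<lambda>x. restrict (\<lambda>i. x i) (I j)) -` A j \<inter> space clocks = {x. E j x}" if "j \<in> J" for j
  proof -
    have "E j (ext j (restrict (\<lambda>i. x i) (I j))) = E j x" for x
      using that by (rule dep) (simp add: ext_def)
    then show ?thesis by (simp add: A_def space_PiM vimage_def)
  qed
  have "measure clocks (\<Inter>j\<in>J. (\<lambda>x. restrict (\<lambda>i. x i) (I j)) -` A j \<inter> space clocks)
      = (\<Prod>j\<in>J. measure clocks ((\<lambda>x. restrict (\<lambda>i. x i) (I j)) -` A j \<inter> space clocks))"
    using ind False J A by (rule clocks.indep_varsD_finite)
  moreover have "(\<Inter>j\<in>J. (\<lambda>x. restrict (\<lambda>i. x i) (I j)) -` A j \<inter> space clocks) = {x. \<forall>j\<in>J. E j x}"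
    using eq False by blast
  ultimately show ?thesis using eq by simp
qed

lemma measure_clock: "A \<in> sets borel \<Longrightarrow> measure clocks {x. x w \<in> A} = measure unif A"
  using measure_distr[of "\<lambda>x. x w" clocks borel A] by (simp add: distr_clock vimage_def)

lemma clocks_cylinder:
  assumes "finite J" "\<And>j. j \<in> J \<Longrightarrow> A j \<in> sets borel"
  shows "measure clocks {x. \<forall>j\<in>J. x j \<in> A j} = (\<Prod>j\<in>J. measure unif (A j))"
proof -
  have "Measurable.pred clocks (\<lambda>x. x j \<in> A j)" if "j \<in> J" for j
    using measurable_sets[OF measurable_clock assms(2)[OF that], of j] by (simp add: pred_def vimage_def)
  then have "measure clocks {x. \<forall>j\<in>J. x j \<in> A j} = (\<Prod>j\<in>J. measure clocks {x. x j \<in> A j})"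
    using assms by (intro clocks_blocks[where I = "\<lambda>j. {j}"]) (auto simp: disjoint_family_on_def)
  then show ?thesis using assms by (simp add: measure_clock)
qed

text \<open>Reindexing a product of equal factors along the injection
  \<open>p \<mapsto> p @ w\<close> reproduces the product. This makes each subtree process a copy in
  law of the whole one.\<close>

lemma distr_shift: "distr clocks clocks (shift w) = clocks"
proof -
  have "distr (PiM UNIV (\<lambda>_. unif)) (PiM UNIV (\<lambda>_. unif)) (\<lambda>x. \<lambda>n\<in>UNIV. x (n @ w))
      = PiM UNIV (\<lambda>_. unif)"
    by (rule distr_PiM_reindex) (auto simp: prob_space_unif inj_on_def)
  moreover have "shift w = (\<lambda>x n. x (n @ w) :: real)" by (simp add: shift_def fun_eq_iff)
  ultimately show ?thesis by (simp add: clocks_def restrict_def)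
qed

lemma measurable_shift [measurable]: "shift w \<in> measurable clocks clocks"
  by (rule measurable_into_clocks) (simp add: shift_def)

lemma measure_shift:
  assumes "Measurable.pred clocks E" shows "measure clocks {x. E (shift w x)} = measure clocks {x. E x}"
proof -
  have "measure (distr clocks clocks (shift w)) {x. E x} = measure clocks (shift w -` {x. E x} \<inter> space clocks)"
    using assms by (intro measure_distr) (auto simp: pred_def)
  then show ?thesis by (simp add: distr_shift vimage_def)
qed

lemma AE_clocks_range: "AE x in clocks. \<forall>w. 0 < x w \<and> x w \<le> 1"
proof -
  have "AE y in unif. 0 < y \<and> y \<le> 1"
    unfolding unif_def
  proof (rule AE_uniform_measureI)
    have "AE y in lborel. y \<noteq> (0::real)" by (rule AE_lborel_singleton)
    then show "AE y in lborel. y \<in> {0..1} \<longrightarrow> 0 < y \<and> y \<le> (1::real)" by eventually_elim auto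
  qed simp
  then have "AE x in clocks. 0 < x w \<and> x w \<le> 1" for w
    unfolding clocks_def by (intro AE_PiM_component) (auto simp: prob_space_unif)
  then show ?thesis by (simp add: AE_all_countable)
qed

lemma unit_interval_cell:
  fixes y :: real
  assumes "0 \<le> y" "0 < m"
  shows "y \<in> {real (nat \<lfloor>m * y\<rfloor>) / m .. (real (nat \<lfloor>m * y\<rfloor>) + 1) / m}"
proof -
  have "0 \<le> m * y" using assms by simp
  then have "real (nat \<lfloor>m * y\<rfloor>) = of_int \<lfloor>m * y\<rfloor>" by simp
  moreover have "of_int \<lfloor>m * y\<rfloor> \<le> m * y" "m * y \<le> of_int \<lfloor>m * y\<rfloor> + 1" by linarith+
  ultimately show ?thesis using assms by (auto simp: field_simps)
qed

lemma measure_cell_le: "0 < m \<Longrightarrow> measure unif {real j / m .. (real j + 1) / m} \<le> 1 / m"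
  using measure_unif_le[of "real j / m" "(real j + 1) / m"] by (simp add: field_simps)

text \<open>Two clocks that agree fall into a common cell of a grid of mesh
  \<open>1 / (m + 1)\<close>. The diagonal is covered by \<open>m + 2\<close> squares, each of mass
  at most \<open>1 / (m + 1) ^ 2\<close>.\<close>

lemma AE_clocks_inj: "AE x in clocks. inj x"
proof -
  have "AE x in clocks. x v \<noteq> x w" if vw: "v \<noteq> w" for v w
  proof -
    let ?B = "{x \<in> space clocks. 0 < x v \<and> x v \<le> 1 \<and> x v = x w}"
    have [measurable]: "Measurable.pred clocks (\<lambda>x. x v = x w)"
      unfolding pred_def by (rule borel_measurable_eq) measurable
    have B: "?B \<in> sets clocks" by measurable
    have "measure clocks ?B \<le> 2 / real (Suc m)" for m
    proof -
      define c where "c j = {real j / Suc m .. (real j + 1) / Suc m}" for j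
      define D where "D j = {x. \<forall>u\<in>{v, w}. x u \<in> c j}" for j :: nat
      have D: "D j \<in> sets clocks" for j
      proof -
        have "{x \<in> space clocks. \<forall>u\<in>{v, w}. x u \<in> c j} \<in> sets clocks"
          unfolding c_def by measurable
        then show ?thesis by (simp add: D_def)
      qed
      \<comment> \<open>The index \<open>Suc m\<close> is included because a clock equal to 1 is
        assigned to that cell.\<close>
      have "?B \<subseteq> (\<Union>j\<le>Suc m. D j)"
      proof
        fix x assume x: "x \<in> ?B"
        let ?j = "nat \<lfloor>real (Suc m) * x v\<rfloor>"
        have "x v \<in> c ?j" unfolding c_def using x by (intro unit_interval_cell) auto
        then have "x \<in> D ?j" using x by (simp add: D_def)
        moreover have "real (Suc m) * x v \<le> Suc m" using x by (simp add: mult_left_le)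
        then have "?j \<le> Suc m" by linarith
        ultimately show "x \<in> (\<Union>j\<le>Suc m. D j)" by blast
      qed
      then have "measure clocks ?B \<le> measure clocks (\<Union>j\<le>Suc m. D j)"
        using D by (intro clocks.finite_measure_mono) auto
      also have "\<dots> \<le> (\<Sum>j\<le>Suc m. measure clocks (D j))"
        using D by (intro clocks.finite_measure_subadditive_finite) auto
      also have "\<dots> \<le> (\<Sum>j\<le>Suc m. (1 / Suc m) * (1 / Suc m))"
      proof (rule sum_mono)
        fix j
        have "measure clocks (D j) = measure unif (c j) * measure unif (c j)"
          unfolding D_def using vw by (subst clocks_cylinder) (auto simp: c_def)
        also have "\<dots> \<le> (1 / Suc m) * (1 / Suc m)"
          unfolding c_def by (intro mult_mono measure_cell_le) auto
        finally show "measure clocks (D j) \<le> (1 / Suc m) * (1 / Suc m)" .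
      qed
      also have "\<dots> = (real m + 2) / (real (Suc m) * real (Suc m))" by simp
      also have "\<dots> = (real m + 2) / real (Suc m) / real (Suc m)" by simp
      also have "\<dots> \<le> 2 / real (Suc m)" by (intro divide_right_mono) (auto simp: field_simps)
      finally show ?thesis .
    qed
    moreover have "(\<lambda>m. 2 / real (Suc m)) \<longlonglongrightarrow> 0" by real_asymp
    ultimately have "measure clocks ?B \<le> 0" by (intro LIMSEQ_le_const) auto
    then have "measure clocks ?B = 0" by (simp add: measure_le_0_iff)
    then have "AE x in clocks. \<not> (0 < x v \<and> x v \<le> 1 \<and> x v = x w)"
      using B by (subst AE_iff_measurable[OF B]) (auto simp: clocks.emeasure_eq_measure)
    with AE_clocks_range show ?thesis by eventually_elim auto
  qed
  then have "AE x in clocks. v \<noteq> w \<longrightarrow> x v \<noteq> x w" for v w by (cases "v = w") auto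
  then have "AE x in clocks. \<forall>v w. v \<noteq> w \<longrightarrow> x v \<noteq> x w" by (simp add: AE_all_countable)
  then show ?thesis by eventually_elim (auto simp: inj_def)
qed

text \<open>Any realisation may thus be replaced by the product space, as long as the event in
  question is a function of the clocks.\<close>

lemma distr_iid_uniform:
  assumes "prob_space M" "iid_uniform M \<tau>"
  shows "(\<lambda>\<omega> w. \<tau> (edge_to w) \<omega>) \<in> measurable M clocks" "distr M clocks (\<lambda>\<omega> w. \<tau> (edge_to w) \<omega>) = clocks"
proof -
  interpret prob_space M by fact
  have ind: "indep_vars (\<lambda>_. borel) \<tau> tree_edges"
    and d: "\<And>e. e \<in> tree_edges \<Longrightarrow> distr M borel (\<tau> e) = unif"
    using assms(2) by (auto simp: iid_uniform_def unif_def)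
  have rv: "e \<in> tree_edges \<Longrightarrow> \<tau> e \<in> borel_measurable M" for e
    using ind by (simp add: indep_vars_def2)
  have te: "edge_to w \<in> tree_edges" for w by (simp add: tree_edges_edge_to)
  show m: "(\<lambda>\<omega> w. \<tau> (edge_to w) \<omega>) \<in> measurable M clocks"
    by (rule measurable_into_clocks) (simp add: rv te)
  let ?P = "PiM tree_edges (\<lambda>_. borel :: real measure)"
  have 1: "distr M ?P (\<lambda>\<omega>. \<lambda>e\<in>tree_edges. \<tau> e \<omega>) = PiM tree_edges (\<lambda>_. unif)"
  proof -
    have "distr M ?P (\<lambda>\<omega>. \<lambda>e\<in>tree_edges. \<tau> e \<omega>) = PiM tree_edges (\<lambda>e. distr M borel (\<tau> e))"
      using ind rv te by (subst indep_vars_iff_distr_eq_PiM'[symmetric]) auto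
    also have "\<dots> = PiM tree_edges (\<lambda>_. unif)" by (rule PiM_cong) (auto simp: d)
    finally show ?thesis .
  qed
  have 2: "distr (PiM tree_edges (\<lambda>_. unif)) (PiM UNIV (\<lambda>_. unif)) (\<lambda>x. \<lambda>w\<in>UNIV. x (edge_to w))
      = PiM UNIV (\<lambda>_. unif)"
    by (rule distr_PiM_reindex) (auto simp: prob_space_unif te inj_edge_to)
  have meas: "(\<lambda>x w. x (edge_to w)) \<in> measurable ?P clocks"
    by (rule measurable_into_clocks) (simp add: te)
  have "distr M clocks (\<lambda>\<omega> w. \<tau> (edge_to w) \<omega>)
      = distr (distr M ?P (\<lambda>\<omega>. \<lambda>e\<in>tree_edges. \<tau> e \<omega>)) clocks (\<lambda>x w. x (edge_to w))"
    by (subst distr_distr) (use meas rv te in \<open>auto simp: comp_def intro!: measurable_restrict\<close>)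
  also have "\<dots> = clocks" unfolding 1 using 2 by (simp add: clocks_def restrict_def)
  finally show "distr M clocks (\<lambda>\<omega> w. \<tau> (edge_to w) \<omega>) = clocks" .
qed

section \<open>Measurability of the solution and well-foundedness of almost every clock
  configuration\<close>

context freezing
begin

text \<open>\<open>growable\<close> is determined by the trace of \<open>P x\<close> on the finite
  set \<open>influence e\<close>, so the event is a finite union over the possible traces.\<close>

lemma measurable_growable:
  assumes [measurable]: "\<And>f. Measurable.pred M (\<lambda>x. f \<in> P x)"
    and u: "u = parent (Node e) \<or> u = Node e"
  shows "Measurable.pred M (\<lambda>x. growable (P x) u)"
proof -
  have "growable (P x) u \<longleftrightarrow> (\<exists>S\<in>Pow (influence e). growable S u \<and> (\<forall>g\<in>influence e. g \<in> P x \<longleftrightarrow> g \<in> S))" for x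
  proof
    assume "growable (P x) u"
    then have "growable (P x \<inter> influence e) u" using growable_local[OF u, of "P x" "P x \<inter> influence e"] by blast
    then show "\<exists>S\<in>Pow (influence e). growable S u \<and> (\<forall>g\<in>influence e. g \<in> P x \<longleftrightarrow> g \<in> S)"
      by (intro bexI[of _ "P x \<inter> influence e"]) auto
  next
    assume "\<exists>S\<in>Pow (influence e). growable S u \<and> (\<forall>g\<in>influence e. g \<in> P x \<longleftrightarrow> g \<in> S)"
    then obtain S where "growable S u" "\<And>g. g \<in> influence e \<Longrightarrow> g \<in> P x \<longleftrightarrow> g \<in> S" by blast
    then show "growable (P x) u" using growable_local[OF u, of "P x" S] by blast
  qed
  moreover have "Measurable.pred M (\<lambda>x. \<exists>S\<in>Pow (influence e). growable S u \<and> (\<forall>g\<in>influence e. g \<in> P x \<longleftrightarrow> g \<in> S))"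
    using finite_influence by (intro pred_intros_finite pred_intros_logic) auto
  ultimately show ?thesis by simp
qed

lemma measurable_step:
  assumes [measurable]: "\<And>f. Measurable.pred clocks (\<lambda>x. f \<in> Q x)"
  shows "Measurable.pred clocks (\<lambda>x. e \<in> step x (Q x))"
proof -
  have [measurable]: "Measurable.pred clocks (\<lambda>x. f \<in> {f \<in> Q x. x f < x e})" for f
    by simp
  have "Measurable.pred clocks (\<lambda>x. growable {f \<in> Q x. x f < x e} (parent (Node e)))"
    "Measurable.pred clocks (\<lambda>x. growable {f \<in> Q x. x f < x e} (Node e))"
    by (rule measurable_growable[of _ _ _ e]; simp)+
  then show ?thesis unfolding step_def by simp
qed

lemma measurable_opened [measurable]: "Measurable.pred clocks (\<lambda>x. e \<in> opened x)"
proof -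
  have "Measurable.pred clocks (\<lambda>x. f \<in> (step x ^^ n) {})" for n f
  proof (induction n arbitrary: f)
    case (Suc n)
    then show ?case using measurable_step[of "\<lambda>x. (step x ^^ n) {}"] by simp
  qed simp
  then show ?thesis unfolding opened_def eventually_sequentially by simp
qed

text \<open>Initial segments of dependency chains with \<open>n + 1\<close> words, disregarding the
  order of the clocks.\<close>

primrec paths :: "nat \<Rightarrow> bool list \<Rightarrow> bool list list set" where
  "paths 0 e = {[e]}"
| "paths (Suc n) e = (\<Union>f\<in>influence e. (#) e ` paths n f)"

lemma card_paths: "finite (paths n e) \<and> card (paths n e) \<le> K ^ n"
proof (induction n arbitrary: e)
  case (Suc n)
  have "card (paths (Suc n) e) \<le> (\<Sum>f\<in>influence e. card ((#) e ` paths n f))"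
    by (simp add: card_UN_le finite_influence)
  also have "\<dots> \<le> (\<Sum>f\<in>influence e. K ^ n)"
    by (intro sum_mono order_trans[OF card_image_le]) (use Suc in auto)
  also have "\<dots> \<le> K * K ^ n" using card_influence[of e] by simp
  finally show ?case using Suc finite_influence by simp
qed simp

lemma length_paths: "l \<in> paths n e \<Longrightarrow> length l = Suc n"
  by (induction n arbitrary: e l) auto

lemma map_in_paths:
  assumes "\<And>i. g (Suc i) \<in> influence (g i)" shows "map g [k..<k + Suc n] \<in> paths n (g k)"
proof (induction n arbitrary: k)
  case (Suc n)
  have "map g [k..<k + Suc (Suc n)] = g k # map g [Suc k..<Suc k + Suc n]"
    by (simp add: upt_conv_Cons del: upt_Suc)
  then show ?case using Suc[of "Suc k"] assms by (auto simp del: upt_Suc)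
qed simp

text \<open>An infinite descending chain of dependencies would eventually stay in one cell of a partition
  of \<open>[0,1]\<close> into \<open>m > K\<close> cells, which the union bound over at most \<open>K ^ n\<close> paths excludes.\<close>

lemma AE_wf_clocks: "AE x in clocks. wf_clocks x"
proof -
  define m where "m = Suc K"
  have m: "0 < real m" by (simp add: m_def)
  define c where "c j = {real j / m .. (real j + 1) / m}" for j :: nat
  \<comment> \<open>Distinctness gives a product of independent factors, one per word of the
    path.\<close>
  define D where "D n e j = {x. \<exists>l\<in>paths n e. distinct l \<and> (\<forall>f\<in>set l. x f \<in> c j)}" for n e j
  have sets_l: "{x. \<forall>f\<in>set l. x f \<in> c j} \<in> sets clocks" for l j
  proof -
    have "{x \<in> space clocks. \<forall>f\<in>set l. x f \<in> c j} \<in> sets clocks" unfolding c_def by measurable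
    then show ?thesis by simp
  qed
  have D_eq: "D n e j = (\<Union>l\<in>{l \<in> paths n e. distinct l}. {x. \<forall>f\<in>set l. x f \<in> c j})" for n e j
    by (auto simp: D_def)
  have D: "D n e j \<in> sets clocks" for n e j
    unfolding D_eq using card_paths[of n e] sets_l by (intro sets.finite_UN) auto
  have le: "measure clocks (D n e j) \<le> (K / m) ^ n" for n e j
  proof -
    have "measure clocks (D n e j) \<le> (\<Sum>l\<in>{l \<in> paths n e. distinct l}. measure clocks {x. \<forall>f\<in>set l. x f \<in> c j})"
      unfolding D_eq using card_paths[of n e] sets_l
      by (intro clocks.finite_measure_subadditive_finite) auto
    also have "\<dots> \<le> (\<Sum>l\<in>{l \<in> paths n e. distinct l}. (1 / m) ^ n)"
    proof (rule sum_mono)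
      fix l assume l: "l \<in> {l \<in> paths n e. distinct l}"
      have "measure clocks {x. \<forall>f\<in>set l. x f \<in> c j} = (\<Prod>f\<in>set l. measure unif (c j))"
        by (rule clocks_cylinder) (auto simp: c_def)
      also have "\<dots> = measure unif (c j) ^ Suc n"
        using l length_paths[of l n e] by (simp add: distinct_card)
      \<comment> \<open>One of the \<open>n + 1\<close> factors is given up, so that the exponent
        matches the path count \<open>K ^ n\<close>.\<close>
      also have "\<dots> \<le> measure unif (c j) ^ n" by (rule power_decreasing) auto
      also have "\<dots> \<le> (1 / m) ^ n"
        unfolding c_def by (intro power_mono measure_cell_le m) auto
      finally show "measure clocks {x. \<forall>f\<in>set l. x f \<in> c j} \<le> (1 / m) ^ n" .
    qed
    also have "\<dots> = card {l \<in> paths n e. distinct l} * (1 / m) ^ n" by (simp only: sum_constant)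
    also have "\<dots> \<le> K ^ n * (1 / m) ^ n"
    proof (rule mult_right_mono)
      have "card {l \<in> paths n e. distinct l} \<le> card (paths n e)"
        using card_paths[of n e] by (intro card_mono) auto
      also have "\<dots> \<le> K ^ n" using card_paths by blast
      finally show "real (card {l \<in> paths n e. distinct l}) \<le> K ^ n" by (simp flip: of_nat_power)
    qed simp
    finally show ?thesis by (simp add: power_divide)
  qed
  have "AE x in clocks. \<exists>n. x \<notin> D n e j" for e j
  proof -
    have S: "(\<Inter>n. D n e j) \<in> sets clocks" using D by (intro sets.countable_INT) auto
    have "measure clocks (\<Inter>n. D n e j) \<le> (K / m) ^ n" for n
    proof (rule order_trans[OF _ le])
      show "measure clocks (\<Inter>n. D n e j) \<le> measure clocks (D n e j)"
        by (rule clocks.finite_measure_mono) (use D in auto)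
    qed
    moreover have "(\<lambda>n. (K / m) ^ n) \<longlonglongrightarrow> 0" by (rule LIMSEQ_realpow_zero) (auto simp: m_def)
    ultimately have "measure clocks (\<Inter>n. D n e j) \<le> 0" by (intro LIMSEQ_le_const) auto
    then have "measure clocks (\<Inter>n. D n e j) = 0" by (simp add: measure_le_0_iff)
    then show ?thesis
      by (subst AE_iff_measurable[OF S]) (auto simp: clocks.emeasure_eq_measure)
  qed
  then have "AE x in clocks. \<forall>e j. \<exists>n. x \<notin> D n e j" by (simp add: AE_all_countable)
  with AE_clocks_range show ?thesis
  proof eventually_elim
    fix x assume r: "\<forall>w. 0 < x w \<and> x w \<le> 1" and nD: "\<forall>e j. \<exists>n. x \<notin> D n e j"
    show "wf_clocks x"
    proof (rule ccontr)
      assume "\<not> wf_clocks x"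
      then obtain g where g: "\<And>i. g (Suc i) \<in> influence (g i)" "\<And>i. x (g (Suc i)) < x (g i)"
        unfolding wf_clocks_def wf_iff_no_infinite_down_chain by blast
      have dec: "x (g j) \<le> x (g i)" if "i \<le> j" for i j
        using lift_Suc_antimono_le[of "\<lambda>i. x (g i)", OF less_imp_le[OF g(2)] that] .
      have sdec: "x (g j) < x (g i)" if "i < j" for i j
        using dec[of "Suc i" j] g(2)[of i] that by simp
      have inj: "inj g"
        by (rule injI) (metis linorder_neqE_nat order_less_irrefl sdec)
      \<comment> \<open>The cell indices along a descending chain form a nonincreasing sequence of
        natural numbers; from the position \<open>i0\<close> of its minimum on they are
        constant.\<close>
      define a where "a i = nat \<lfloor>real m * x (g i)\<rfloor>" for i
      obtain i0 where i0: "\<And>i. a i0 \<le> a i"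
        using ex_has_least_nat[of "\<lambda>_. True" undefined a] by blast
      have "a i = a i0" if "i0 \<le> i" for i
      proof -
        have "real m * x (g i) \<le> real m * x (g i0)" using dec[OF that] m by simp
        then have "a i \<le> a i0" unfolding a_def by (intro nat_mono floor_mono)
        then show ?thesis using i0[of i] by simp
      qed
      moreover have "x (g i) \<in> c (a i)" for i
        unfolding c_def a_def using r m by (intro unit_interval_cell) (auto intro: less_imp_le)
      ultimately have cell: "x (g i) \<in> c (a i0)" if "i0 \<le> i" for i using that by metis
      have "x \<in> D n (g i0) (a i0)" for n
        unfolding D_def
      proof (intro CollectI bexI[of _ "map g [i0..<i0 + Suc n]"] conjI ballI)
        show "map g [i0..<i0 + Suc n] \<in> paths n (g i0)" using g(1) by (rule map_in_paths)
        show "distinct (map g [i0..<i0 + Suc n])"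
          unfolding distinct_map by (intro conjI distinct_upt inj_on_subset[OF inj] subset_UNIV)
        show "x f \<in> c (a i0)" if "f \<in> set (map g [i0..<i0 + Suc n])" for f
          using that cell by auto
      qed
      then show False using nD by blast
    qed
  qed
qed

end

section \<open>The law of the root cluster\<close>

text \<open>The event is decided by finitely many edges, which is what makes it measurable, both for
  the clocks and for an abstract realisation.\<close>

lemma open_cluster_eq_cluster_at_root_iff:
  assumes W: "suffix_closed W"
  shows "open_cluster (edge_to ` P) Root = cluster_at_root W \<longleftrightarrow> W \<subseteq> P \<and> outer_boundary W \<inter> P = {}"
proof
  assume oc: "open_cluster (edge_to ` P) Root = cluster_at_root W"
  have "snd (cluster_at_root W) \<subseteq> edge_to ` P" unfolding oc[symmetric] by (auto simp: snd_open_cluster)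
  then have "W \<subseteq> P" by (auto simp: cluster_at_root_def)
  moreover have "w \<notin> P" if w: "w \<in> outer_boundary W" for w
  proof
    assume "w \<in> P"
    then have "(parent (Node w), Node w) \<in> edge_to ` P" unfolding edge_to_def[of w, symmetric] by simp
    moreover have "parent (Node w) \<in> fst (open_cluster (edge_to ` P) Root)"
      unfolding oc using w by (auto simp: cluster_at_root_def outer_boundary_def parent_Node)
    ultimately have "Node w \<in> fst (open_cluster (edge_to ` P) Root)"
      by (intro conjunct2[OF open_cluster_edge_in]) auto
    then show False unfolding oc using w by (auto simp: cluster_at_root_def outer_boundary_def)
  qed
  ultimately show "W \<subseteq> P \<and> outer_boundary W \<inter> P = {}" by blast
next
  assume P: "W \<subseteq> P \<and> outer_boundary W \<inter> P = {}"
  have "open_cluster (edge_to ` P) Root = open_cluster (edge_to ` W) Root"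
  proof (rule open_cluster_cong)
    fix a b assume "a \<in> fst (open_cluster (edge_to ` W) Root) \<or> b \<in> fst (open_cluster (edge_to ` W) Root)"
    then have ab: "a \<in> insert Root (Node ` W) \<or> b \<in> insert Root (Node ` W)"
      unfolding open_cluster_cluster_at_root[OF W] by (simp add: cluster_at_root_def)
    show "(a, b) \<in> edge_to ` W \<longleftrightarrow> (a, b) \<in> edge_to ` P"
    proof
      assume "(a, b) \<in> edge_to ` P"
      then obtain g where g: "(a, b) = edge_to g" "g \<in> P" by auto
      then have "a = parent (Node g)" "b = Node g" by (simp_all add: edge_to_def)
      then have "g \<in> W \<or> g \<in> outer_boundary W"
        using ab by (cases g) (auto simp: outer_boundary_def)
      then show "(a, b) \<in> edge_to ` W" using g P by auto
    qed (use P in auto)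
  qed
  then show "open_cluster (edge_to ` P) Root = cluster_at_root W" by (simp add: open_cluster_cluster_at_root[OF W])
qed

lemma open_cluster_eq_cluster_below_root:
  assumes fin: "finite (fst (open_cluster (edge_to ` P) (Node [])))" and P: "[] \<notin> P"
  obtains W where "suffix_closed W" "[] \<in> W" "open_cluster (edge_to ` P) (Node []) = cluster_below_root W"
proof -
  let ?C = "open_cluster (edge_to ` P) (Node [])"
  define W where "W = {w. Node w \<in> fst ?C}"
  have linked: "w \<in> W \<longleftrightarrow> (Node [], Node w) \<in> linked (edge_to ` P)" for w
    by (simp add: W_def mem_open_cluster)
  have nil: "[] \<in> W" by (simp add: linked)
  have step: "w \<in> P \<and> tl w \<in> W" if w: "w \<in> W" "w \<noteq> []" for w
  proof -
    have "w \<in> P"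
    proof (rule ccontr)
      assume "w \<notin> P"
      moreover have "Node w \<in> descendants w" by (force simp: descendants_def)
      ultimately have "Node [] \<in> descendants w" using linked_descendants linked_sym w(1) linked by blast
      then show False using w(2) by (auto simp: descendants_def)
    qed
    then have "(parent (Node w), Node w) \<in> edge_to ` P" unfolding edge_to_def[of w, symmetric] by simp
    moreover have "Node w \<in> fst ?C" using w by (simp add: W_def)
    ultimately have "parent (Node w) \<in> fst ?C" by (intro conjunct1[OF open_cluster_edge_in]) auto
    then show ?thesis using \<open>w \<in> P\<close> w(2) by (simp add: W_def parent_Node)
  qed
  have "finite W" using finite_vimageI[OF fin, of Node] by (simp add: inj_def vimage_def W_def)
  then have sc: "suffix_closed W" using step by (simp add: suffix_closed_def)
  have root: "Root \<notin> fst ?C"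
  proof
    assume "Root \<in> fst ?C"
    then have "Root \<in> descendants []" using linked_descendants[of "Node []" Root P "[]"] P
      by (simp add: mem_open_cluster descendants_def)
    then show False by (simp add: descendants_def)
  qed
  have "v \<in> fst ?C \<longleftrightarrow> v \<in> Node ` W" for v using root by (cases v) (auto simp: W_def)
  then have "fst ?C = Node ` W" by blast
  moreover have "snd ?C = edge_to ` (W - {[]})"
  proof -
    have "e \<in> snd ?C \<longleftrightarrow> e \<in> edge_to ` (W - {[]})" for e
    proof
      assume "e \<in> snd ?C"
      then obtain g where "e = edge_to g" "g \<in> P" "g \<in> W"
        by (auto simp: snd_open_cluster edge_to_def linked)
      then show "e \<in> edge_to ` (W - {[]})" using P by auto
    next
      assume "e \<in> edge_to ` (W - {[]})"
      then obtain g where g: "e = edge_to g" "g \<in> W" "g \<noteq> []" by auto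
      then have "tl g \<in> W" "g \<in> P" using step by auto
      then have "(Node [], parent (Node g)) \<in> linked (edge_to ` P)" "(Node [], Node g) \<in> linked (edge_to ` P)"
        using g linked by (auto simp: parent_Node)
      moreover have "e \<in> edge_to ` P" using g \<open>g \<in> P\<close> by simp
      ultimately show "e \<in> snd ?C" using g by (simp add: snd_open_cluster edge_to_def)
    qed
    then show ?thesis by blast
  qed
  ultimately have "?C = cluster_below_root W" by (simp add: cluster_below_root_def prod_eq_iff)
  then show ?thesis using that sc nil by blast
qed

text \<open>If one boundary word properly extended another, its tail would lie in \<open>W\<close>
  and still extend the shorter one, which would then belong to \<open>W\<close>. Hence the subtrees
  below distinct boundary edges use disjoint sets of clocks.\<close>

lemma outer_boundary_not_suffix:
  assumes W: "suffix_closed W" and w: "w \<in> outer_boundary W" "w' \<in> outer_boundary W" and eq: "p @ w = q @ w'"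
  shows "w = w'"
proof -
  have *: "u = u'" if u: "u \<in> outer_boundary W" "u' \<in> outer_boundary W" "u = r @ u'" for u u' r
  proof (cases r)
    case (Cons b r')
    then have "r' @ u' \<in> W" using u by (simp add: outer_boundary_def)
    then show ?thesis using suffix_in_suffix_closed[OF W] u(2) by (auto simp: outer_boundary_def)
  qed (use u in simp)
  from eq obtain r where "p = q @ r \<and> r @ w = w' \<or> p @ r = q \<and> w = r @ w'"
    by (auto simp: append_eq_append_conv2)
  then show ?thesis
  proof
    assume "p = q @ r \<and> r @ w = w'"
    then show ?thesis using *[OF w(2,1), of r] by simp
  next
    assume "p @ r = q \<and> w = r @ w'"
    then show ?thesis using *[OF w, of r] by simp
  qed
qed

section \<open>Cylinder events, the law of the root cluster and increments of
  \<open>beta\<close>\<close>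

context freezing
begin

definition root_closed :: "real \<Rightarrow> (bool list \<Rightarrow> real) \<Rightarrow> bool" where
  "root_closed t x \<longleftrightarrow> (x [] \<le> t \<longrightarrow> [] \<notin> opened x)"

definition beta :: "real \<Rightarrow> real" where
  "beta t = measure clocks {x. root_closed t x}"

definition opened_by :: "real \<Rightarrow> (bool list \<Rightarrow> real) \<Rightarrow> bool list set" where
  "opened_by t x = {f \<in> opened x. x f \<le> t}"

lemma measurable_root_closed [measurable]: "Measurable.pred clocks (root_closed t)"
  unfolding root_closed_def[abs_def] by measurable

lemma measurable_opened_by [measurable]: "Measurable.pred clocks (\<lambda>x. f \<in> opened_by t x)"
  unfolding opened_by_def by simp

lemma root_closed_shift: "root_closed t (shift w x) \<longleftrightarrow> (x w \<le> t \<longrightarrow> [] \<notin> opened (shift w x))"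
  by (simp add: root_closed_def shift_def)

lemma measurable_root_closed_shift [measurable]: "Measurable.pred clocks (\<lambda>x. root_closed t (shift w x))"
  by (rule measurable_compose[OF measurable_shift measurable_root_closed])

lemma measurable_cylinder:
  assumes "suffix_closed W" "\<And>f. f \<in> W \<Longrightarrow> A f \<in> sets borel"
  shows "{x. (\<forall>f\<in>W. x f \<in> A f) \<and> (\<forall>w\<in>outer_boundary W. root_closed t (shift w x))} \<in> sets clocks"
proof -
  have 1: "Measurable.pred clocks (\<lambda>x. x f \<in> A f)" if "f \<in> W" for f
    using measurable_sets[OF measurable_clock assms(2)[OF that], of f] by (simp add: pred_def vimage_def)
  have "Measurable.pred clocks (\<lambda>x. (\<forall>f\<in>W. x f \<in> A f) \<and> (\<forall>w\<in>outer_boundary W. root_closed t (shift w x)))"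
    using assms(1) finite_outer_boundary[OF assms(1)] 1
    by (intro pred_intros_logic pred_intros_finite) (auto simp: suffix_closed_def)
  then show ?thesis by (simp add: pred_def)
qed

text \<open>The independent blocks are one coordinate for each word of \<open>W\<close> and all
  words below each boundary word. The sets \<open>A f\<close> are kept general so that the root
  clock can later be confined to a short time interval.\<close>

lemma measure_cylinder:
  assumes W: "suffix_closed W" and A: "\<And>f. f \<in> W \<Longrightarrow> A f \<in> sets borel"
  shows "measure clocks {x. (\<forall>f\<in>W. x f \<in> A f) \<and> (\<forall>w\<in>outer_boundary W. root_closed t (shift w x))}
    = (\<Prod>f\<in>W. measure unif (A f)) * beta t ^ (card W + 1)"
proof -
  define E where "E j x \<longleftrightarrow> (if j \<in> W then x j \<in> A j else root_closed t (shift j x))" for j x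
  define I where "I j = (if j \<in> W then {j} else {p @ j | p. True})" for j
  have fin: "finite W" "finite (outer_boundary W)" using W finite_outer_boundary by (auto simp: suffix_closed_def)
  have WB: "W \<inter> outer_boundary W = {}" by (auto simp: outer_boundary_def)
  have "disjoint_family_on I (W \<union> outer_boundary W)"
  proof -
    have "u = v" if u: "u \<in> W \<union> outer_boundary W" and v: "v \<in> W \<union> outer_boundary W" and y: "y \<in> I u" "y \<in> I v" for u v y
    proof -
      consider "u \<in> W" "v \<in> W" | "u \<in> W" "v \<in> outer_boundary W" | "u \<in> outer_boundary W" "v \<in> W" | "u \<in> outer_boundary W" "v \<in> outer_boundary W"
        using u v by blast
      then show ?thesis
      proof cases
        case 1
        then show ?thesis using y by (simp add: I_def)
      next
        case 2
        then have "v \<notin> W" by (simp add: outer_boundary_def)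
        then obtain p where "u = p @ v" using 2 y by (auto simp: I_def)
        then have "v \<in> W" using suffix_in_suffix_closed[OF W] 2 by simp
        then show ?thesis using \<open>v \<notin> W\<close> by simp
      next
        case 3
        then have "u \<notin> W" by (simp add: outer_boundary_def)
        then obtain p where "v = p @ u" using 3 y by (auto simp: I_def)
        then have "u \<in> W" using suffix_in_suffix_closed[OF W] 3 by simp
        then show ?thesis using \<open>u \<notin> W\<close> by simp
      next
        case 4
        then have "u \<notin> W" "v \<notin> W" by (simp_all add: outer_boundary_def)
        then have "\<exists>p. y = p @ u" "\<exists>q. y = q @ v" using y by (simp_all add: I_def)
        then show ?thesis using outer_boundary_not_suffix[OF W 4] by metis
      qed
    qed
    then show ?thesis unfolding disjoint_family_on_def by blast
  qed
  moreover have "Measurable.pred clocks (E j)" if "j \<in> W \<union> outer_boundary W" for j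
  proof (cases "j \<in> W")
    case True
    then show ?thesis using measurable_sets[OF measurable_clock A[OF True], of j]
      by (simp add: pred_def vimage_def E_def)
  next
    case False
    then have "E j = (\<lambda>x. root_closed t (shift j x))" by (simp add: E_def fun_eq_iff)
    then show ?thesis using measurable_root_closed_shift by simp
  qed
  moreover have "E j x = E j y" if eq: "\<And>i. i \<in> I j \<Longrightarrow> x i = y i" for j x y
  proof (cases "j \<in> W")
    case True
    then show ?thesis using eq[of j] by (simp add: E_def I_def)
  next
    case False
    then have "shift j x = shift j y" using eq by (auto simp: shift_def I_def fun_eq_iff)
    then show ?thesis using False by (simp add: E_def)
  qed
  ultimately have "measure clocks {x. \<forall>j\<in>W \<union> outer_boundary W. E j x}
      = (\<Prod>j\<in>W \<union> outer_boundary W. measure clocks {x. E j x})"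
    by (rule clocks_blocks[OF finite_UnI[OF fin]])
  moreover have "(\<forall>j\<in>W \<union> outer_boundary W. E j x)
      \<longleftrightarrow> (\<forall>f\<in>W. x f \<in> A f) \<and> (\<forall>w\<in>outer_boundary W. root_closed t (shift w x))" for x
    using WB by (auto simp: E_def)
  moreover have "(\<Prod>j\<in>W \<union> outer_boundary W. measure clocks {x. E j x})
      = (\<Prod>j\<in>W. measure clocks {x. E j x}) * (\<Prod>j\<in>outer_boundary W. measure clocks {x. E j x})"
    using fin WB by (rule prod.union_disjoint)
  moreover have "(\<Prod>j\<in>W. measure clocks {x. E j x}) = (\<Prod>f\<in>W. measure unif (A f))"
    using A by (intro prod.cong) (auto simp: E_def measure_clock)
  moreover have "(\<Prod>j\<in>outer_boundary W. measure clocks {x. E j x}) = (\<Prod>j\<in>outer_boundary W. beta t)"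
  proof (rule prod.cong)
    fix j assume "j \<in> outer_boundary W"
    then have "j \<notin> W" using WB by blast
    then have "measure clocks {x. E j x} = measure clocks {x. root_closed t (shift j x)}" by (simp add: E_def)
    then show "measure clocks {x. E j x} = beta t"
      by (simp add: measure_shift[OF measurable_root_closed] beta_def)
  qed simp
  ultimately show ?thesis by (simp add: card_outer_boundary[OF W])
qed

lemma sets_root_cluster:
  assumes "suffix_closed W" shows "{x. open_cluster (edge_to ` opened_by t x) Root = cluster_at_root W} \<in> sets clocks"
proof -
  have "Measurable.pred clocks (\<lambda>x. (\<forall>f\<in>W. f \<in> opened_by t x) \<and> (\<forall>f\<in>outer_boundary W. f \<notin> opened_by t x))"
    using assms finite_outer_boundary[OF assms]
    by (intro pred_intros_logic pred_intros_finite measurable_opened_by) (auto simp: suffix_closed_def)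
  moreover have "open_cluster (edge_to ` opened_by t x) Root = cluster_at_root W
      \<longleftrightarrow> (\<forall>f\<in>W. f \<in> opened_by t x) \<and> (\<forall>f\<in>outer_boundary W. f \<notin> opened_by t x)" for x
    unfolding open_cluster_eq_cluster_at_root_iff[OF assms] by blast
  ultimately show ?thesis by (simp add: pred_def)
qed

lemma root_cluster_iff:
  assumes "suffix_closed W" "s (cluster_at_root W) < N" "wf_clocks x"
  shows "open_cluster (edge_to ` opened_by t x) Root = cluster_at_root W
    \<longleftrightarrow> (\<forall>f\<in>W. x f \<le> t) \<and> (\<forall>w\<in>outer_boundary W. root_closed t (shift w x))"
proof -
  have fr: "framed x t W (cluster_at_root W)" using assms by (simp add: framed_def)
  have "(\<forall>f. edge_to f \<in> snd (cluster_at_root W) \<longrightarrow> x f \<le> t) \<longleftrightarrow> (\<forall>f\<in>W. x f \<le> t)" by (auto simp: cluster_at_root_def)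
  then show ?thesis
    using cluster_char[OF fr assms(3) opened_fixpoint[OF assms(3)], of Root]
    by (simp add: opened_by_def root_closed_shift cluster_at_root_def)
qed

lemma measure_root_cluster:
  assumes W: "suffix_closed W" "s (cluster_at_root W) < N" and t: "0 \<le> t" "t \<le> 1"
  shows "measure clocks {x. open_cluster (edge_to ` opened_by t x) Root = cluster_at_root W} = t ^ card W * beta t ^ (card W + 1)"
proof -
  let ?E = "{x. (\<forall>f\<in>W. x f \<in> {..t}) \<and> (\<forall>w\<in>outer_boundary W. root_closed t (shift w x))}"
  have "measure clocks {x. open_cluster (edge_to ` opened_by t x) Root = cluster_at_root W} = measure clocks ?E"
  proof (rule clocks.finite_measure_eq_AE)
    show "AE x in clocks. x \<in> {x. open_cluster (edge_to ` opened_by t x) Root = cluster_at_root W} \<longleftrightarrow> x \<in> ?E"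
      using AE_wf_clocks by eventually_elim (simp add: root_cluster_iff[OF W])
    show "{x. open_cluster (edge_to ` opened_by t x) Root = cluster_at_root W} \<in> sets clocks"
      by (rule sets_root_cluster) fact
    show "?E \<in> sets clocks" by (rule measurable_cylinder) (use W in auto)
  qed
  also have "\<dots> = (\<Prod>f\<in>W. measure unif {..t}) * beta t ^ (card W + 1)"
    by (rule measure_cylinder) (use W in auto)
  finally show ?thesis using t by (simp add: measure_unif_atMost)
qed

lemma beta_diff:
  assumes "t1 \<le> t2"
  shows "beta t1 - beta t2 = measure clocks {x. x [] \<in> {t1<..t2} \<and> [] \<in> opened x}"
proof -
  have s: "{x. root_closed t x} \<in> sets clocks" for t
    using measurable_root_closed[of t] by (simp add: pred_def)
  have "{x. x [] \<in> {t1<..t2} \<and> [] \<in> opened x} = {x. root_closed t1 x} - {x. root_closed t2 x}"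
    using assms by (auto simp: root_closed_def)
  moreover have "{x. root_closed t2 x} \<subseteq> {x. root_closed t1 x}"
    using assms by (auto simp: root_closed_def)
  ultimately show ?thesis unfolding beta_def using s by (simp add: clocks.finite_measure_Diff)
qed

lemma beta_le_1: "beta t \<le> 1"
  by (simp add: beta_def)

lemma beta_nonneg: "0 \<le> beta t"
  by (simp add: beta_def)

lemma beta_diff_le:
  assumes "0 \<le> t1" "t1 \<le> t2" "t2 \<le> 1" shows "beta t1 - beta t2 \<le> t2 - t1"
proof -
  have "Measurable.pred clocks (\<lambda>x. x [] \<in> {t1<..t2})" by measurable
  then have "measure clocks {x. x [] \<in> {t1<..t2} \<and> [] \<in> opened x} \<le> measure clocks {x. x [] \<in> {t1<..t2}}"
    by (intro clocks.finite_measure_mono) (auto simp: pred_def)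
  also have "\<dots> = measure unif {t1<..t2}" by (rule measure_clock) simp
  also have "\<dots> = t2 - t1" using assms by (rule measure_unif_interval)
  finally show ?thesis using assms by (simp add: beta_diff)
qed

lemma beta_0: "beta 0 = 1"
proof -
  have "measure clocks {x. root_closed 0 x} = measure clocks (space clocks)"
  proof (rule clocks.finite_measure_eq_AE)
    show "AE x in clocks. x \<in> {x. root_closed 0 x} \<longleftrightarrow> x \<in> space clocks"
      using AE_clocks_range by eventually_elim (auto simp: root_closed_def simp flip: not_less)
    show "{x. root_closed 0 x} \<in> sets clocks"
      using measurable_root_closed[of 0] by (simp add: pred_def)
  qed (rule sets.top)
  then show ?thesis unfolding beta_def using clocks.prob_space by simp
qed

lemma beta_ge: "0 \<le> t \<Longrightarrow> t \<le> 1 \<Longrightarrow> 1 - t \<le> beta t"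
  using beta_diff_le[of 0 t] by (simp add: beta_0)

text \<open>These are the clusters of \<open>Node []\<close> that let the root edge open. In
  \<open>root_family\<close> the cluster is measured with the root edge included, and adding that
  edge can raise the size to \<open>N\<close>.\<close>

definition below_root_family :: "bool list set set" where
  "below_root_family = {W. suffix_closed W \<and> [] \<in> W \<and> s (cluster_below_root W) < N}"

definition root_family :: "bool list set set" where
  "root_family = {W. suffix_closed W \<and> s (cluster_at_root W) < N}"

lemma finite_below_root_family: "finite below_root_family"
proof (rule finite_imageD)
  have "cluster_below_root ` below_root_family \<subseteq> {C \<in> finite_clusters. Node [] \<in> fst C \<and> s C \<le> N}"
    using cluster_below_root_finite_cluster by (auto simp: below_root_family_def cluster_below_root_def)
  then show "finite (cluster_below_root ` below_root_family)" using size_finite by (rule finite_subset)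
qed (simp add: inj_on_def)

lemma finite_root_family: "finite root_family"
proof (rule finite_imageD)
  have "cluster_at_root ` root_family \<subseteq> {C \<in> finite_clusters. Root \<in> fst C \<and> s C \<le> N}"
    using cluster_at_root_finite_cluster by (auto simp: root_family_def) (auto simp: cluster_at_root_def)
  then show "finite (cluster_at_root ` root_family)" using size_finite by (rule finite_subset)
qed (simp add: inj_on_def)

lemma measure_cylinder_root:
  assumes W: "suffix_closed W" "[] \<in> W" and t: "0 \<le> t" "t \<le> 1" and t12: "0 \<le> t1" "t1 \<le> t2" "t2 \<le> 1"
  shows "measure clocks {x. (\<forall>f\<in>W. x f \<in> (if f = [] then {t1<..t2} else {..t}))
      \<and> (\<forall>w\<in>outer_boundary W. root_closed t (shift w x))}
    = (t2 - t1) * t ^ (card W - 1) * beta t ^ (card W + 1)"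
proof -
  have fin: "finite W" using W by (simp add: suffix_closed_def)
  have "(\<Prod>f\<in>W. measure unif (if f = [] then {t1<..t2} else {..t}))
      = measure unif {t1<..t2} * (\<Prod>f\<in>W - {[]}. measure unif {..t})"
    using fin W(2) by (subst prod.remove[OF fin W(2)]) (auto intro!: prod.cong)
  also have "\<dots> = (t2 - t1) * t ^ (card W - 1)"
    using t t12 fin W(2) by (simp add: measure_unif_interval measure_unif_atMost)
  finally show ?thesis using measure_cylinder[OF W(1), of "\<lambda>f. if f = [] then {t1<..t2} else {..t}" t]
    by simp
qed

text \<open>If the root edge opens during \<open>(t1, t2]\<close>, the cluster of
  \<open>Node []\<close> was already unfrozen at time \<open>t1\<close>, with one of finitely many
  shapes. An inequality results because that cluster may still freeze between \<open>t1\<close> and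
  the clock of the root edge.\<close>

lemma beta_diff_upper:
  assumes t: "0 \<le> t1" "t1 \<le> t2" "t2 \<le> 1"
  shows "beta t1 - beta t2 \<le> (t2 - t1) * (\<Sum>W\<in>below_root_family. t1 ^ (card W - 1) * beta t1 ^ (card W + 1))"
proof -
  define Z where "Z W = {x. (\<forall>f\<in>W. x f \<in> (if f = [] then {t1<..t2} else {..t1}))
      \<and> (\<forall>w\<in>outer_boundary W. root_closed t1 (shift w x))}" for W
  have Z: "Z W \<in> sets clocks" if "W \<in> below_root_family" for W
    unfolding Z_def using that by (intro measurable_cylinder) (auto simp: below_root_family_def)
  have "measure clocks {x. x [] \<in> {t1<..t2} \<and> [] \<in> opened x} \<le> measure clocks (\<Union>W\<in>below_root_family. Z W)"
  proof (rule clocks.finite_measure_mono_AE)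
    show "AE x in clocks. x \<in> {x. x [] \<in> {t1<..t2} \<and> [] \<in> opened x} \<longrightarrow> x \<in> (\<Union>W\<in>below_root_family. Z W)"
      using AE_wf_clocks
    proof eventually_elim
      fix x assume wf: "wf_clocks x"
      show "x \<in> {x. x [] \<in> {t1<..t2} \<and> [] \<in> opened x} \<longrightarrow> x \<in> (\<Union>W\<in>below_root_family. Z W)"
      proof
        assume "x \<in> {x. x [] \<in> {t1<..t2} \<and> [] \<in> opened x}"
        then have x: "t1 < x []" "x [] \<le> t2" "[] \<in> step x (opened x)"
          using opened_fixpoint[OF wf] by auto
        then have "growable {f \<in> opened x. x f < x []} (Node [])" by (simp add: step_def)
        then have g: "growable (opened_by t1 x) (Node [])" by (rule growable_mono[rotated]) (use x in \<open>auto simp: opened_by_def\<close>)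
        have "[] \<notin> opened_by t1 x" using x by (simp add: opened_by_def)
        then obtain W where W: "suffix_closed W" "[] \<in> W" "open_cluster (edge_to ` opened_by t1 x) (Node []) = cluster_below_root W"
          using g by (elim open_cluster_eq_cluster_below_root[rotated]) (auto simp: growable_def finite_clusters_def)
        then have sW: "s (cluster_below_root W) < N" using g by (simp add: growable_def)
        have fr: "framed x t1 W (cluster_below_root W)" using W sW x by (simp add: framed_def)
        have "Node [] \<in> fst (cluster_below_root W)" using W by (simp add: cluster_below_root_def)
        from cluster_char[OF fr wf opened_fixpoint[OF wf] this] W(3)
        have c: "\<And>f. f \<in> W \<Longrightarrow> f \<noteq> [] \<Longrightarrow> x f \<le> t1" "\<forall>w\<in>outer_boundary W. root_closed t1 (shift w x)"
          by (auto simp: opened_by_def root_closed_shift cluster_below_root_def)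
        then have "x \<in> Z W" using x by (simp add: Z_def)
        moreover have "W \<in> below_root_family" using W sW by (simp add: below_root_family_def)
        ultimately show "x \<in> (\<Union>W\<in>below_root_family. Z W)" by blast
      qed
    qed
    show "(\<Union>W\<in>below_root_family. Z W) \<in> sets clocks" using Z finite_below_root_family by auto
  qed
  also have "\<dots> \<le> (\<Sum>W\<in>below_root_family. measure clocks (Z W))"
    using Z finite_below_root_family by (intro clocks.finite_measure_subadditive_finite) auto
  also have "\<dots> = (\<Sum>W\<in>below_root_family. (t2 - t1) * (t1 ^ (card W - 1) * beta t1 ^ (card W + 1)))"
    unfolding Z_def using t by (intro sum.cong) (auto simp: below_root_family_def measure_cylinder_root)
  finally show ?thesis using t by (simp add: beta_diff sum_distrib_left)
qed

text \<open>If the root clock rings during \<open>(t1, t2]\<close> and the root cluster at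
  \<open>t2\<close> is unfrozen and has an edge, then the root edge opened in that interval. All
  factors are evaluated at the right endpoint, in contrast to
  \<open>beta_diff_upper\<close>.\<close>

lemma beta_diff_lower:
  assumes t: "0 \<le> t1" "t1 \<le> t2" "t2 \<le> 1"
  shows "(t2 - t1) * (\<Sum>W\<in>root_family - {{}}. t2 ^ (card W - 1) * beta t2 ^ (card W + 1)) \<le> beta t1 - beta t2"
proof -
  let ?F = "root_family - {{}}"
  have F: "suffix_closed W" "s (cluster_at_root W) < N" "[] \<in> W" if WF: "W \<in> ?F" for W
  proof -
    show W: "suffix_closed W" "s (cluster_at_root W) < N" using WF by (auto simp: root_family_def)
    obtain w where "w \<in> W" using WF by blast
    then show "[] \<in> W" using suffix_in_suffix_closed[OF W(1), of w "[]"] by simp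
  qed
  define Z where "Z W = {x. x [] \<in> {t1<..t2} \<and> open_cluster (edge_to ` opened_by t2 x) Root = cluster_at_root W}" for W
  have I: "{x. x [] \<in> {t1<..t2}} \<in> sets clocks"
    using measurable_sets[OF measurable_clock[of "[]"], of "{t1<..t2}"] by (simp add: vimage_def)
  have Z: "Z W \<in> sets clocks" if "W \<in> ?F" for W
    using sets.Int[OF I sets_root_cluster[OF F(1)[OF that]], of t2] by (simp add: Z_def Collect_conj_eq Int_assoc)
  have "(\<Sum>W\<in>?F. (t2 - t1) * (t2 ^ (card W - 1) * beta t2 ^ (card W + 1))) = (\<Sum>W\<in>?F. measure clocks (Z W))"
  proof (rule sum.cong)
    fix W assume "W \<in> ?F"
    note W = F[OF this] and ZW = Z[OF this]
    let ?E = "{x. (\<forall>f\<in>W. x f \<in> (if f = [] then {t1<..t2} else {..t2}))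
      \<and> (\<forall>w\<in>outer_boundary W. root_closed t2 (shift w x))}"
    have key: "x \<in> Z W \<longleftrightarrow> x \<in> ?E" if "wf_clocks x" for x
    proof -
      have 1: "(\<forall>f\<in>W. x f \<in> (if f = [] then {t1<..t2} else {..t2})) \<longleftrightarrow> x [] \<in> {t1<..t2} \<and> (\<forall>f\<in>W. x f \<le> t2)"
      proof (intro iffI conjI ballI)
        assume L: "\<forall>f\<in>W. x f \<in> (if f = [] then {t1<..t2} else {..t2})"
        show "x [] \<in> {t1<..t2}" using bspec[OF L W(3)] by simp
        show "x f \<le> t2" if "f \<in> W" for f using bspec[OF L that] by (simp split: if_splits)
      next
        fix f assume "x [] \<in> {t1<..t2} \<and> (\<forall>f\<in>W. x f \<le> t2)" "f \<in> W"
        then show "x f \<in> (if f = [] then {t1<..t2} else {..t2})" by (cases "f = []") simp_all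
      qed
      have 2: "open_cluster (edge_to ` opened_by t2 x) Root = cluster_at_root W
          \<longleftrightarrow> (\<forall>f\<in>W. x f \<le> t2) \<and> (\<forall>w\<in>outer_boundary W. root_closed t2 (shift w x))"
        by (rule root_cluster_iff[OF W(1,2) \<open>wf_clocks x\<close>])
      have "x \<in> Z W \<longleftrightarrow> x [] \<in> {t1<..t2} \<and> open_cluster (edge_to ` opened_by t2 x) Root = cluster_at_root W"
        by (simp only: Z_def mem_Collect_eq)
      also have "\<dots> \<longleftrightarrow> x [] \<in> {t1<..t2} \<and> (\<forall>f\<in>W. x f \<le> t2) \<and> (\<forall>w\<in>outer_boundary W. root_closed t2 (shift w x))"
        by (simp only: 2)
      also have "\<dots> \<longleftrightarrow> (x [] \<in> {t1<..t2} \<and> (\<forall>f\<in>W. x f \<le> t2)) \<and> (\<forall>w\<in>outer_boundary W. root_closed t2 (shift w x))"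
        by (rule conj_assoc[symmetric])
      also have "\<dots> \<longleftrightarrow> x \<in> ?E" by (simp only: 1 mem_Collect_eq)
      finally show ?thesis .
    qed
    have "measure clocks (Z W) = measure clocks ?E"
    proof (rule clocks.finite_measure_eq_AE)
      show "AE x in clocks. x \<in> Z W \<longleftrightarrow> x \<in> ?E"
        using AE_wf_clocks by eventually_elim (rule key)
      show "Z W \<in> sets clocks" by (rule ZW)
      show "?E \<in> sets clocks" by (rule measurable_cylinder) (use W in auto)
    qed
    also have "\<dots> = (t2 - t1) * t2 ^ (card W - 1) * beta t2 ^ (card W + 1)"
      using W t by (intro measure_cylinder_root) auto
    finally show "(t2 - t1) * (t2 ^ (card W - 1) * beta t2 ^ (card W + 1)) = measure clocks (Z W)" by simp
  qed simp
  also have "\<dots> = measure clocks (\<Union>W\<in>?F. Z W)"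
  proof (rule clocks.finite_measure_finite_Union[symmetric])
    show "finite ?F" using finite_root_family by simp
    show "Z ` ?F \<subseteq> sets clocks" using Z by blast
    show "disjoint_family_on Z ?F" by (auto simp: disjoint_family_on_def Z_def)
  qed
  also have "\<dots> \<le> measure clocks {x. x [] \<in> {t1<..t2} \<and> [] \<in> opened x}"
  proof (rule clocks.finite_measure_mono)
    show "(\<Union>W\<in>?F. Z W) \<subseteq> {x. x [] \<in> {t1<..t2} \<and> [] \<in> opened x}"
    proof
      fix x assume "x \<in> (\<Union>W\<in>?F. Z W)"
      then obtain W where W: "W \<in> ?F" "x \<in> Z W" by blast
      then have "W \<subseteq> opened_by t2 x" using open_cluster_eq_cluster_at_root_iff[OF F(1)[OF W(1)]] by (auto simp: Z_def)
      then show "x \<in> {x. x [] \<in> {t1<..t2} \<and> [] \<in> opened x}" using F(3)[OF W(1)] W(2) by (auto simp: opened_by_def Z_def)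
    qed
    have "Measurable.pred clocks (\<lambda>x. x [] \<in> {t1<..t2} \<and> [] \<in> opened x)" by measurable
    then show "{x. x [] \<in> {t1<..t2} \<and> [] \<in> opened x} \<in> sets clocks" by (simp add: pred_def)
  qed
  finally show ?thesis using t by (simp add: beta_diff sum_distrib_left)
qed

lemma root_cluster_total:
  assumes t: "0 \<le> t" "t \<le> 1" and S: "S \<subseteq> root_family"
  shows "(\<Sum>W\<in>S. t ^ card W * beta t ^ (card W + 1)) \<le> 1"
proof -
  define Z where "Z W = {x. open_cluster (edge_to ` opened_by t x) Root = cluster_at_root W}" for W
  have F: "suffix_closed W" "s (cluster_at_root W) < N" if "W \<in> S" for W using that S by (auto simp: root_family_def)
  have "(\<Sum>W\<in>S. t ^ card W * beta t ^ (card W + 1)) = (\<Sum>W\<in>S. measure clocks (Z W))"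
    unfolding Z_def using F t by (intro sum.cong) (auto simp: measure_root_cluster)
  also have "\<dots> = measure clocks (\<Union>W\<in>S. Z W)"
  proof (rule clocks.finite_measure_finite_Union[symmetric])
    show "finite S" using finite_root_family S by (rule finite_subset[rotated])
    show "Z ` S \<subseteq> sets clocks" unfolding Z_def using F sets_root_cluster by blast
    show "disjoint_family_on Z S" by (auto simp: disjoint_family_on_def Z_def)
  qed
  also have "\<dots> \<le> 1" by simp
  finally show ?thesis .
qed

end

section \<open>Generating functions and bounds on the closing probability\<close>

text \<open>Truncation by height exhausts all finite clusters through \<open>Root\<close> by an
  increasing sequence of finite families.\<close>

definition suffix_closed_below :: "nat \<Rightarrow> bool list set set" where
  "suffix_closed_below n = {W. suffix_closed W \<and> (\<forall>w\<in>W. length w < n)}"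

text \<open>Truncations of the Catalan generating function, the power series solution of
  \<open>y = 1 + x * y ^ 2\<close>.\<close>

fun cluster_poly :: "real \<Rightarrow> nat \<Rightarrow> real" where
  "cluster_poly x 0 = 1"
| "cluster_poly x (Suc n) = 1 + x * (cluster_poly x n)\<^sup>2"

text \<open>The last letter of a word is its first step down from \<open>Node []\<close>, so
  appending a letter at the end moves a set of words into one of the two subtrees below the root
  edge.\<close>

definition join :: "bool list set \<times> bool list set \<Rightarrow> bool list set" where
  "join = (\<lambda>(U, V). insert [] ((\<lambda>w. w @ [False]) ` U \<union> (\<lambda>w. w @ [True]) ` V))"

lemma finite_suffix_closed_below: "finite (suffix_closed_below n)"
proof (rule finite_subset)
  show "suffix_closed_below n \<subseteq> Pow {w. length w \<le> n}" by (auto simp: suffix_closed_below_def)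
  show "finite (Pow {w :: bool list. length w \<le> n})" using finite_words_le by simp
qed

lemma card_join:
  assumes "finite U" "finite V" shows "card (join (U, V)) = 1 + card U + card V"
proof -
  have "card ((\<lambda>w. w @ [False]) ` U \<union> (\<lambda>w. w @ [True]) ` V) = card U + card V"
    using assms by (subst card_Un_disjoint) (auto simp: card_image inj_on_def)
  moreover have "[] \<notin> (\<lambda>w. w @ [False]) ` U \<union> (\<lambda>w. w @ [True]) ` V" by auto
  ultimately show ?thesis using assms by (simp add: join_def)
qed

lemma inj_join: "inj join"
proof (rule injI)
  fix a b :: "bool list set \<times> bool list set"
  assume eq: "join a = join b"
  have F: "w \<in> fst c \<longleftrightarrow> w @ [False] \<in> join c" and T: "w \<in> snd c \<longleftrightarrow> w @ [True] \<in> join c" for c w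
    by (cases c; auto simp: join_def)+
  show "a = b" using F[of _ a] F[of _ b] T[of _ a] T[of _ b] eq by (auto simp: prod_eq_iff)
qed

lemma suffix_closed_below_Suc: "suffix_closed_below (Suc n) = insert {} (join ` (suffix_closed_below n \<times> suffix_closed_below n))"
proof
  show "suffix_closed_below (Suc n) \<subseteq> insert {} (join ` (suffix_closed_below n \<times> suffix_closed_below n))"
  proof
    fix W assume W: "W \<in> suffix_closed_below (Suc n)"
    then have sc: "suffix_closed W" by (simp add: suffix_closed_below_def)
    show "W \<in> insert {} (join ` (suffix_closed_below n \<times> suffix_closed_below n))"
    proof (cases "W = {}")
      case False
      then obtain w where "w \<in> W" by blast
      then have nil: "[] \<in> W" using suffix_in_suffix_closed[OF sc, of w "[]"] by simp
      define R where "R b = {u. u @ [b] \<in> W}" for b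
      have R: "R b \<in> suffix_closed_below n" for b
      proof -
        have "finite (R b)"
          using sc finite_vimageI[of W "\<lambda>u. u @ [b]"] by (simp add: R_def suffix_closed_def vimage_def inj_def)
        moreover have "tl u \<in> R b" if "u \<in> R b" "u \<noteq> []" for u
        proof -
          have "\<forall>w\<in>W. w \<noteq> [] \<longrightarrow> tl w \<in> W" using sc by (simp add: suffix_closed_def)
          then have "tl (u @ [b]) \<in> W" using that(1) unfolding R_def by blast
          then show ?thesis using that(2) by (simp add: R_def)
        qed
        moreover have "length u < n" if "u \<in> R b" for u
        proof -
          have "length (u @ [b]) < Suc n" using that W unfolding R_def suffix_closed_below_def by blast
          then show ?thesis by simp
        qed
        ultimately show ?thesis by (simp add: suffix_closed_below_def suffix_closed_def)
      qed
      have "w \<in> W \<longleftrightarrow> w \<in> join (R False, R True)" for w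
      proof (cases w rule: rev_cases)
        case Nil
        then show ?thesis using nil by (simp add: join_def)
      next
        case (snoc u b)
        then show ?thesis by (cases b) (auto simp: join_def R_def)
      qed
      then have "W = join (R False, R True)" by blast
      then show ?thesis using R by blast
    qed simp
  qed
  have "join (U, V) \<in> suffix_closed_below (Suc n)" if "U \<in> suffix_closed_below n" "V \<in> suffix_closed_below n" for U V
  proof -
    have fin: "finite (join (U, V))" using that by (simp add: join_def suffix_closed_below_def suffix_closed_def)
    have tl: "tl w \<in> join (U, V)" if w: "w \<in> join (U, V)" "w \<noteq> []" for w
    proof (cases w rule: rev_cases)
      case (snoc u b)
      show ?thesis
      proof (cases "u = []")
        case True
        then show ?thesis using snoc by (simp add: join_def)
      next
        case False
        then show ?thesis using snoc w \<open>U \<in> suffix_closed_below n\<close> \<open>V \<in> suffix_closed_below n\<close>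
          by (cases b) (auto simp: join_def suffix_closed_below_def suffix_closed_def)
      qed
    qed (use w in simp)
    have "length w < Suc n" if "w \<in> join (U, V)" for w
      using that \<open>U \<in> suffix_closed_below n\<close> \<open>V \<in> suffix_closed_below n\<close> by (auto simp: join_def suffix_closed_below_def)
    then show ?thesis using fin tl by (simp add: suffix_closed_below_def suffix_closed_def)
  qed
  moreover have "{} \<in> suffix_closed_below (Suc n)" by (simp add: suffix_closed_below_def suffix_closed_def)
  ultimately show "insert {} (join ` (suffix_closed_below n \<times> suffix_closed_below n)) \<subseteq> suffix_closed_below (Suc n)" by auto
qed

text \<open>The empty set corresponds to the constant term, and \<open>join\<close> to the product of the generating
  functions of the two subtrees.\<close>

lemma sum_suffix_closed_below: "(\<Sum>W\<in>suffix_closed_below n. x ^ card W) = cluster_poly x n"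
proof (induction n)
  case 0
  have "suffix_closed_below 0 = {{}}" by (auto simp: suffix_closed_below_def suffix_closed_def)
  then show ?case by simp
next
  case (Suc n)
  have "(\<Sum>W\<in>suffix_closed_below (Suc n). x ^ card W) = 1 + (\<Sum>W\<in>join ` (suffix_closed_below n \<times> suffix_closed_below n). x ^ card W)"
  proof -
    have "{} \<notin> join ` (suffix_closed_below n \<times> suffix_closed_below n)" by (auto simp: join_def)
    then show ?thesis unfolding suffix_closed_below_Suc using finite_suffix_closed_below by simp
  qed
  also have "(\<Sum>W\<in>join ` (suffix_closed_below n \<times> suffix_closed_below n). x ^ card W) = (\<Sum>a\<in>suffix_closed_below n \<times> suffix_closed_below n. x ^ card (join a))"
    by (subst sum.reindex) (auto intro: inj_on_subset[OF inj_join])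
  also have "\<dots> = (\<Sum>(U, V)\<in>suffix_closed_below n \<times> suffix_closed_below n. x * (x ^ card U * x ^ card V))"
    by (intro sum.cong) (auto simp: card_join suffix_closed_below_def suffix_closed_def power_add)
  also have "\<dots> = (\<Sum>U\<in>suffix_closed_below n. \<Sum>V\<in>suffix_closed_below n. x * (x ^ card U * x ^ card V))"
    by (simp add: sum.cartesian_product)
  also have "\<dots> = x * ((\<Sum>U\<in>suffix_closed_below n. x ^ card U) * (\<Sum>V\<in>suffix_closed_below n. x ^ card V))"
    by (simp only: sum_product) (simp only: sum_distrib_left)
  finally show ?case by (simp add: Suc power2_eq_square)
qed

lemma finite_subset_suffix_closed_below:
  assumes "finite S" "\<And>W. W \<in> S \<Longrightarrow> suffix_closed W"
  obtains n where "S \<subseteq> suffix_closed_below n"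
proof -
  have "finite (\<Union>S)" using assms by (auto simp: suffix_closed_def)
  then obtain n where "\<And>w. w \<in> \<Union>S \<Longrightarrow> length w \<le> n"
    using finite_nat_set_iff_bounded_le[of "length ` \<Union>S"] by auto
  then have "S \<subseteq> suffix_closed_below (Suc n)" using assms(2) by (fastforce simp: suffix_closed_below_def less_Suc_eq_le)
  then show ?thesis using that by blast
qed

lemma cluster_poly_ge_1: "0 \<le> x \<Longrightarrow> 1 \<le> cluster_poly x n"
  by (induction n) auto

lemma cluster_poly_Suc_ge: "0 \<le> x \<Longrightarrow> cluster_poly x n \<le> cluster_poly x (Suc n)"
proof (induction n)
  case (Suc n)
  then show ?case using cluster_poly_ge_1[of x n] by (auto intro!: mult_left_mono power_mono)
qed simp

text \<open>At \<open>x = 1/4\<close> the value 2 is a fixed point of the recursion.\<close>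

lemma cluster_poly_le_2: "0 \<le> x \<Longrightarrow> x \<le> 1/4 \<Longrightarrow> cluster_poly x n \<le> 2"
proof (induction n)
  case (Suc n)
  then have "(cluster_poly x n)\<^sup>2 \<le> 2\<^sup>2" using cluster_poly_ge_1[of x n] by (intro power_mono) auto
  then have "x * (cluster_poly x n)\<^sup>2 \<le> (1/4) * 4" using Suc by (intro mult_mono) auto
  then show ?case by simp
qed simp

lemma beta_infinity_nonneg: "0 \<le> t \<Longrightarrow> t \<le> 1 \<Longrightarrow> 0 \<le> beta_infinity t"
  by (simp add: beta_infinity_def)

text \<open>The rescaled polynomials \<open>q n = b * cluster_poly (t * b) n\<close> satisfy \<open>q (n + 1) = b + t * (q n)\<^sup>2\<close>.\<close>

lemma cluster_poly_limit:
  assumes "0 \<le> t" "0 \<le> b" and bound: "\<And>n. b * cluster_poly (t * b) n \<le> c"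
  obtains q where "(\<lambda>n. b * cluster_poly (t * b) n) \<longlonglongrightarrow> q" "q = b + t * q\<^sup>2" "0 \<le> q" "q \<le> c"
    "\<And>n. b * cluster_poly (t * b) n \<le> q"
proof -
  let ?q = "\<lambda>n. b * cluster_poly (t * b) n"
  have inc: "incseq ?q"
    by (rule incseq_SucI) (intro mult_left_mono cluster_poly_Suc_ge, use assms in auto)
  have "Bseq ?q"
  proof (rule BseqI'[of _ c])
    show "norm (?q n) \<le> c" for n
      using bound[of n] cluster_poly_ge_1[of "t * b" n] assms by simp
  qed
  then have "convergent ?q" using inc by (simp add: Bseq_mono_convergent incseq_def)
  then obtain q where q: "?q \<longlonglongrightarrow> q" by (auto simp: convergent_def)
  have le: "?q n \<le> q" for n using inc q by (rule incseq_le)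
  have "?q (Suc n) = b + t * (?q n)\<^sup>2" for n by (simp add: power2_eq_square algebra_simps)
  moreover have "(\<lambda>n. ?q (Suc n)) \<longlonglongrightarrow> q" using q by (rule LIMSEQ_Suc)
  moreover have "(\<lambda>n. b + t * (?q n)\<^sup>2) \<longlonglongrightarrow> b + t * q\<^sup>2" by (intro tendsto_intros q)
  ultimately have "q = b + t * q\<^sup>2" using LIMSEQ_unique by simp
  moreover have "q \<le> c" using LIMSEQ_le_const2[OF q] bound by blast
  moreover have "0 \<le> q" using le[of 0] assms by simp
  ultimately show ?thesis using that q le by blast
qed

text \<open>In the limit \<open>b = q - t * q ^ 2\<close> for some \<open>q\<close> in
  \<open>[0,1]\<close>, and \<open>beta_infinity t\<close> is the maximum of this parabola on
  \<open>[0,1]\<close>: it is attained at the endpoint 1 if \<open>t \<le> 1/2\<close> and at the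
  vertex \<open>1 / (2 * t)\<close> otherwise.\<close>

lemma le_beta_infinity:
  assumes t: "0 \<le> t" "t \<le> 1" and b: "0 \<le> b" and bound: "\<And>n. b * cluster_poly (t * b) n \<le> 1"
  shows "b \<le> beta_infinity t"
proof -
  obtain q where q: "q = b + t * q\<^sup>2" "0 \<le> q" "q \<le> 1"
    using cluster_poly_limit[OF t(1) b bound] by blast
  show ?thesis
  proof (cases "t \<le> 1/2")
    case True
    have "t * (1 + q) \<le> (1/2) * 2" using True q t by (intro mult_mono) auto
    then have "0 \<le> (1 - q) * (1 - t * (1 + q))" using q by simp
    then have "b \<le> 1 - t" using q(1) by (simp add: algebra_simps power2_eq_square)
    then show ?thesis using True by (simp add: beta_infinity_def)
  next
    case False
    have "0 \<le> (2 * t * q - 1)\<^sup>2" by simp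
    then have "4 * t * (q - t * q\<^sup>2) \<le> 1" by (simp add: algebra_simps power2_eq_square)
    moreover have "q - t * q\<^sup>2 = b" using q(1) by linarith
    ultimately have "4 * t * b \<le> 1" by simp
    then show ?thesis using False by (simp add: beta_infinity_def field_simps)
  qed
qed

text \<open>The maximiser of \<open>q - t * q ^ 2\<close> on \<open>[0,1]\<close>; it is the total
  mass of the limiting probabilities of the finite clusters.\<close>

definition theta :: "real \<Rightarrow> real" where
  "theta t = (if t \<le> 1/2 then 1 else 1 / (2 * t))"

text \<open>For \<open>0 < t \<le> 1/2\<close> the limiting equation has the roots 1 and
  \<open>(1 - t) / t \<ge> 1\<close>, and the bound by 1 selects the former. For
  \<open>t > 1/2\<close> the argument of the polynomials is constantly 1/4, where the equation has
  the double root 2.\<close>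

lemma cluster_poly_theta:
  assumes t: "0 \<le> t" "t \<le> 1"
  shows "(\<lambda>n. beta_infinity t * cluster_poly (t * beta_infinity t) n) \<longlonglongrightarrow> theta t"
proof (cases "t \<le> 1/2")
  case True
  define b where "b = 1 - t"
  have b: "0 \<le> b" using t by (simp add: b_def)
  have bound: "b * cluster_poly (t * b) n \<le> 1" for n
  proof (induction n)
    case (Suc n)
    have "(b * cluster_poly (t * b) n)\<^sup>2 \<le> 1\<^sup>2"
      using Suc b t cluster_poly_ge_1[of "t * b" n] by (intro power_mono) auto
    then have "t * (b * cluster_poly (t * b) n)\<^sup>2 \<le> t" using t by (simp add: mult_left_le)
    moreover have "b * cluster_poly (t * b) (Suc n) = b + t * (b * cluster_poly (t * b) n)\<^sup>2"
      by (simp add: power2_eq_square algebra_simps)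
    ultimately show ?case by (simp add: b_def)
  qed (use t in \<open>simp add: b_def\<close>)
  obtain q where conv: "(\<lambda>n. b * cluster_poly (t * b) n) \<longlonglongrightarrow> q" and q: "q = b + t * q\<^sup>2" "0 \<le> q" "q \<le> 1"
    using cluster_poly_limit[OF t(1) b bound] by blast
  have "(1 - q) * (1 - t - t * q) = 0" using q(1) by (simp add: b_def algebra_simps power2_eq_square)
  moreover have "0 < 1 - t - t * q" if "q < 1"
  proof (cases "t = 0")
    case False
    then have "t * q < t" using that t by simp
    then show ?thesis using True by simp
  qed simp
  ultimately have "q = 1" using q(3) by (cases "q < 1") auto
  then show ?thesis using conv True by (simp add: beta_infinity_def theta_def b_def)
next
  case False
  then have x: "t * beta_infinity t = 1/4" by (simp add: beta_infinity_def)
  have bound: "1 * cluster_poly (1/4 * 1) n \<le> 2" for n using cluster_poly_le_2[of "1/4" n] by simp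
  obtain q where conv: "(\<lambda>n. 1 * cluster_poly (1/4 * 1) n) \<longlonglongrightarrow> q" and q: "q = 1 + (1/4) * q\<^sup>2"
    using cluster_poly_limit[OF _ _ bound] by auto
  have "(q - 2)\<^sup>2 = 0" using q by (simp add: power2_eq_square algebra_simps)
  then have "(\<lambda>n. cluster_poly (1/4) n) \<longlonglongrightarrow> 2" using conv by simp
  then have "(\<lambda>n. beta_infinity t * cluster_poly (1/4) n) \<longlonglongrightarrow> beta_infinity t * 2"
    by (intro tendsto_intros)
  then show ?thesis using False unfolding x by (simp add: beta_infinity_def theta_def)
qed

section \<open>Lower bound on \<open>beta\<close> and upper bound on the unfrozen mass\<close>

context freezing
begin

lemma root_family_if_card: "suffix_closed W \<Longrightarrow> card W < N \<Longrightarrow> W \<in> root_family"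
  using size_volume[OF cluster_at_root_finite_cluster[of W]] by (simp add: root_family_def volume_cluster_at_root)

text \<open>Each term is \<open>beta t1 ^ 2\<close> times a power of \<open>t1 * beta t1\<close>
  with exponent \<open>card W - 1\<close>; replacing the base by 1/4 and raising the exponent to
  \<open>card W\<close> costs the factor 4. The generating function at 1/4 is at most 2, of which
  the empty set takes 1.\<close>

lemma sum_below_root_family_le:
  assumes "0 \<le> t1" "t1 * beta t1 \<le> 1/4"
  shows "(\<Sum>W\<in>below_root_family. t1 ^ (card W - 1) * beta t1 ^ (card W + 1)) \<le> 4 * (beta t1)\<^sup>2"
proof -
  obtain n where n: "below_root_family \<subseteq> suffix_closed_below n"
    using finite_below_root_family by (rule finite_subset_suffix_closed_below) (auto simp: below_root_family_def)
  have "(\<Sum>W\<in>below_root_family. t1 ^ (card W - 1) * beta t1 ^ (card W + 1))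
      \<le> (\<Sum>W\<in>below_root_family. 4 * (beta t1)\<^sup>2 * (1/4) ^ card W)"
  proof (rule sum_mono)
    fix W assume "W \<in> below_root_family"
    then have "finite W" "W \<noteq> {}" by (auto simp: below_root_family_def suffix_closed_def)
    then obtain k where k: "card W = Suc k" by (metis card_gt_0_iff gr0_implies_Suc)
    have "(t1 * beta t1) ^ k \<le> (1/4) ^ k" using assms beta_nonneg by (intro power_mono) auto
    then have "(beta t1)\<^sup>2 * (t1 * beta t1) ^ k \<le> (beta t1)\<^sup>2 * (1/4) ^ k"
      by (intro mult_left_mono) auto
    then show "t1 ^ (card W - 1) * beta t1 ^ (card W + 1) \<le> 4 * (beta t1)\<^sup>2 * (1/4) ^ card W"
      by (simp add: k power_mult_distrib power2_eq_square mult_ac)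
  qed
  also have "\<dots> = 4 * (beta t1)\<^sup>2 * (\<Sum>W\<in>below_root_family. (1/4) ^ card W)" by (simp add: sum_distrib_left)
  also have "\<dots> \<le> 4 * (beta t1)\<^sup>2 * 1"
  proof (rule mult_left_mono)
    have "(\<Sum>W\<in>insert {} below_root_family. (1/4 :: real) ^ card W) \<le> (\<Sum>W\<in>suffix_closed_below n. (1/4) ^ card W)"
      using n finite_suffix_closed_below by (intro sum_mono2) (auto simp: suffix_closed_below_def suffix_closed_def)
    also have "\<dots> \<le> 2" by (simp add: sum_suffix_closed_below cluster_poly_le_2)
    finally show "(\<Sum>W\<in>below_root_family. (1/4 :: real) ^ card W) \<le> 1"
      using finite_below_root_family by (subst (asm) sum.insert) (auto simp: below_root_family_def)
  qed simp
  finally show ?thesis by simp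
qed

text \<open>The second order error disappears when the grid is refined, so \<open>t * beta t\<close> cannot fall
  below \<open>1/4\<close> again once it has reached that value.\<close>

lemma beta_step:
  assumes t: "0 \<le> t1" "t1 \<le> t2" "t2 \<le> 1" and le: "t1 * beta t1 \<le> 1/4"
  shows "t1 * beta t1 - 4 * (t2 - t1)\<^sup>2 \<le> t2 * beta t2"
proof -
  define b where "b = beta t1"
  define h where "h = t2 - t1"
  have b: "0 \<le> b" "b \<le> 1" "t1 * b \<le> 1/4" using beta_nonneg beta_le_1 le by (auto simp: b_def)
  have h: "0 \<le> h" "t2 = t1 + h" using t by (auto simp: h_def)
  have "b - beta t2 \<le> h * (4 * b\<^sup>2)"
    using beta_diff_upper[OF t] mult_left_mono[OF sum_below_root_family_le[OF t(1) le] h(1)]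
    unfolding b_def h_def by linarith
  then have "t2 * (b - h * (4 * b\<^sup>2)) \<le> t2 * beta t2" using t by (intro mult_left_mono) auto
  \<comment> \<open>The term of first order in \<open>h\<close> is nonnegative because
    \<open>t1 * b \<le> 1/4\<close>; only a second order term is lost.\<close>
  moreover have "t2 * (b - h * (4 * b\<^sup>2)) = t1 * b + h * b * (1 - 4 * (t1 * b)) - 4 * h\<^sup>2 * b\<^sup>2"
    unfolding h(2) by (simp add: power2_eq_square algebra_simps)
  moreover have "0 \<le> h * b * (1 - 4 * (t1 * b))" using b h by simp
  moreover have "4 * h\<^sup>2 * b\<^sup>2 \<le> 4 * h\<^sup>2 * 1" using b by (intro mult_left_mono) (auto simp: power_le_one)
  ultimately show ?thesis unfolding b_def[symmetric] h_def[symmetric] by linarith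
qed

lemma quarter_le:
  assumes t: "1/2 \<le> t" "t \<le> 1" shows "1/4 \<le> t * beta t"
proof -
  \<comment> \<open>The grid error is \<open>h\<close> for one overshoot plus at most
    \<open>2 * h\<close> for the accumulated second order terms, and
    \<open>h \<le> 1 / (n + 1)\<close>.\<close>
  have "1/4 - 3 / real (Suc n) \<le> t * beta t" for n
  proof -
    define h where "h = (t - 1/2) / real (Suc n)"
    define r where "r i = 1/2 + real i * h" for i
    have h: "0 \<le> h" "h * real (Suc n) = t - 1/2" using t by (auto simp: h_def)
    have r: "1/2 \<le> r i" "r i \<le> 1" if "i \<le> Suc n" for i
    proof -
      have "real i * h \<le> real (Suc n) * h" using that h by (intro mult_right_mono) auto
      then show "1/2 \<le> r i" "r i \<le> 1" using h t by (auto simp: r_def mult.commute)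
    qed
    have rS: "r (Suc i) = r i + h" for i by (simp add: r_def algebra_simps)
    \<comment> \<open>From a value up to 1/4 a step loses at most \<open>4 * h ^ 2\<close>. From
      above 1/4 it may fall past 1/4, but by no more than \<open>h\<close>, since
      \<open>beta\<close> is Lipschitz with constant 1; the accumulated loss then starts
      afresh.\<close>
    have "1/4 - h - 4 * h\<^sup>2 * real i \<le> r i * beta (r i)" if "i \<le> Suc n" for i
      using that
    proof (induction i)
      case 0
      have "1/2 \<le> beta (1/2)" using beta_ge[of "1/2"] by simp
      then show ?case using h by (simp add: r_def)
    next
      case (Suc i)
      have ri: "1/2 \<le> r i" "r i \<le> 1" "r (Suc i) \<le> 1" using r Suc by auto
      show ?case
      proof (cases "r i * beta (r i) \<le> 1/4")
        case True
        have "r i * beta (r i) - 4 * (r (Suc i) - r i)\<^sup>2 \<le> r (Suc i) * beta (r (Suc i))"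
          using ri h True rS by (intro beta_step) auto
        then show ?thesis using Suc rS by (simp add: algebra_simps)
      next
        case False
        have "beta (r i) - beta (r (Suc i)) \<le> r (Suc i) - r i"
          using ri h rS by (intro beta_diff_le) auto
        then have "beta (r i) - h \<le> beta (r (Suc i))" by (simp add: rS)
        then have "r i * (beta (r i) - h) \<le> r i * beta (r (Suc i))" using ri by (intro mult_left_mono) auto
        also have "\<dots> \<le> r (Suc i) * beta (r (Suc i))"
          using h rS beta_nonneg by (intro mult_right_mono) auto
        finally have "r i * (beta (r i) - h) \<le> r (Suc i) * beta (r (Suc i))" .
        moreover have "r i * h \<le> h" using ri h by (simp add: mult_right_le_one_le mult.commute)
        ultimately have "1/4 - h \<le> r (Suc i) * beta (r (Suc i))"
          using False by (simp add: right_diff_distrib)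
        moreover have "0 \<le> 4 * h\<^sup>2 * real (Suc i)" by simp
        ultimately show ?thesis by linarith
      qed
    qed
    from this[of "Suc n"] have "1/4 - h - 4 * h\<^sup>2 * real (Suc n) \<le> r (Suc n) * beta (r (Suc n))" by simp
    moreover have "r (Suc n) = t" using h by (simp add: r_def mult.commute)
    moreover have "4 * h\<^sup>2 * real (Suc n) = 4 * h * (t - 1/2)"
      using h(2) by (simp add: power2_eq_square)
    moreover have "4 * h * (t - 1/2) \<le> 4 * h * (1/2)" using t h by (intro mult_left_mono) auto
    moreover have "h \<le> 1 / real (Suc n)" using t by (auto simp: h_def divide_right_mono)
    ultimately show ?thesis by simp
  qed
  moreover have "(\<lambda>n. 1/4 - 3 / real (Suc n)) \<longlonglongrightarrow> 1/4" by real_asymp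
  ultimately show ?thesis by (intro LIMSEQ_le_const2) auto
qed

lemma beta_infinity_le_beta:
  assumes t: "0 \<le> t" "t \<le> 1" shows "beta_infinity t \<le> beta t"
proof (cases "t \<le> 1/2")
  case True
  then show ?thesis using beta_ge[OF t] by (simp add: beta_infinity_def)
next
  case False
  then show ?thesis using quarter_le[of t] t by (simp add: beta_infinity_def field_simps)
qed

text \<open>The probability that the root cluster is unfrozen at time \<open>t\<close>.\<close>

definition total :: "real \<Rightarrow> real" where
  "total t = (\<Sum>W\<in>root_family. t ^ card W * beta t ^ (card W + 1))"

lemma total_le_1: "0 \<le> t \<Longrightarrow> t \<le> 1 \<Longrightarrow> total t \<le> 1"
  unfolding total_def by (rule root_cluster_total) auto

text \<open>A discrete form of \<open>\<beta> - t * \<beta>'\<close>: the empty set contributes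
  \<open>beta t\<close>, and once a factor \<open>t\<close> is split off the other terms add up to
  at most the difference quotient supplied by \<open>beta_diff_lower\<close>.\<close>

lemma total_le:
  assumes t: "0 \<le> r" "r < t" "t \<le> 1"
  shows "total t \<le> beta t + t * ((beta r - beta t) / (t - r))"
proof -
  have e: "{} \<in> root_family" using N_pos by (intro root_family_if_card) (auto simp: suffix_closed_def)
  let ?S = "\<Sum>W\<in>root_family - {{}}. t ^ (card W - 1) * beta t ^ (card W + 1)"
  have "total t = beta t + (\<Sum>W\<in>root_family - {{}}. t ^ card W * beta t ^ (card W + 1))"
    unfolding total_def by (subst sum.remove[OF finite_root_family e]) simp
  also have "(\<Sum>W\<in>root_family - {{}}. t ^ card W * beta t ^ (card W + 1)) = t * ?S"
    unfolding sum_distrib_left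
  proof (rule sum.cong)
    fix W assume "W \<in> root_family - {{}}"
    then have "card W \<noteq> 0" by (auto simp: root_family_def suffix_closed_def)
    then have "t ^ card W = t * t ^ (card W - 1)" by (metis power_eq_if)
    then show "t ^ card W * beta t ^ (card W + 1) = t * (t ^ (card W - 1) * beta t ^ (card W + 1))" by simp
  qed simp
  also have "?S \<le> (beta r - beta t) / (t - r)"
    using beta_diff_lower[of r t] t by (simp add: field_simps)
  then have "t * ?S \<le> t * ((beta r - beta t) / (t - r))" using t by (intro mult_left_mono) auto
  finally show ?thesis by simp
qed

end

section \<open>Convergence\<close>

text \<open>Volume counts edges while \<open>finite_clusters\<close> counts vertices; every vertex
  of the root cluster other than \<open>Root\<close> brings the edge above it.\<close>

lemma finite_root_cluster_iff:
  "finite (snd (open_cluster (edge_to ` P) Root)) \<longleftrightarrow> open_cluster (edge_to ` P) Root \<in> finite_clusters"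
proof
  let ?C = "open_cluster (edge_to ` P) Root"
  assume fin: "finite (snd ?C)"
  define W where "W = {w. Node w \<in> fst ?C}"
  have "edge_to w \<in> snd ?C" if "w \<in> W" for w
  proof -
    have l: "(Root, Node w) \<in> linked (edge_to ` P)" using that by (simp add: W_def mem_open_cluster)
    have "w \<in> P" "(Root, parent (Node w)) \<in> linked (edge_to ` P)" using cluster_root_words[OF l] by simp_all
    moreover have "edge_to w \<in> edge_to ` P" using \<open>w \<in> P\<close> by simp
    ultimately show ?thesis using l by (simp add: snd_open_cluster edge_to_def)
  qed
  then have "edge_to ` W \<subseteq> snd ?C" by blast
  then have "finite (edge_to ` W)" using fin by (rule finite_subset)
  then have "finite W" using inj_on_subset[OF inj_edge_to subset_UNIV] by (rule finite_imageD)
  moreover have "v \<in> insert Root (Node ` W)" if "v \<in> fst ?C" for v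
    using that by (cases v) (simp_all add: W_def)
  ultimately have "finite (fst ?C)"
    using finite_subset[of "fst ?C" "insert Root (Node ` W)"] by blast
  then show "?C \<in> finite_clusters" by (simp add: finite_clusters_def cluster_open_cluster edge_to_range)
next
  let ?C = "open_cluster (edge_to ` P) Root"
  assume "?C \<in> finite_clusters"
  then have "finite (fst ?C \<times> fst ?C)" "snd ?C \<subseteq> fst ?C \<times> fst ?C"
    by (simp_all add: finite_clusters_def cluster_def)
  then show "finite (snd ?C)" by (rule finite_subset[rotated])
qed

lemma root_in_open_cluster: "Root \<in> fst (open_cluster F Root)"
  by (simp add: mem_open_cluster)

lemma countable_suffix_closed: "countable {W. suffix_closed W}"
proof (rule countable_subset)
  show "{W. suffix_closed W} \<subseteq> {W. finite W}" by (auto simp: suffix_closed_def)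
  show "countable {W :: bool list set. finite W}" by (rule countable_Collect_finite)
qed

section \<open>Root cluster events of an abstract realisation\<close>

context
  fixes G M and \<tau> :: "edge \<Rightarrow> 'a \<Rightarrow> real" and A
  assumes proc: "frozen_percolation G M \<tau> A"
begin

lemma proc_prob_space: "prob_space M"
  using proc by (simp add: frozen_percolation_def)

lemma proc_eq_image:
  assumes "t \<in> {0..1}" "\<omega> \<in> space M" shows "A t \<omega> = edge_to ` {w. edge_to w \<in> A t \<omega>}"
proof -
  have "A t \<omega> \<subseteq> range edge_to" using proc assms by (simp add: frozen_percolation_def tree_edges_edge_to)
  then show ?thesis by blast
qed

lemma proc_cluster_sets:
  assumes t: "t \<in> {0..1}" and W: "suffix_closed W"
  shows "{\<omega> \<in> space M. open_cluster (A t \<omega>) Root = cluster_at_root W} \<in> sets M"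
proof -
  have [measurable]: "Measurable.pred M (\<lambda>\<omega>. edge_to w \<in> A t \<omega>)" for w
    using proc t unfolding frozen_percolation_def pred_def by (simp add: tree_edges_edge_to)
  have "Measurable.pred M (\<lambda>\<omega>. (\<forall>w\<in>W. edge_to w \<in> A t \<omega>) \<and> (\<forall>w\<in>outer_boundary W. edge_to w \<notin> A t \<omega>))"
    using W finite_outer_boundary[OF W] by (intro pred_intros_logic pred_intros_finite) (auto simp: suffix_closed_def)
  moreover have "open_cluster (A t \<omega>) Root = cluster_at_root W
      \<longleftrightarrow> (\<forall>w\<in>W. edge_to w \<in> A t \<omega>) \<and> (\<forall>w\<in>outer_boundary W. edge_to w \<notin> A t \<omega>)" if "\<omega> \<in> space M" for \<omega>
    using open_cluster_eq_cluster_at_root_iff[OF W, of "{w. edge_to w \<in> A t \<omega>}"] proc_eq_image[OF t that] by auto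
  ultimately show ?thesis unfolding pred_def by (simp cong: conj_cong)
qed

lemma proc_cluster_family_sets:
  assumes t: "t \<in> {0..1}" and S: "\<And>W. W \<in> S \<Longrightarrow> suffix_closed W"
  shows "{\<omega> \<in> space M. \<exists>W\<in>S. open_cluster (A t \<omega>) Root = cluster_at_root W} \<in> sets M"
proof -
  have "countable S" using countable_suffix_closed by (rule countable_subset[rotated]) (use S in blast)
  moreover have "{\<omega> \<in> space M. \<exists>W\<in>S. open_cluster (A t \<omega>) Root = cluster_at_root W}
      = (\<Union>W\<in>S. {\<omega> \<in> space M. open_cluster (A t \<omega>) Root = cluster_at_root W})" by blast
  ultimately show ?thesis using proc_cluster_sets[OF t] S by (auto intro: sets.countable_UN')
qed

lemma proc_cluster_family_measure:
  assumes t: "t \<in> {0..1}" and S: "\<And>W. W \<in> S \<Longrightarrow> suffix_closed W" "finite S"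
  shows "measure M {\<omega> \<in> space M. \<exists>W\<in>S. open_cluster (A t \<omega>) Root = cluster_at_root W}
    = (\<Sum>W\<in>S. measure M {\<omega> \<in> space M. open_cluster (A t \<omega>) Root = cluster_at_root W})"
proof -
  interpret prob_space M by (rule proc_prob_space)
  have "{\<omega> \<in> space M. \<exists>W\<in>S. open_cluster (A t \<omega>) Root = cluster_at_root W}
      = (\<Union>W\<in>S. {\<omega> \<in> space M. open_cluster (A t \<omega>) Root = cluster_at_root W})" by blast
  moreover have "disjoint_family_on (\<lambda>W. {\<omega> \<in> space M. open_cluster (A t \<omega>) Root = cluster_at_root W}) S"
    by (auto simp: disjoint_family_on_def)
  ultimately show ?thesis
    using finite_measure_finite_Union[OF S(2), of "\<lambda>W. {\<omega> \<in> space M. open_cluster (A t \<omega>) Root = cluster_at_root W}"]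
      proc_cluster_sets[OF t S(1)] by auto
qed

lemma proc_finite_cluster_iff:
  "open_cluster (A t \<omega>) Root \<in> finite_clusters \<longleftrightarrow> (\<exists>W. suffix_closed W \<and> open_cluster (A t \<omega>) Root = cluster_at_root W)"
  using cluster_eq_cluster_at_root[OF _ root_in_open_cluster] cluster_at_root_finite_cluster by metis

end

section \<open>Realised processes with parameter \<open>N\<close> and their root cluster\<close>

context freezing
begin

text \<open>The condition for an edge to open refers to its own clock and not to the observation
  time, so the trajectory is encoded by the clocks and the set \<open>Q\<close> of edges open at
  time 1. The rule then says that \<open>Q\<close> is a fixed point of \<open>step x\<close>, which
  is unique.\<close>

lemma dynamics_eq_opened_by:
  assumes wf: "wf_clocks x" and x: "\<And>w. 0 < x w \<and> x w \<le> 1" and xy: "\<And>w. y (edge_to w) = x w"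
    and rule: "\<forall>t\<in>{0..1}. F t = {(u, v) \<in> tree_edges. y (u, v) \<le> t \<and>
       (open_cluster (open_before F (y (u, v))) u \<in> finite_clusters \<and>
          s (open_cluster (open_before F (y (u, v))) u) < N) \<and>
       (open_cluster (open_before F (y (u, v))) v \<in> finite_clusters \<and>
          s (open_cluster (open_before F (y (u, v))) v) < N)}"
    and t: "t \<in> {0..1}"
  shows "F t = edge_to ` opened_by t x"
proof -
  define Q where "Q = {w. edge_to w \<in> F 1}"
  define g where "g w v \<longleftrightarrow> open_cluster (open_before F (x w)) v \<in> finite_clusters \<and>
      s (open_cluster (open_before F (x w)) v) < N" for w v
  have mem: "edge_to w \<in> F r \<longleftrightarrow> x w \<le> r \<and> g w (parent (Node w)) \<and> g w (Node w)" if r: "r \<in> {0..1}" for w r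
  proof -
    have e: "edge_to w \<in> tree_edges" by (simp add: tree_edges_edge_to)
    have "y (parent (Node w), Node w) = x w" using xy[of w] by (simp add: edge_to_def)
    then show ?thesis using e unfolding bspec[OF rule r] g_def by (simp add: edge_to_def)
  qed
  have Fr: "F r = edge_to ` {w \<in> Q. x w \<le> r}" if r: "r \<in> {0..1}" for r
  proof -
    have "F r \<subseteq> range edge_to" unfolding bspec[OF rule r] tree_edges_edge_to by blast
    moreover have "edge_to w \<in> F r \<longleftrightarrow> w \<in> {w \<in> Q. x w \<le> r}" for w
      using mem[OF r, of w] mem[of 1 w] x[of w] by (auto simp: Q_def)
    ultimately show ?thesis by blast
  qed
  have before: "open_before F (x w) = edge_to ` {f \<in> Q. x f < x w}" for w
  proof -
    have "e \<in> open_before F (x w) \<longleftrightarrow> e \<in> edge_to ` {f \<in> Q. x f < x w}" for e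
    proof
      assume "e \<in> open_before F (x w)"
      then obtain r where r: "0 \<le> r" "r < x w" "e \<in> F r" by (auto simp: open_before_def)
      then show "e \<in> edge_to ` {f \<in> Q. x f < x w}" using Fr[of r] x[of w] by auto
    next
      assume "e \<in> edge_to ` {f \<in> Q. x f < x w}"
      then obtain f where f: "e = edge_to f" "f \<in> Q" "x f < x w" by blast
      then have "e \<in> F (x f)" using Fr[of "x f"] x[of f] by auto
      then show "e \<in> open_before F (x w)" using f(3) x[of f] by (auto simp: open_before_def)
    qed
    then show ?thesis by blast
  qed
  have "w \<in> step x Q \<longleftrightarrow> w \<in> Q" for w
    using mem[of 1 w] x[of w] by (simp add: Q_def[symmetric] step_def growable_def g_def before) (simp add: Q_def)
  then have "step x Q = Q" by blast
  then have "Q = opened x" by (rule fixpoint_unique[OF wf])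
  then show ?thesis using Fr[OF t] by (simp add: opened_by_def)
qed

context
  fixes M and \<tau> :: "edge \<Rightarrow> 'a \<Rightarrow> real" and A
  assumes proc: "N_frozen_percolation s N M \<tau> A"
begin

lemma N_proc: "frozen_percolation (\<lambda>C. C \<in> finite_clusters \<and> s C < N) M \<tau> A"
  using proc by (simp add: N_frozen_percolation_def)

lemma AE_transfer:
  assumes "AE x in clocks. P x" shows "AE \<omega> in M. P (\<lambda>w. \<tau> (edge_to w) \<omega>)"
proof -
  have "prob_space M" "iid_uniform M \<tau>" using N_proc by (simp_all add: frozen_percolation_def)
  from distr_iid_uniform[OF this] show ?thesis using assms AE_distrD by metis
qed

lemma AE_proc_eq_opened_by:
  assumes t: "t \<in> {0..1}" shows "AE \<omega> in M. A t \<omega> = edge_to ` opened_by t (\<lambda>w. \<tau> (edge_to w) \<omega>)"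
proof -
  have "AE \<omega> in M. A 0 \<omega> = {} \<and> (\<forall>t\<in>{0..1}. A t \<omega> =
           {(u, v) \<in> tree_edges. \<tau> (u, v) \<omega> \<le> t \<and>
              (open_cluster (open_before (\<lambda>r. A r \<omega>) (\<tau> (u, v) \<omega>)) u \<in> finite_clusters \<and>
                s (open_cluster (open_before (\<lambda>r. A r \<omega>) (\<tau> (u, v) \<omega>)) u) < N) \<and>
              (open_cluster (open_before (\<lambda>r. A r \<omega>) (\<tau> (u, v) \<omega>)) v \<in> finite_clusters \<and>
                s (open_cluster (open_before (\<lambda>r. A r \<omega>) (\<tau> (u, v) \<omega>)) v) < N)})"
    using N_proc unfolding frozen_percolation_def by blast
  with AE_transfer[OF AE_wf_clocks] AE_transfer[OF AE_clocks_range] show ?thesis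
  proof eventually_elim
    case (elim \<omega>)
    show ?case
      by (rule dynamics_eq_opened_by[where F = "\<lambda>r. A r \<omega>" and y = "\<lambda>e. \<tau> e \<omega>"])
        (use elim t in \<open>auto simp only:\<close>)
  qed
qed

lemma AE_proc_finite:
  assumes t: "t \<in> {0..1}" shows "AE \<omega> in M. open_cluster (A t \<omega>) Root \<in> finite_clusters"
  using AE_proc_eq_opened_by[OF t] AE_transfer[OF AE_wf_clocks] AE_transfer[OF AE_clocks_inj]
proof eventually_elim
  case (elim \<omega>)
  show ?case
    unfolding elim(1) opened_by_def using opened_fixpoint[OF elim(2)] elim(3) by (rule finite_root_cluster)
qed

lemma proc_cluster_prob:
  assumes t: "t \<in> {0..1}" and W: "W \<in> root_family"
  shows "measure M {\<omega> \<in> space M. open_cluster (A t \<omega>) Root = cluster_at_root W} = t ^ card W * beta t ^ (card W + 1)"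
proof -
  interpret prob_space M by (rule proc_prob_space[OF N_proc])
  have sc: "suffix_closed W" "s (cluster_at_root W) < N" using W by (simp_all add: root_family_def)
  have iid: "prob_space M" "iid_uniform M \<tau>" using N_proc by (simp_all add: frozen_percolation_def)
  let ?X = "\<lambda>\<omega> w. \<tau> (edge_to w) \<omega>"
  let ?E = "{x. open_cluster (edge_to ` opened_by t x) Root = cluster_at_root W}"
  note X = distr_iid_uniform[OF iid]
  have E: "?E \<in> sets clocks" by (rule sets_root_cluster[OF sc(1)])
  have "measure M {\<omega> \<in> space M. open_cluster (A t \<omega>) Root = cluster_at_root W} = measure M (?X -` ?E \<inter> space M)"
  proof (rule finite_measure_eq_AE)
    show "AE \<omega> in M. \<omega> \<in> {\<omega> \<in> space M. open_cluster (A t \<omega>) Root = cluster_at_root W} \<longleftrightarrow> \<omega> \<in> ?X -` ?E \<inter> space M"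
      using AE_proc_eq_opened_by[OF t] by eventually_elim auto
    show "{\<omega> \<in> space M. open_cluster (A t \<omega>) Root = cluster_at_root W} \<in> sets M"
      by (rule proc_cluster_sets[OF N_proc t sc(1)])
    show "?X -` ?E \<inter> space M \<in> sets M" using X(1) E by (rule measurable_sets)
  qed
  also have "\<dots> = measure (distr M clocks ?X) ?E" using X(1) E by (rule measure_distr[symmetric])
  also have "\<dots> = t ^ card W * beta t ^ (card W + 1)"
    unfolding X(2) using t by (intro measure_root_cluster sc) auto
  finally show ?thesis .
qed

lemma proc_size_between:
  assumes t: "t \<in> {0..1}"
  shows "\<P>(\<omega> in M. open_cluster (A t \<omega>) Root \<in> finite_clusters \<and>
      k \<le> s (open_cluster (A t \<omega>) Root) \<and> s (open_cluster (A t \<omega>) Root) < N)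
    = (\<Sum>W\<in>{W \<in> root_family. k \<le> s (cluster_at_root W)}. t ^ card W * beta t ^ (card W + 1))"
proof -
  let ?S = "{W \<in> root_family. k \<le> s (cluster_at_root W)}"
  have "{\<omega> \<in> space M. open_cluster (A t \<omega>) Root \<in> finite_clusters \<and>
      k \<le> s (open_cluster (A t \<omega>) Root) \<and> s (open_cluster (A t \<omega>) Root) < N}
    = {\<omega> \<in> space M. \<exists>W\<in>?S. open_cluster (A t \<omega>) Root = cluster_at_root W}"
    unfolding proc_finite_cluster_iff[OF N_proc] by (auto simp: root_family_def)
  moreover have "measure M {\<omega> \<in> space M. \<exists>W\<in>?S. open_cluster (A t \<omega>) Root = cluster_at_root W}
      = (\<Sum>W\<in>?S. measure M {\<omega> \<in> space M. open_cluster (A t \<omega>) Root = cluster_at_root W})"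
  proof (rule proc_cluster_family_measure[OF N_proc t])
    show "finite ?S" using finite_root_family by simp
  qed (simp add: root_family_def)
  moreover have "\<dots> = (\<Sum>W\<in>?S. t ^ card W * beta t ^ (card W + 1))"
    by (intro sum.cong proc_cluster_prob[OF t]) auto
  ultimately show ?thesis by simp
qed

text \<open>The root cluster is finite almost surely, so being frozen is the complement of the
  finitely many events summed in \<open>total t\<close>.\<close>

lemma proc_frozen_prob:
  assumes t: "t \<in> {0..1}"
  shows "\<P>(\<omega> in M. open_cluster (A t \<omega>) Root \<in> finite_clusters \<and> N \<le> s (open_cluster (A t \<omega>) Root))
    = 1 - total t"
proof -
  interpret prob_space M by (rule proc_prob_space[OF N_proc])
  let ?B = "{\<omega> \<in> space M. \<exists>W\<in>root_family. open_cluster (A t \<omega>) Root = cluster_at_root W}"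
  let ?D = "{\<omega> \<in> space M. \<exists>W\<in>{W. suffix_closed W \<and> N \<le> s (cluster_at_root W)}. open_cluster (A t \<omega>) Root = cluster_at_root W}"
  have B: "?B \<in> sets M" by (rule proc_cluster_family_sets[OF N_proc t]) (simp add: root_family_def)
  have D: "?D \<in> sets M" by (rule proc_cluster_family_sets[OF N_proc t]) simp
  have "{\<omega> \<in> space M. open_cluster (A t \<omega>) Root \<in> finite_clusters \<and> N \<le> s (open_cluster (A t \<omega>) Root)} = ?D"
    unfolding proc_finite_cluster_iff[OF N_proc] by auto
  moreover have "measure M ?D = measure M (space M - ?B)"
  proof (rule finite_measure_eq_AE)
    show "AE \<omega> in M. \<omega> \<in> ?D \<longleftrightarrow> \<omega> \<in> space M - ?B"
      using AE_proc_finite[OF t]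
    proof eventually_elim
      case (elim \<omega>)
      then obtain W where "suffix_closed W" "open_cluster (A t \<omega>) Root = cluster_at_root W"
        unfolding proc_finite_cluster_iff[OF N_proc] by blast
      then show ?case by (auto simp: root_family_def)
    qed
  qed (use B D in auto)
  moreover have "measure M (space M - ?B) = 1 - measure M ?B" using B by (rule prob_compl)
  moreover have "measure M ?B = total t"
  proof -
    have "measure M ?B = (\<Sum>W\<in>root_family. measure M {\<omega> \<in> space M. open_cluster (A t \<omega>) Root = cluster_at_root W})"
      using finite_root_family by (intro proc_cluster_family_measure[OF N_proc t]) (auto simp: root_family_def)
    also have "\<dots> = total t"
      unfolding total_def by (intro sum.cong proc_cluster_prob[OF t]) auto
    finally show ?thesis .
  qed
  ultimately show ?thesis by simp
qed

end
end

section \<open>Limits as \<open>N\<close> tends to infinity\<close>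

context
  fixes s assumes gs: "good_size_function s"
begin

lemma freezing_Suc: "1 \<le> N \<Longrightarrow> freezing s N"
  using gs by unfold_locales auto

text \<open>Sizes are bounded by volumes, so a fixed finite family of clusters is unfrozen for all
  large \<open>N\<close>.\<close>

lemma eventually_suffix_closed_below: "\<forall>\<^sub>F N in sequentially. freezing s N \<and> suffix_closed_below n \<subseteq> freezing.root_family s N"
proof -
  define m where "m = Max (card ` suffix_closed_below n)"
  show ?thesis
    unfolding eventually_sequentially
  proof (intro exI allI impI)
    fix N assume N: "Suc m \<le> N"
    then interpret freezing s N by (intro freezing_Suc) simp
    have "W \<in> root_family" if "W \<in> suffix_closed_below n" for W
    proof (rule root_family_if_card)
      have "card W \<le> m" unfolding m_def using that finite_suffix_closed_below by (intro Max_ge) auto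
      then show "card W < N" using N by simp
    qed (use that in \<open>simp add: suffix_closed_below_def\<close>)
    then show "freezing s N \<and> suffix_closed_below n \<subseteq> freezing.root_family s N" using freezing_axioms by blast
  qed
qed

lemma sum_suffix_closed_below_scaled:
  "(\<Sum>W\<in>suffix_closed_below n. t ^ card W * b ^ (card W + 1)) = b * cluster_poly (t * b) n" for b :: real
  by (simp add: sum_suffix_closed_below[symmetric] sum_distrib_left power_mult_distrib mult_ac)

text \<open>If \<open>beta\<close> were at least \<open>b\<close>, the probabilities of a fixed
  finite family of clusters, unfrozen for large \<open>N\<close>, would already add up to more than
  1.\<close>

lemma eventually_beta_less:
  assumes t: "0 \<le> t" "t \<le> 1" and b: "beta_infinity t < b"
  shows "\<forall>\<^sub>F N in sequentially. freezing.beta s N t < b"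
proof -
  have b0: "0 \<le> b" using beta_infinity_nonneg[OF t] b by simp
  obtain n where n: "1 < b * cluster_poly (t * b) n"
    using le_beta_infinity[OF t b0] b by (meson not_le)
  show ?thesis using eventually_suffix_closed_below[of n]
  proof eventually_elim
    case (elim N)
    then interpret freezing s N by simp
    show ?case
    proof (rule ccontr)
      assume "\<not> beta t < b"
      then have "b \<le> beta t" by simp
      then have "(\<Sum>W\<in>suffix_closed_below n. t ^ card W * b ^ (card W + 1))
          \<le> (\<Sum>W\<in>suffix_closed_below n. t ^ card W * beta t ^ (card W + 1))"
        using t b0 by (intro sum_mono mult_left_mono power_mono) auto
      also have "\<dots> \<le> 1" using t elim by (intro root_cluster_total) auto
      finally show False using n unfolding sum_suffix_closed_below_scaled by simp
    qed
  qed
qed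

lemma eventually_freezing: "\<forall>\<^sub>F N in sequentially. freezing s N"
  using eventually_suffix_closed_below[of 0] by eventually_elim simp

lemma beta_tendsto:
  assumes t: "0 \<le> t" "t \<le> 1"
  shows "(\<lambda>N. freezing.beta s N t) \<longlonglongrightarrow> beta_infinity t"
proof (rule order_tendstoI)
  fix a assume a: "a < beta_infinity t"
  show "\<forall>\<^sub>F N in sequentially. a < freezing.beta s N t"
    using eventually_freezing
  proof eventually_elim
    case (elim N)
    then interpret freezing s N .
    show ?case using beta_infinity_le_beta[OF t] a by simp
  qed
qed (rule eventually_beta_less[OF t])

lemma sum_suffix_closed_below_le:
  assumes t: "0 \<le> t" "t \<le> 1" and "freezing s N"
  shows "beta_infinity t * cluster_poly (t * beta_infinity t) n
    \<le> (\<Sum>W\<in>suffix_closed_below n. t ^ card W * freezing.beta s N t ^ (card W + 1))"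
  unfolding sum_suffix_closed_below_scaled[symmetric]
  using freezing.beta_infinity_le_beta[OF assms(3) t] beta_infinity_nonneg[OF t] t
  by (intro sum_mono mult_left_mono power_mono) auto

text \<open>Truncated sums give the lower bound. For \<open>t \<le> 1/2\<close> the upper bound is
  trivial, as \<open>theta t = 1\<close>. Otherwise \<open>total_le\<close> is applied with
  \<open>r\<close> near \<open>t\<close> held fixed while \<open>N\<close> grows, so pointwise
  convergence of \<open>beta\<close> at \<open>r\<close> and \<open>t\<close> replaces any control
  of derivatives.\<close>

lemma total_tendsto:
  assumes t: "0 \<le> t" "t \<le> 1"
  shows "(\<lambda>N. freezing.total s N t) \<longlonglongrightarrow> theta t"
proof (rule order_tendstoI)
  fix a assume "a < theta t"
  then obtain n where n: "a < beta_infinity t * cluster_poly (t * beta_infinity t) n"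
    using order_tendstoD(1)[OF cluster_poly_theta[OF t]] by (meson eventually_happens sequentially_bot)
  show "\<forall>\<^sub>F N in sequentially. a < freezing.total s N t"
    using eventually_suffix_closed_below[of n]
  proof eventually_elim
    case (elim N)
    then interpret freezing s N by simp
    have "(\<Sum>W\<in>suffix_closed_below n. t ^ card W * beta t ^ (card W + 1)) \<le> total t"
      unfolding total_def using elim finite_root_family t beta_nonneg by (intro sum_mono2) auto
    then show ?case using n sum_suffix_closed_below_le[OF t, of N n] freezing_axioms by simp
  qed
next
  fix a assume a: "theta t < a"
  show "\<forall>\<^sub>F N in sequentially. freezing.total s N t < a"
  proof (cases "t \<le> 1/2")
    case True
    show ?thesis using eventually_freezing
    proof eventually_elim
      case (elim N)
      then interpret freezing s N .
      show ?case using total_le_1[OF t] a True by (simp add: theta_def)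
    qed
  next
    case False
    \<comment> \<open>For fixed \<open>r\<close> this expression is the limit of the bound in
      \<open>total_le\<close>; as \<open>r\<close> approaches \<open>t\<close> from the left it
      tends to \<open>1 / (2 * t) = theta t\<close>.\<close>
    have "((\<lambda>r. 1 / (4 * t) + 1 / (4 * r)) \<longlongrightarrow> 1 / (4 * t) + 1 / (4 * t)) (at_left t)"
      using False by (intro tendsto_intros) auto
    moreover have "1 / (4 * t) + 1 / (4 * t) < a" using a False by (simp add: theta_def)
    ultimately have "\<forall>\<^sub>F r in at_left t. 1 / (4 * t) + 1 / (4 * r) < a" by (rule order_tendstoD(2))
    moreover have "\<forall>\<^sub>F r in at_left t. r \<in> {1/2<..<t}" using False by (intro eventually_at_left_real) simp
    ultimately have "\<forall>\<^sub>F r in at_left t. 1 / (4 * t) + 1 / (4 * r) < a \<and> r \<in> {1/2<..<t}"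
      by (rule eventually_conj)
    then obtain r where r: "1 / (4 * t) + 1 / (4 * r) < a" "1/2 < r" "r < t"
      using eventually_happens[of _ "at_left t"] by (auto simp: trivial_limit_at_left_real)
    let ?f = "\<lambda>N. freezing.beta s N t + t * ((freezing.beta s N r - freezing.beta s N t) / (t - r))"
    have "?f \<longlonglongrightarrow> beta_infinity t + t * ((beta_infinity r - beta_infinity t) / (t - r))"
      using t r by (intro tendsto_intros beta_tendsto) auto
    moreover have "beta_infinity t + t * ((beta_infinity r - beta_infinity t) / (t - r)) = 1 / (4 * t) + 1 / (4 * r)"
    proof -
      have "beta_infinity r - beta_infinity t = (t - r) / (4 * r * t)"
        using r by (simp add: beta_infinity_def field_simps)
      then show ?thesis using r by (simp add: beta_infinity_def)
    qed
    ultimately have "\<forall>\<^sub>F N in sequentially. ?f N < a" using r(1) by (intro order_tendstoD(2)) auto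
    then show ?thesis using eventually_freezing
    proof eventually_elim
      case (elim N)
      then interpret freezing s N by simp
      show ?case using total_le[of r t] elim(1) r t by simp
    qed
  qed
qed

text \<open>The unfrozen mass outside a fixed finite family is \<open>total\<close> minus the mass
  of the family. The former is eventually below \<open>theta t + e / 2\<close> and the latter above
  \<open>theta t - e / 2\<close>, so clusters of size at least \<open>k\<close> are left with less
  than \<open>e\<close>.\<close>

lemma eventually_size_between:
  assumes t: "0 \<le> t" "t \<le> 1" and e: "0 < e"
  shows "\<forall>\<^sub>F k in sequentially. \<forall>\<^sub>F N in sequentially.
    (\<Sum>W\<in>{W \<in> freezing.root_family s N. k \<le> s (cluster_at_root W)}. t ^ card W * freezing.beta s N t ^ (card W + 1)) < e"
proof -
  have "theta t - e / 2 < theta t" using e by simp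
  then obtain n where n: "theta t - e / 2 < beta_infinity t * cluster_poly (t * beta_infinity t) n"
    using order_tendstoD(1)[OF cluster_poly_theta[OF t]] by (meson eventually_happens sequentially_bot)
  have tot: "\<forall>\<^sub>F N in sequentially. freezing.total s N t < theta t + e / 2"
    using total_tendsto[OF t] e by (intro order_tendstoD(2)) auto
  \<comment> \<open>\<open>root_family\<close> appears with \<open>k\<close> in place of
    \<open>N\<close>, to express that every cluster of the family has size below
    \<open>k\<close>.\<close>
  have "\<forall>\<^sub>F k in sequentially. suffix_closed_below n \<subseteq> freezing.root_family s k"
    using eventually_suffix_closed_below[of n] by eventually_elim simp
  then show ?thesis
    using eventually_freezing
  proof eventually_elim
    case (elim k)
    have small: "s (cluster_at_root W) < k" if "W \<in> suffix_closed_below n" for W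
      using elim that freezing.root_family_def[OF elim(2)] by blast
    show ?case using tot eventually_suffix_closed_below[of n]
    proof eventually_elim
      case (elim N)
      then interpret freezing s N by simp
      let ?f = "\<lambda>W. t ^ card W * beta t ^ (card W + 1)"
      have nn: "0 \<le> ?f W" for W using t beta_nonneg by simp
      have sub: "suffix_closed_below n \<subseteq> root_family" using elim by simp
      have "sum ?f {W \<in> root_family. k \<le> s (cluster_at_root W)} \<le> sum ?f (root_family - suffix_closed_below n)"
      proof (rule sum_mono2)
        show "{W \<in> root_family. k \<le> s (cluster_at_root W)} \<subseteq> root_family - suffix_closed_below n" using small leD by blast
      qed (use finite_root_family nn in auto)
      also have "\<dots> = total t - sum ?f (suffix_closed_below n)"
        unfolding total_def using finite_root_family sub by (rule sum_diff)
      also have "\<dots> < e" using elim(1) n sum_suffix_closed_below_le[OF t freezing_axioms, of n] by simp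
      finally show ?case .
    qed
  qed
qed

end

text \<open>The events \<open>B n\<close> exhaust the finite root clusters as the height bound
  grows, so the given marginals sum to \<open>theta t\<close>, the limit of the scaled
  polynomials.\<close>

lemma Aldous_infinite_cluster:
  assumes proc: "infinite_frozen_percolation M \<tau> A" and ald: "Aldous_marginals M A" and t: "t \<in> {0..1}"
  shows "\<P>(\<omega> in M. infinite (snd (open_cluster (A t \<omega>) Root))) = 1 - theta t"
proof -
  have N_proc: "frozen_percolation (\<lambda>C. C \<in> finite_clusters) M \<tau> A"
    using proc by (simp add: infinite_frozen_percolation_def)
  interpret prob_space M by (rule proc_prob_space[OF N_proc])
  define B where "B n = {\<omega> \<in> space M. \<exists>W\<in>suffix_closed_below n. open_cluster (A t \<omega>) Root = cluster_at_root W}" for n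
  have sc: "suffix_closed W" if "W \<in> suffix_closed_below n" for W n using that by (simp add: suffix_closed_below_def)
  have B: "B n \<in> sets M" for n unfolding B_def by (rule proc_cluster_family_sets[OF N_proc t sc])
  have "measure M (B n) = beta_infinity t * cluster_poly (t * beta_infinity t) n" for n
  proof -
    have "measure M (B n) = (\<Sum>W\<in>suffix_closed_below n. measure M {\<omega> \<in> space M. open_cluster (A t \<omega>) Root = cluster_at_root W})"
      unfolding B_def by (rule proc_cluster_family_measure[OF N_proc t sc finite_suffix_closed_below])
    also have "\<dots> = (\<Sum>W\<in>suffix_closed_below n. beta_infinity t * (t * beta_infinity t) ^ card W)"
    proof (rule sum.cong)
      fix W assume "W \<in> suffix_closed_below n"
      then have "cluster_at_root W \<in> finite_clusters" "Root \<in> fst (cluster_at_root W)"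
        using cluster_at_root_finite_cluster[OF sc] by (auto simp: cluster_at_root_def)
      then show "measure M {\<omega> \<in> space M. open_cluster (A t \<omega>) Root = cluster_at_root W}
          = beta_infinity t * (t * beta_infinity t) ^ card W"
        using ald t unfolding Aldous_marginals_def by (simp add: volume_cluster_at_root)
    qed simp
    finally show ?thesis by (simp add: sum_suffix_closed_below[symmetric] sum_distrib_left)
  qed
  moreover have "(\<lambda>n. measure M (B n)) \<longlonglongrightarrow> measure M (\<Union>n. B n)"
  proof (rule finite_Lim_measure_incseq)
    show "incseq B" by (rule incseq_SucI) (fastforce simp: B_def suffix_closed_below_def)
  qed (use B in auto)
  moreover have "(\<lambda>n. beta_infinity t * cluster_poly (t * beta_infinity t) n) \<longlonglongrightarrow> theta t"
    using t by (intro cluster_poly_theta) auto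
  ultimately have "measure M (\<Union>n. B n) = theta t" using LIMSEQ_unique by simp
  moreover have "{\<omega> \<in> space M. infinite (snd (open_cluster (A t \<omega>) Root))} = space M - (\<Union>n. B n)"
  proof -
    have "finite (snd (open_cluster (A t \<omega>) Root)) \<longleftrightarrow> \<omega> \<in> (\<Union>n. B n)" if \<omega>: "\<omega> \<in> space M" for \<omega>
    proof -
      have "finite (snd (open_cluster (A t \<omega>) Root)) \<longleftrightarrow> open_cluster (A t \<omega>) Root \<in> finite_clusters"
        by (subst (1 2) proc_eq_image[OF N_proc t \<omega>]) (rule finite_root_cluster_iff)
      also have "\<dots> \<longleftrightarrow> (\<exists>W. suffix_closed W \<and> open_cluster (A t \<omega>) Root = cluster_at_root W)"
        by (rule proc_finite_cluster_iff[OF N_proc])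
      also have "\<dots> \<longleftrightarrow> \<omega> \<in> (\<Union>n. B n)"
      proof
        assume "\<exists>W. suffix_closed W \<and> open_cluster (A t \<omega>) Root = cluster_at_root W"
        then obtain W where W: "suffix_closed W" "open_cluster (A t \<omega>) Root = cluster_at_root W" by blast
        obtain n where "{W} \<subseteq> suffix_closed_below n" by (rule finite_subset_suffix_closed_below[of "{W}"]) (use W in auto)
        then show "\<omega> \<in> (\<Union>n. B n)" using W \<omega> by (auto simp: B_def)
      next
        assume "\<omega> \<in> (\<Union>n. B n)"
        then show "\<exists>W. suffix_closed W \<and> open_cluster (A t \<omega>) Root = cluster_at_root W" using sc by (auto simp: B_def)
      qed
      finally show ?thesis .
    qed
    then show ?thesis by blast
  qed
  moreover have "measure M (space M - (\<Union>n. B n)) = 1 - measure M (\<Union>n. B n)"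
    using B by (intro prob_compl) auto
  ultimately show ?thesis by simp
qed

theorem theorem2:
  fixes s :: "subgraph \<Rightarrow> nat" and t :: real
    and M :: "nat \<Rightarrow> 'a measure" and \<tau> :: "nat \<Rightarrow> edge \<Rightarrow> 'a \<Rightarrow> real"
    and A :: "nat \<Rightarrow> real \<Rightarrow> 'a \<Rightarrow> edge set"
    and M_inf :: "'b measure" and \<tau>_inf :: "edge \<Rightarrow> 'b \<Rightarrow> real"
    and A_inf :: "real \<Rightarrow> 'b \<Rightarrow> edge set"
  assumes "good_size_function s" and "t \<in> {0..1}"
    and "\<And>N. N \<ge> 1 \<Longrightarrow> N_frozen_percolation s N (M N) (\<tau> N) (A N)"
    and "infinite_frozen_percolation M_inf \<tau>_inf A_inf"
    and "Aldous_marginals M_inf A_inf"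
  shows "(\<forall>C\<in>finite_clusters.
            (\<lambda>N. \<P>(\<omega> in M N. open_cluster (A N t \<omega>) Root = C))
              \<longlonglongrightarrow> \<P>(\<omega> in M_inf. open_cluster (A_inf t \<omega>) Root = C)) \<and>
         (\<lambda>k. limsup (\<lambda>N. ereal (\<P>(\<omega> in M N.
              open_cluster (A N t \<omega>) Root \<in> finite_clusters \<and>
              k \<le> s (open_cluster (A N t \<omega>) Root) \<and> s (open_cluster (A N t \<omega>) Root) < N))))
            \<longlonglongrightarrow> 0 \<and>
         (\<lambda>N. \<P>(\<omega> in M N.
              open_cluster (A N t \<omega>) Root \<in> finite_clusters \<and>
              N \<le> s (open_cluster (A N t \<omega>) Root)))
            \<longlonglongrightarrow> \<P>(\<omega> in M_inf. infinite (snd (open_cluster (A_inf t \<omega>) Root)))"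
proof (intro conjI ballI)
  note gs = assms(1) and t = assms(2) and proc = assms(3)
  have t01: "0 \<le> t" "t \<le> 1" using t by auto
  note fr = freezing_Suc[OF gs]
  have ge1: "\<forall>\<^sub>F N in sequentially. (1::nat) \<le> N" by (rule eventually_ge_at_top)
  fix C assume C: "C \<in> finite_clusters"
  show "(\<lambda>N. \<P>(\<omega> in M N. open_cluster (A N t \<omega>) Root = C))
      \<longlonglongrightarrow> \<P>(\<omega> in M_inf. open_cluster (A_inf t \<omega>) Root = C)"
  proof (cases "Root \<in> fst C")
    case True
    then obtain W where W: "suffix_closed W" "C = cluster_at_root W" using cluster_eq_cluster_at_root[OF C] by blast
    obtain n where n: "{W} \<subseteq> suffix_closed_below n" by (rule finite_subset_suffix_closed_below[of "{W}"]) (use W in auto)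
    have "\<forall>\<^sub>F N in sequentially. t ^ card W * freezing.beta s N t ^ (card W + 1)
        = \<P>(\<omega> in M N. open_cluster (A N t \<omega>) Root = C)"
      using eventually_suffix_closed_below[OF gs, of n] ge1
    proof eventually_elim
      case (elim N)
      then have "W \<in> freezing.root_family s N" using n by blast
      then show ?case unfolding W(2)
        by (intro freezing.proc_cluster_prob[OF fr proc t, symmetric] elim)
    qed
    moreover have "(\<lambda>N. t ^ card W * freezing.beta s N t ^ (card W + 1))
        \<longlonglongrightarrow> t ^ card W * beta_infinity t ^ (card W + 1)"
      by (intro tendsto_intros beta_tendsto[OF gs t01])
    moreover have "\<P>(\<omega> in M_inf. open_cluster (A_inf t \<omega>) Root = C) = t ^ card W * beta_infinity t ^ (card W + 1)"
    proof -
      have "\<P>(\<omega> in M_inf. open_cluster (A_inf t \<omega>) Root = C) = beta_infinity t * (t * beta_infinity t) ^ volume C"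
        using assms(5) t C True unfolding Aldous_marginals_def by blast
      then show ?thesis by (simp add: W(2) volume_cluster_at_root power_mult_distrib)
    qed
    ultimately show ?thesis using Lim_transform_eventually by fastforce
  next
    case False
    \<comment> \<open>The root cluster always contains \<open>Root\<close>, so both sides of the
      limit are 0.\<close>
    then have "open_cluster F Root \<noteq> C" for F using root_in_open_cluster by blast
    then show ?thesis by simp
  qed
next
  note gs = assms(1) and t = assms(2) and proc = assms(3)
  have t01: "0 \<le> t" "t \<le> 1" using t by auto
  note fr = freezing_Suc[OF gs]
  have ge1: "\<forall>\<^sub>F N in sequentially. (1::nat) \<le> N" by (rule eventually_ge_at_top)
  let ?P = "\<lambda>k N. \<P>(\<omega> in M N. open_cluster (A N t \<omega>) Root \<in> finite_clusters \<and>
              k \<le> s (open_cluster (A N t \<omega>) Root) \<and> s (open_cluster (A N t \<omega>) Root) < N)"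
  show "(\<lambda>k. limsup (\<lambda>N. ereal (?P k N))) \<longlonglongrightarrow> 0"
  proof (rule order_tendstoI)
    fix a :: ereal assume "a < 0"
    moreover have "0 \<le> limsup (\<lambda>N. ereal (?P k N))" for k
      by (intro le_Limsup) auto
    ultimately show "\<forall>\<^sub>F k in sequentially. a < limsup (\<lambda>N. ereal (?P k N))"
      by (intro always_eventually allI) (rule less_le_trans)
  next
    fix a :: ereal assume "0 < a"
    \<comment> \<open>\<open>a\<close> is an extended real and may be infinite, so a real threshold
      below it is inserted.\<close>
    then obtain e where e: "0 < e" "ereal e < a"
      using ereal_dense2[of 0 a] by auto
    show "\<forall>\<^sub>F k in sequentially. limsup (\<lambda>N. ereal (?P k N)) < a"
      using eventually_size_between[OF gs t01 e(1)]
    proof eventually_elim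
      case (elim k)
      then have "\<forall>\<^sub>F N in sequentially. ereal (?P k N) \<le> ereal e"
        using ge1
      proof eventually_elim
        case (elim N)
        show ?case using freezing.proc_size_between[OF fr proc t, OF elim(2) elim(2), of k] elim(1) by simp
      qed
      then have "limsup (\<lambda>N. ereal (?P k N)) \<le> ereal e" by (rule Limsup_bounded)
      then show ?case using e(2) by (rule le_less_trans)
    qed
  qed
  have "\<forall>\<^sub>F N in sequentially. 1 - freezing.total s N t
      = \<P>(\<omega> in M N. open_cluster (A N t \<omega>) Root \<in> finite_clusters \<and> N \<le> s (open_cluster (A N t \<omega>) Root))"
    using ge1
  proof eventually_elim
    case (elim N)
    show ?case by (rule freezing.proc_frozen_prob[OF fr proc t, symmetric]) (rule elim)+
  qed
  moreover have "(\<lambda>N. 1 - freezing.total s N t) \<longlonglongrightarrow> 1 - theta t"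
    by (intro tendsto_intros total_tendsto[OF gs t01])
  ultimately show "(\<lambda>N. \<P>(\<omega> in M N. open_cluster (A N t \<omega>) Root \<in> finite_clusters \<and>
        N \<le> s (open_cluster (A N t \<omega>) Root)))
      \<longlonglongrightarrow> \<P>(\<omega> in M_inf. infinite (snd (open_cluster (A_inf t \<omega>) Root)))"
    unfolding Aldous_infinite_cluster[OF assms(4,5) t] by (rule Lim_transform_eventually[rotated])
qed

end
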